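(* Let $\underline{s}=(s_k)_{k\ge 0}$ be a bounded sequence of positive integers and put $\sigma=\sigma(\underline{s})=1/\limsup_{k\to\infty}[s_{k+1};s_k,\dots,s_1]$. There exists a set $\Delta_{\underline{s}}\subset[0,\frac{\sigma}{1+\sigma}]$ which contains $0$ and is dense in the interval $[0,\frac{\sigma}{1+\sigma}]$, such that for each $\delta\in\Delta_{\underline{s}}$ there is a real number $\xi$, of Sturmian type associated to $\underline{s}$, satisfying $$\omega_2(\xi)=\frac{2-\delta}{\sigma}+1-\delta,\qquad \widehat{\omega}_2(\xi)=1+(1-\delta)(1+\sigma),$$ $$\widehat{\lambda}_2(\xi)=\frac{(1-\delta)(1+\sigma)}{1+(1-\delta)(1+\sigma)},\qquad 1-\delta\le\lambda_2(\xi)\le\max\Big(1-\delta,\frac{1}{1-\delta+\sigma}\Big).$$ Moreover, if $\delta\in[0,h(\sigma)]$ with $$h(\sigma)=\frac{\sigma}{2}+1-\sqrt{\Big(\frac{\sigma}{2}\Big)^2+1}\;\le\;\frac{\sigma}{1+\sigma},$$ then $\lambda_2(\xi)=1-\delta$.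
   Context: $[a_0;a_1,a_2,\dots]$ denotes the continued fraction with partial quotients $a_0,a_1,a_2,\dots$. Exponents. Let $\xi\in\mathbb{R}$ be not algebraic of degree $\le 2$. $\omega_2(\xi)$ (resp. $\widehat\omega_2(\xi)$) is the supremum of the real $\omega$ such that, for arbitrarily large $X$ (resp. for all sufficiently large $X$), there is a non-zero $(x_0,x_1,x_2)\in\mathbb{Z}^3$ with $|x_0+x_1\xi+x_2\xi^2|\le X^{-\omega}$ and $\max(|x_1|,|x_2|)\le X$. $\lambda_2(\xi)$ (resp. $\widehat\lambda_2(\xi)$) is the supremum of the real $\lambda$ such that, for arbitrarily large $X$ (resp. for all sufficiently large $X$), there is a non-zero $(x_0,x_1,x_2)\in\mathbb{Z}^3$ with $|x_0|\le X$ and $\max(|x_0\xi-x_1|,|x_0\xi^2-x_2|)\le X^{-\lambda}$. Numbers of Sturmian type associated to $\underline{s}$. Redefine $s_0=-1$, $s_1=1$ (this does not affect $\sigma$) and keep $s_k$ for $k\ge2$; put $t_k=s_0+\dots+s_k$. Let $\psi$ be the function on $\{0,1,2,\dots\}$ with $\psi(t_k)=t_{k-1}-1$ for $k\ge1$ and $\psi(i)=i-1$ if $i$ is not among the $t_k$. Let $\mathcal{M}$ be the monoid of $2\times2$ integer matrices with non-zero determinant, and let $\|w\|$ be the maximum of the absolute values of the entries of a matrix $w$. A $\psi$-Sturmian sequence in $\mathcal{M}$ is a sequence $(w_i)_{i\ge0}$ in $\mathcal{M}$ with $w_{i+1}=w_i^{s_{i+1}}w_{i-1}$ for $i\ge1$.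 It is admissible if there is $N\in\mathcal{M}$ such that $w_1N$, $w_0{}^tN$ and $w_1w_0{}^tN$ are symmetric. It has multiplicative growth if there are $c_1,c_2>0$ with $c_1\|w_k\|\,\|w_k^{l-1}w_{k-1}\|\le\|w_k^lw_{k-1}\|\le c_2\|w_k\|\,\|w_k^{l-1}w_{k-1}\|$ for all $k\ge1$, $1\le l\le s_{k+1}+1$. Given such an admissible sequence with matrix $N$, put $N_k=N$ for $k$ even, $N_k={}^tN$ for $k$ odd, $y_{-2}=w_0{}^tN$, $y_{-1}=w_1N$, and $y_{t_k+l}=w_k^{l+1}w_{k-1}N_k$ for $k\ge1$, $0\le l<s_{k+1}$; these are symmetric matrices, identified with points of $\mathbb{Z}^3$ through $(x_0,x_1,x_2)\leftrightarrow\begin{pmatrix} x_0 & x_1 \\ x_1 & x_2 \end{pmatrix}$. The content of an integer point is the gcd of its coordinates. A real number $\xi$ is of Sturmian type associated to $\underline{s}$ if there is an admissible $\psi$-Sturmian sequence $(w_i)$ in $\mathcal{M}$ with multiplicative growth and with a non-symmetric matrix $N$, such that $\|w_i\|\to\infty$, the contents of the $y_i$ are bounded, the real number $\delta\ge0$ with $|\det w_i|\asymp\|w_i\|^{\delta}$ (i.e. the ratio of both sides is bounded above and below by positive constants) satisfies $\delta<\sigma/(1+\sigma)$, and $(y_i)$ converges in $\mathbb{P}^2(\mathbb{R})$ to the class of $(1,\xi,\xi^2)$. (Such a $\xi$ is not algebraic of degree $\le2$.) *)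

theory Defs
  imports "HOL-Analysis.Analysis"
begin

section \<open>Continued fractions and \<open>\<sigma>\<close>\<close>

text \<open>\<open>contfrac [a\<^sub>0, \<dots>, a\<^sub>n]\<close> is the finite continued fraction
  \<open>[a\<^sub>0; a\<^sub>1, \<dots>, a\<^sub>n]\<close>; the value at the empty list is a dummy.\<close>

fun contfrac :: "real list \<Rightarrow> real" where
  "contfrac [] = 0"
| "contfrac [a] = a"
| "contfrac (a # b # as) = a + 1 / contfrac (b # as)"

text \<open>The list below is \<open>[s (k + 1), s k, \<dots>, s 1]\<close>. The limit superior is taken in \<^typ>\<open>ereal\<close>;
  it is finite and at least 1 when \<open>s\<close> is bounded and positive.\<close>

definition sturm_sigma :: "(nat \<Rightarrow> nat) \<Rightarrow> real" where
  "sturm_sigma s =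
     1 / real_of_ereal (limsup (\<lambda>k. ereal (contfrac (map (\<lambda>i. real (s i)) (rev [1..<k + 2])))))"


section \<open>Exponents of Diophantine approximation\<close>

text \<open>Suprema are taken in \<^typ>\<open>ereal\<close> because the exponents may be infinite.\<close>

definition omega2_sol :: "real \<Rightarrow> real \<Rightarrow> real \<Rightarrow> bool" where
  "omega2_sol \<xi> \<omega> X \<longleftrightarrow>
     (\<exists>x0 x1 x2 :: int. (x0, x1, x2) \<noteq> (0, 0, 0) \<and>
        \<bar>of_int x0 + of_int x1 * \<xi> + of_int x2 * \<xi>\<^sup>2\<bar> \<le> X powr (- \<omega>) \<and>
        max \<bar>of_int x1\<bar> \<bar>of_int x2\<bar> \<le> X)"

definition lambda2_sol :: "real \<Rightarrow> real \<Rightarrow> real \<Rightarrow> bool" where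
  "lambda2_sol \<xi> \<mu> X \<longleftrightarrow>
     (\<exists>x0 x1 x2 :: int. (x0, x1, x2) \<noteq> (0, 0, 0) \<and>
        \<bar>of_int x0\<bar> \<le> X \<and>
        max \<bar>of_int x0 * \<xi> - of_int x1\<bar> \<bar>of_int x0 * \<xi>\<^sup>2 - of_int x2\<bar> \<le> X powr (- \<mu>))"

definition omega2 :: "real \<Rightarrow> ereal" where
  "omega2 \<xi> = Sup (ereal ` {\<omega>. \<exists>\<^sub>F X in at_top. omega2_sol \<xi> \<omega> X})"

definition omega2_hat :: "real \<Rightarrow> ereal" where
  "omega2_hat \<xi> = Sup (ereal ` {\<omega>. \<forall>\<^sub>F X in at_top. omega2_sol \<xi> \<omega> X})"

definition lambda2 :: "real \<Rightarrow> ereal" where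
  "lambda2 \<xi> = Sup (ereal ` {\<mu>. \<exists>\<^sub>F X in at_top. lambda2_sol \<xi> \<mu> X})"

definition lambda2_hat :: "real \<Rightarrow> ereal" where
  "lambda2_hat \<xi> = Sup (ereal ` {\<mu>. \<forall>\<^sub>F X in at_top. lambda2_sol \<xi> \<mu> X})"


section \<open>The real projective plane\<close>

text \<open>Points are the classes of non-zero vectors under non-zero scaling, and the topology is the
  quotient topology. The class of \<open>0\<close> is not a point of the space.\<close>

definition proj_class :: "real^3 \<Rightarrow> (real^3) set" where
  "proj_class x = {c *\<^sub>R x | c. c \<noteq> 0}"

definition proj_plane :: "(real^3) set topology" where
  "proj_plane = topology (\<lambda>U. U \<subseteq> proj_class ` (- {0}) \<and> open {x. x \<noteq> 0 \<and> proj_class x \<in> U})"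

lemma openin_proj_plane:
  "openin proj_plane U \<longleftrightarrow> U \<subseteq> proj_class ` (- {0}) \<and> open {x. x \<noteq> 0 \<and> proj_class x \<in> U}"
proof -
  have int: "{x. x \<noteq> 0 \<and> proj_class x \<in> S \<inter> T} =
      {x. x \<noteq> 0 \<and> proj_class x \<in> S} \<inter> {x. x \<noteq> 0 \<and> proj_class x \<in> T}" for S T
    by blast
  have un: "{x. x \<noteq> 0 \<and> proj_class x \<in> \<Union>\<K>} = (\<Union>K\<in>\<K>. {x. x \<noteq> 0 \<and> proj_class x \<in> K})" for \<K>
    by blast
  have "istopology (\<lambda>U. U \<subseteq> proj_class ` (- {0}) \<and> open {x. x \<noteq> 0 \<and> proj_class x \<in> U})"
    unfolding istopology_def int un by (intro conjI allI impI open_Int open_UN) blast+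
  then show ?thesis
    by (simp add: proj_plane_def)
qed

lemma topspace_proj_plane: "topspace proj_plane = proj_class ` (- {0})"
proof -
  have "{x. x \<noteq> 0 \<and> proj_class x \<in> proj_class ` (- {0})} = - {0}"
    by auto
  then have "openin proj_plane (proj_class ` (- {0}))"
    by (simp add: openin_proj_plane open_Compl)
  then have "proj_class ` (- {0}) \<subseteq> topspace proj_plane"
    by (rule openin_subset)
  moreover have "topspace proj_plane \<subseteq> proj_class ` (- {0})"
    using openin_topspace[of proj_plane] unfolding openin_proj_plane by (rule conjunct1)
  ultimately show ?thesis
    by (rule equalityI[rotated])
qed

lemma quotient_map_proj_class:
  "quotient_map (top_of_set (- {0})) proj_plane proj_class"
proof -
  have "openin (top_of_set (- {0 :: real^3})) {x \<in> topspace (top_of_set (- {0})). proj_class x \<in> U} \<longleftrightarrow>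
      openin proj_plane U" if "U \<subseteq> topspace proj_plane" for U
  proof -
    have set: "{x \<in> topspace (top_of_set (- {0})). proj_class x \<in> U} = {x. x \<noteq> 0 \<and> proj_class x \<in> U}"
      by simp
    have "{x. x \<noteq> 0 \<and> proj_class x \<in> U} \<subseteq> - {0}"
      by blast
    moreover have "open (- {0 :: real^3})"
      by (rule open_Compl) simp
    ultimately show ?thesis
      using that unfolding set openin_proj_plane topspace_proj_plane
      by (simp only: openin_open_eq simp_thms)
  qed
  then show ?thesis
    unfolding quotient_map_def by (simp add: topspace_proj_plane)
qed


section \<open>Sturmian sequences of matrices\<close>

text \<open>On \<^typ>\<open>int^2^2\<close> the operations \<open>*\<close> and \<open>^\<close> act entrywise, so matrix powers need
  their own definition.\<close>

definition mat_power :: "int^2^2 \<Rightarrow> nat \<Rightarrow> int^2^2" where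
  "mat_power w n = (((**) w) ^^ n) (mat 1)"

definition mat_norm :: "int^2^2 \<Rightarrow> real" where
  "mat_norm w = real_of_int (Max {\<bar>w $ i $ j\<bar> | i j. True})"

definition symmetric_mat :: "int^2^2 \<Rightarrow> bool" where
  "symmetric_mat w \<longleftrightarrow> transpose w = w"

definition matM :: "(int^2^2) set" where
  "matM = {w. det w \<noteq> 0}"

text \<open>The sequence \<open>s\<close> with \<open>s 0\<close> and \<open>s 1\<close> redefined, and the partial sums of the new sequence:
  \<open>sturm_t s 0 = - 1\<close>, \<open>sturm_t s 1 = 0\<close>, \<open>sturm_t s 2 = s 2\<close>, and so on.\<close>

definition sturm_s :: "(nat \<Rightarrow> nat) \<Rightarrow> nat \<Rightarrow> int" where
  "sturm_s s k = (if k = 0 then - 1 else if k = 1 then 1 else int (s k))"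

definition sturm_t :: "(nat \<Rightarrow> nat) \<Rightarrow> nat \<Rightarrow> int" where
  "sturm_t s k = (\<Sum>i\<le>k. sturm_s s i)"

text \<open>The next definitions refer to \<open>s (k + 1)\<close> only for \<open>k \<ge> 1\<close>, where it agrees with
  \<open>sturm_s s (k + 1)\<close>. The combinatorial function \<open>\<psi>\<close> determined by \<open>s\<close>, after which
  \<open>\<psi>\<close>-Sturmian sequences are named, enters only through \<open>s\<close> and \<open>sturm_t s\<close>.\<close>

definition sturmian_seq :: "(nat \<Rightarrow> nat) \<Rightarrow> (nat \<Rightarrow> int^2^2) \<Rightarrow> bool" where
  "sturmian_seq s w \<longleftrightarrow>
     (\<forall>i. w i \<in> matM) \<and> (\<forall>i\<ge>1. w (i + 1) = mat_power (w i) (s (i + 1)) ** w (i - 1))"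

definition admissible_with :: "(nat \<Rightarrow> int^2^2) \<Rightarrow> int^2^2 \<Rightarrow> bool" where
  "admissible_with w N \<longleftrightarrow>
     N \<in> matM \<and> symmetric_mat (w 1 ** N) \<and> symmetric_mat (w 0 ** transpose N) \<and>
     symmetric_mat (w 1 ** w 0 ** transpose N)"

definition multiplicative_growth :: "(nat \<Rightarrow> nat) \<Rightarrow> (nat \<Rightarrow> int^2^2) \<Rightarrow> bool" where
  "multiplicative_growth s w \<longleftrightarrow>
     (\<exists>c1>0. \<exists>c2>0. \<forall>k\<ge>1. \<forall>l. 1 \<le> l \<and> l \<le> s (k + 1) + 1 \<longrightarrow>
        c1 * mat_norm (w k) * mat_norm (mat_power (w k) (l - 1) ** w (k - 1))
          \<le> mat_norm (mat_power (w k) l ** w (k - 1)) \<and>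
        mat_norm (mat_power (w k) l ** w (k - 1))
          \<le> c2 * mat_norm (w k) * mat_norm (mat_power (w k) (l - 1) ** w (k - 1)))"

text \<open>\<open>associated_points s w N y\<close> says that \<open>y\<close> is the sequence \<open>(y\<^sub>i)\<close>, \<open>i \<ge> - 2\<close>, attached to
  \<open>w\<close> and \<open>N\<close>. For positive \<open>s\<close>, each integer \<open>i \<ge> 0\<close> is uniquely of the form
  \<open>sturm_t s k + l\<close> with \<open>k \<ge> 1\<close> and \<open>0 \<le> l < s (k + 1)\<close>, so the conditions determine
  \<open>y i\<close> for all \<open>i \<ge> - 2\<close>. The values of \<open>y\<close> at smaller indices are irrelevant.\<close>

definition associated_points ::
    "(nat \<Rightarrow> nat) \<Rightarrow> (nat \<Rightarrow> int^2^2) \<Rightarrow> int^2^2 \<Rightarrow> (int \<Rightarrow> int^2^2) \<Rightarrow> bool" where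
  "associated_points s w N y \<longleftrightarrow>
     y (- 2) = w 0 ** transpose N \<and> y (- 1) = w 1 ** N \<and>
     (\<forall>k\<ge>1. \<forall>l<s (k + 1). y (sturm_t s k + int l) =
        mat_power (w k) (l + 1) ** w (k - 1) ** (if even k then N else transpose N))"

text \<open>A symmetric matrix is identified with the point given by its entries at positions
  \<open>(1,1)\<close>, \<open>(1,2)\<close>, \<open>(2,2)\<close>.\<close>

definition point_content :: "int^2^2 \<Rightarrow> int" where
  "point_content y = Gcd {y $ 1 $ 1, y $ 1 $ 2, y $ 2 $ 2}"

definition point_vec :: "int^2^2 \<Rightarrow> real^3" where
  "point_vec y = vector [of_int (y $ 1 $ 1), of_int (y $ 1 $ 2), of_int (y $ 2 $ 2)]"

definition sturmian_type :: "(nat \<Rightarrow> nat) \<Rightarrow> real \<Rightarrow> bool" where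
  "sturmian_type s \<xi> \<longleftrightarrow>
     (\<exists>w N y.
        sturmian_seq s w \<and> admissible_with w N \<and> \<not> symmetric_mat N \<and>
        multiplicative_growth s w \<and>
        filterlim (\<lambda>i. mat_norm (w i)) at_top sequentially \<and>
        associated_points s w N y \<and>
        (\<exists>B. \<forall>i\<ge>-2. point_content (y i) \<le> B) \<and>
        (\<exists>\<delta>\<ge>0. \<delta> < sturm_sigma s / (1 + sturm_sigma s) \<and>
           (\<exists>c1>0. \<exists>c2>0. \<forall>i.
              c1 * mat_norm (w i) powr \<delta> \<le> \<bar>of_int (det (w i))\<bar> \<and>
              \<bar>of_int (det (w i))\<bar> \<le> c2 * mat_norm (w i) powr \<delta>)) \<and>
        limitin proj_plane (\<lambda>i. proj_class (point_vec (y i)))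
          (proj_class (vector [1, \<xi>, \<xi>\<^sup>2])) at_top)"

definition sturm_h :: "real \<Rightarrow> real" where
  "sturm_h \<sigma> = \<sigma> / 2 + 1 - sqrt ((\<sigma> / 2)\<^sup>2 + 1)"

end

theory Submission
  imports Defs "HOL-Analysis.Kronecker_Approximation_Theorem"
begin

text \<open>The matrices \<open>w\<^sub>0 = (1, b; a, a (b + 1))\<close> and \<open>w\<^sub>1 = (1, b + 1; a, a (b + 2))\<close> of determinant \<open>a\<close>
  generate an admissible sequence whose points \<open>y\<^sub>i\<close> are all primitive, since modulo \<open>a\<close> every product
  of the \<open>w\<^sub>i\<close> has first column \<open>(1, 0)\<close>. The norm is multiplicative up to a factor 2 on the products,
  so \<open>ln \<parallel>w\<^sub>k\<parallel>\<close> stays within bounded distance of a multiple \<open>R\<^sub>k\<close> of the solution \<open>q\<^sub>k\<close> of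
  \<open>q\<^sub>k\<^sub>+\<^sub>1 = s\<^sub>k\<^sub>+\<^sub>1 q\<^sub>k + q\<^sub>k\<^sub>-\<^sub>1\<close> with \<open>det w\<^sub>k = a^q\<^sub>k\<close>; hence \<open>\<delta>\<close> exists, and \<open>limsup R\<^sub>k\<^sub>+\<^sub>1 / R\<^sub>k = 1 / \<sigma>\<close>.
  With \<open>b\<close> close to a power of \<open>a\<close>, the values of \<open>\<delta>\<close> are dense.

  Consecutive points of a block, indexed by \<open>k\<close>, lie in one plane, whose normal vector \<open>z\<^sub>k\<close> comes from the
  fixed-point equation of \<open>w\<^sub>k\<close>. All exponents follow from one remark: if two integer vectors
  are orthogonal to a primitive vector \<open>v\<close>, their cross product is an integer multiple of \<open>v\<close>, so it vanishes or is large.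
  An integer form (or point) that is too good is therefore a multiple of some \<open>z\<^sub>k\<close> (or \<open>y\<^sub>i\<close>).
  The only approximations needed besides the \<open>z\<^sub>k\<close> and \<open>y\<^sub>i\<close> are the points that Dirichlet's
  theorem gives in the plane orthogonal to \<open>z\<^sub>k\<close>, for the lower bound of \<open>lambda2_hat\<close>.\<close>

section \<open>Integer vectors of dimension three\<close>

text \<open>In the scale t = ln X, the point \<open>y k l\<close> has size n = (l+1) R(k) + R(k-1)
  and error -(1-\<delta>) n: its determinant is about exp (\<delta> n) and is at most a constant
  times size times error. The value of \<open>z k\<close> at \<xi> is read off from its pairing with
  the second point of block k+1, which equals a det w(k+1) det w(k) up to sign. This is the origin
  of v(k) = (2-\<delta>) R(k+1) + (1-\<delta>) R(k). With liminf R(k)/R(k+1) = \<sigma>, the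
  exponents of forms are the limiting values of v(k)/R(k) and v(k)/R(k+1). The obstacle is \<delta>
  > 0: determinants grow, so points and forms could acquire large contents, and pairings that should
  vanish need not be small. The congruence modulo a removes the first danger; the second is excluded
  by \<delta> < \<sigma>/(1+\<sigma>), in the form R(k+1) \<le> (1-\<delta>) (R(k+1) + R(k)). The
  growth constant behind R is not computed: \<delta> is only enclosed between two quotients of
  logarithms. So \<Delta> is taken to be the set of all values that work, and its density is shown
  by approximation.\<close>

type_synonym ivec = "int \<times> int \<times> int"

fun dot3 :: "ivec \<Rightarrow> ivec \<Rightarrow> int" where
  "dot3 (x0, x1, x2) (y0, y1, y2) = x0 * y0 + x1 * y1 + x2 * y2"

fun cross :: "ivec \<Rightarrow> ivec \<Rightarrow> ivec" where
  "cross (x0, x1, x2) (y0, y1, y2) = (x1 * y2 - x2 * y1, x2 * y0 - x0 * y2, x0 * y1 - x1 * y0)"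

fun smul :: "int \<Rightarrow> ivec \<Rightarrow> ivec" where
  "smul m (x0, x1, x2) = (m * x0, m * x1, m * x2)"

text \<open>Bezout's form of having coprime coordinates. The witness \<open>h\<close> is itself
  used: it yields the multiplier in \<open>parallel_primitive\<close> and a second lattice vector in
  \<open>plane_point\<close>.\<close>

definition primitive :: "ivec \<Rightarrow> bool" where
  "primitive x \<longleftrightarrow> (\<exists>h. dot3 x h = 1)"

fun lform :: "real \<Rightarrow> ivec \<Rightarrow> real" where
  "lform \<xi> (x0, x1, x2) = of_int x0 + of_int x1 * \<xi> + of_int x2 * \<xi>\<^sup>2"

fun ht :: "ivec \<Rightarrow> real" where
  "ht (x0, x1, x2) = max \<bar>of_int x1\<bar> \<bar>of_int x2\<bar>"

fun size0 :: "ivec \<Rightarrow> real" where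
  "size0 (x0, x1, x2) = \<bar>of_int x0\<bar>"

fun err :: "real \<Rightarrow> ivec \<Rightarrow> real" where
  "err \<xi> (x0, x1, x2) = max \<bar>of_int x0 * \<xi> - of_int x1\<bar> \<bar>of_int x0 * \<xi>\<^sup>2 - of_int x2\<bar>"

lemma omega2_sol_iff:
  "omega2_sol \<xi> \<omega> X \<longleftrightarrow> (\<exists>x. x \<noteq> (0, 0, 0) \<and> \<bar>lform \<xi> x\<bar> \<le> X powr (- \<omega>) \<and> ht x \<le> X)"
  unfolding omega2_sol_def by auto

lemma lambda2_sol_iff:
  "lambda2_sol \<xi> \<mu> X \<longleftrightarrow> (\<exists>x. x \<noteq> (0, 0, 0) \<and> size0 x \<le> X \<and> err \<xi> x \<le> X powr (- \<mu>))"
  unfolding lambda2_sol_def by auto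

lemma parallel_primitive:
  assumes "cross u v = (0, 0, 0)" "primitive v"
  obtains m where "u = smul m v"
proof -
  obtain u0 u1 u2 v0 v1 v2 where uv: "u = (u0, u1, u2)" "v = (v0, v1, v2)"
    by (metis prod.exhaust)
  obtain h0 h1 h2 where h: "v0 * h0 + v1 * h1 + v2 * h2 = 1"
    using assms(2) unfolding primitive_def uv by auto
  have c: "u1 * v2 = u2 * v1" "u2 * v0 = u0 * v2" "u0 * v1 = u1 * v0"
    using assms(1) by (auto simp: uv)
  \<comment> \<open>Pairing the desired relation \<open>u = smul m v\<close> with \<open>h\<close>
    leaves exactly \<open>m\<close>.\<close>
  let ?m = "u0 * h0 + u1 * h1 + u2 * h2"
  have "u0 = ?m * v0" "u1 = ?m * v1" "u2 = ?m * v2"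
    using h c by algebra+
  then show thesis
    using that by (auto simp: uv)
qed

text \<open>Used in both directions: for two forms orthogonal to a point, and for two points
  orthogonal to a form.\<close>

lemma orthogonal_primitive_cases:
  assumes "dot3 u w = 0" "dot3 v w = 0" "primitive v" "primitive w" "u \<noteq> (0, 0, 0)"
  obtains m where "m \<noteq> 0" "u = smul m v" | m where "m \<noteq> 0" "cross u v = smul m w"
proof -
  obtain u0 u1 u2 v0 v1 v2 w0 w1 w2
    where uvw: "u = (u0, u1, u2)" "v = (v0, v1, v2)" "w = (w0, w1, w2)"
    by (metis prod.exhaust)
  \<comment> \<open>The triple product is a combination of \<open>u\<close> and \<open>v\<close>
    with coefficients \<open>dot3 v w\<close> and \<open>dot3 u w\<close>, up to sign.\<close>
  have "cross (cross u v) w = (0, 0, 0)"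
    using assms(1,2) by (simp add: uvw) algebra
  then obtain m where m: "cross u v = smul m w"
    using parallel_primitive assms(4) by blast
  show thesis
  proof (cases "m = 0")
    case True
    then have "cross u v = (0, 0, 0)"
      using m by (simp add: uvw)
    then obtain n where n: "u = smul n v"
      using parallel_primitive assms(3) by blast
    then have "n \<noteq> 0"
      using assms(5) by (auto simp: uvw)
    then show thesis
      using n that(1) by blast
  qed (use m that(2) in blast)
qed

text \<open>Writing \<open>y\<close> as y0 (1, \<xi>, \<xi>^2) minus its error vector turns the
  pairing into y0 times the value of \<open>z\<close>, minus z1 and z2 times the two errors. The
  constant coefficient of \<open>z\<close> meets no error, so \<open>ht\<close>, which ignores it,
  suffices.\<close>

lemma dot3_bound: "\<bar>of_int (dot3 z y)\<bar> \<le> size0 y * \<bar>lform \<xi> z\<bar> + 2 * ht z * err \<xi> y"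
  and dot3_bound': "size0 y * \<bar>lform \<xi> z\<bar> \<le> \<bar>of_int (dot3 z y)\<bar> + 2 * ht z * err \<xi> y"
proof -
  obtain z0 z1 z2 y0 y1 y2 where zy: "z = (z0, z1, z2)" "y = (y0, y1, y2)"
    by (metis prod.exhaust)
  define a b where "a = of_int y0 * \<xi> - of_int y1" and "b = of_int y0 * \<xi>\<^sup>2 - of_int y2"
  have eq: "of_int (dot3 z y) = of_int y0 * lform \<xi> z - of_int z1 * a - of_int z2 * b"
    by (simp add: zy a_def b_def algebra_simps)
  have "\<bar>of_int z1 * a\<bar> \<le> ht z * err \<xi> y" "\<bar>of_int z2 * b\<bar> \<le> ht z * err \<xi> y"
    unfolding abs_mult by (rule mult_mono; simp add: zy a_def b_def)+
  moreover have "\<bar>of_int y0 * lform \<xi> z\<bar> = size0 y * \<bar>lform \<xi> z\<bar>"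
    by (simp add: zy abs_mult)
  ultimately show "\<bar>of_int (dot3 z y)\<bar> \<le> size0 y * \<bar>lform \<xi> z\<bar> + 2 * ht z * err \<xi> y"
    "size0 y * \<bar>lform \<xi> z\<bar> \<le> \<bar>of_int (dot3 z y)\<bar> + 2 * ht z * err \<xi> y"
    using eq by linarith+
qed

text \<open>The third coordinate is singled out because it is the one for which \<open>z k\<close>
  has a lower bound, in \<open>ev_z\<close>.\<close>

lemma cross_third_bound:
  "\<bar>of_int (snd (snd (cross x y)))\<bar> \<le> size0 x * err \<xi> y + size0 y * err \<xi> x"
proof -
  obtain x0 x1 x2 y0 y1 y2 where xy: "x = (x0, x1, x2)" "y = (y0, y1, y2)"
    by (metis prod.exhaust)
  define a b where "a = of_int x0 * \<xi> - of_int x1" and "b = of_int y0 * \<xi> - of_int y1"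
  have eq: "of_int (snd (snd (cross x y))) = of_int y0 * a - of_int x0 * b"
    by (simp add: xy a_def b_def algebra_simps)
  have "\<bar>of_int y0 * a\<bar> \<le> size0 y * err \<xi> x" "\<bar>of_int x0 * b\<bar> \<le> size0 x * err \<xi> y"
    unfolding abs_mult by (rule mult_mono; simp add: xy a_def b_def)+
  then show ?thesis
    unfolding eq by linarith
qed

text \<open>The first coordinate of the product does not involve the constant coefficients, over
  which \<open>ht\<close> has no control, and it is what \<open>size0\<close> measures on a multiple
  of a point.\<close>

lemma cross_first_bound:
  "\<bar>of_int (fst (cross x y))\<bar> \<le> 2 * ht x * ht y"
proof -
  obtain x0 x1 x2 y0 y1 y2 where xy: "x = (x0, x1, x2)" "y = (y0, y1, y2)"
    by (metis prod.exhaust)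
  have eq: "of_int (fst (cross x y)) = of_int x1 * of_int y2 - of_int x2 * (of_int y1 :: real)"
    by (simp add: xy)
  have "\<bar>of_int x1 * (of_int y2 :: real)\<bar> \<le> ht x * ht y" "\<bar>of_int x2 * (of_int y1 :: real)\<bar> \<le> ht x * ht y"
    unfolding abs_mult by (rule mult_mono; simp add: xy)+
  then show ?thesis
    unfolding eq by linarith
qed

lemma abs_of_int_ge_1: "m \<noteq> 0 \<Longrightarrow> 1 \<le> \<bar>of_int m :: real\<bar>"
  by linarith

lemma smul_mono:
  assumes "m \<noteq> 0"
  shows "size0 x \<le> size0 (smul m x)" "ht x \<le> ht (smul m x)"
    "err \<xi> x \<le> err \<xi> (smul m x)" "\<bar>lform \<xi> x\<bar> \<le> \<bar>lform \<xi> (smul m x)\<bar>"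
proof -
  obtain x0 x1 x2 where x: "x = (x0, x1, x2)"
    by (metis prod.exhaust)
  have le: "\<bar>t\<bar> \<le> \<bar>of_int m * t\<bar>" for t :: real
    using mult_right_mono[OF abs_of_int_ge_1[OF assms], of "\<bar>t\<bar>"] by (simp add: abs_mult)
  show "size0 x \<le> size0 (smul m x)"
    using le by (simp add: x)
  show "ht x \<le> ht (smul m x)"
    using le[of "of_int x1"] le[of "of_int x2"] by (auto simp: x max_def)
  have "err \<xi> (smul m x) = max \<bar>of_int m * (of_int x0 * \<xi> - of_int x1)\<bar> \<bar>of_int m * (of_int x0 * \<xi>\<^sup>2 - of_int x2)\<bar>"
    by (simp add: x algebra_simps)
  then show "err \<xi> x \<le> err \<xi> (smul m x)"
    unfolding x err.simps by (simp only: max.mono[OF le le])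
  have "lform \<xi> (smul m x) = of_int m * lform \<xi> x"
    by (simp add: x algebra_simps)
  then show "\<bar>lform \<xi> x\<bar> \<le> \<bar>lform \<xi> (smul m x)\<bar>"
    using le by simp
qed

lemma ht_nonneg: "0 \<le> ht x" and size0_nonneg: "0 \<le> size0 x" and err_nonneg: "0 \<le> err \<xi> x"
  by (cases x; simp)+

section \<open>Suprema of exponents and passage from sequences to a real parameter\<close>

lemma Sup_ereal_eqI:
  assumes "\<And>x. x < c \<Longrightarrow> x \<in> S" "\<And>x. c < x \<Longrightarrow> x \<notin> S"
  shows "Sup (ereal ` S) = ereal c"
proof (rule antisym)
  show "Sup (ereal ` S) \<le> ereal c"
    using assms(2) by (intro Sup_least) (force simp: not_less[symmetric])
  show "ereal c \<le> Sup (ereal ` S)"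
  proof (rule dense_le)
    fix y assume "y < ereal c"
    then show "y \<le> Sup (ereal ` S)"
    proof (cases y)
      case (real r)
      then show ?thesis
        using assms(1) \<open>y < ereal c\<close> by (auto intro!: SUP_upper)
    qed auto
  qed
qed

text \<open>\<open>A\<close> is not assumed monotone, so the bracket ends at the least index beyond
  the threshold \<open>k1\<close> where \<open>A\<close> exceeds \<open>x\<close>. If its
  predecessor is \<open>k1\<close> itself, \<open>A k1 \<le> x\<close> is supplied by taking
  \<open>x\<close> large.\<close>

lemma eventually_bracket:
  fixes A :: "nat \<Rightarrow> real"
  assumes "filterlim A at_top sequentially" and "eventually P sequentially"
  shows "\<forall>\<^sub>F x in at_top. \<exists>k. P k \<and> A k \<le> x \<and> x < A (Suc k)"
proof -
  obtain k1 where k1: "\<And>k. k \<ge> k1 \<Longrightarrow> P k"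
    using assms(2) unfolding eventually_sequentially by blast
  show ?thesis
    using eventually_ge_at_top[of "A k1"]
  proof eventually_elim
    case (elim x)
    have "\<forall>\<^sub>F k in sequentially. x < A k \<and> k1 < k"
      using assms(1) eventually_gt_at_top by (simp add: filterlim_at_top_dense eventually_conj)
    then have ex: "\<exists>k. k1 < k \<and> x < A k"
      unfolding eventually_sequentially by blast
    define j where "j = (LEAST k. k1 < k \<and> x < A k)"
    have j: "k1 < j" "x < A j"
      using LeastI_ex[OF ex] by (auto simp: j_def)
    have "A (j - 1) \<le> x"
    proof (cases "k1 < j - 1")
      case True
      then show ?thesis
        using not_less_Least[of "j - 1" "\<lambda>k. k1 < k \<and> x < A k"] j by (auto simp: j_def[symmetric])
    next
      case False
      then have "j - 1 = k1" using j by simp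
      then show ?thesis using elim by simp
    qed
    then show ?case
      using k1[of "j - 1"] j by (intro exI[of _ "j - 1"]) auto
  qed
qed

lemma eventually_at_top_exp:
  "(\<forall>\<^sub>F X in at_top. P X) \<longleftrightarrow> (\<forall>\<^sub>F t in at_top. P (exp t :: real))"
  using eventually_filtermap[of P exp at_top] by (simp add: filtermap_exp_at_top)

section \<open>Exponents from a regular system of points and forms\<close>

text \<open>\<open>R k\<close> models ln of the norm of \<open>w k\<close>, \<open>n k l\<close> the
  logarithmic size of \<open>y k l\<close>, and \<open>- v k\<close> that of the value of
  \<open>z k\<close> at \<xi>; all multiplicative constants are collected in one \<kappa>. The range
  \<open>l \<le> s (k + 1)\<close> is closed on purpose: the last index gives the point shared with
  block k+1, of size \<open>n (k + 1) 0\<close>.\<close>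

locale sturm_system =
  fixes s :: "nat \<Rightarrow> nat" and R :: "nat \<Rightarrow> real" and \<delta> \<sigma> \<xi> \<kappa> :: real
    and z :: "nat \<Rightarrow> ivec" and y :: "nat \<Rightarrow> nat \<Rightarrow> ivec"
    and n :: "nat \<Rightarrow> nat \<Rightarrow> real" and v :: "nat \<Rightarrow> real"
  defines n_def: "n \<equiv> \<lambda>k l. (real l + 1) * R k + R (k - 1)"
    and v_def: "v \<equiv> \<lambda>k. (2 - \<delta>) * R (k + 1) + (1 - \<delta>) * R k"
  assumes s_pos: "\<And>k. s k > 0"
    and R_rec: "\<And>k. k \<ge> 1 \<Longrightarrow> R (k + 1) = real (s (k + 1)) * R k + R (k - 1)"
    and R_pos: "\<And>k. 0 < R k"
    and R_mono: "\<And>k. R k \<le> R (k + 1)"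
    and R_lim: "filterlim R at_top sequentially"
    and sigma_pos: "0 < \<sigma>" and sigma_le: "\<sigma> \<le> 1"
    and ratio_ev: "\<And>\<tau>. \<tau> < \<sigma> \<Longrightarrow> \<forall>\<^sub>F k in sequentially. \<tau> * R (k + 1) \<le> R k"
    and ratio_freq: "\<And>\<tau>. \<sigma> < \<tau> \<Longrightarrow> \<exists>\<^sub>F k in sequentially. R k \<le> \<tau> * R (k + 1)"
    and delta_nonneg: "0 \<le> \<delta>" and delta_less: "\<delta> * (1 + \<sigma>) < \<sigma>"
    and kappa: "0 \<le> \<kappa>"
    and ev_y: "\<forall>\<^sub>F k in sequentially. \<forall>l\<le>s (k + 1). primitive (y k l) \<and> dot3 (y k l) (z k) = 0 \<and>
        exp (n k l - \<kappa>) \<le> size0 (y k l) \<and> size0 (y k l) \<le> exp (n k l + \<kappa>) \<and>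
        exp (- (1 - \<delta>) * n k l - \<kappa>) \<le> err \<xi> (y k l) \<and> err \<xi> (y k l) \<le> exp (- (1 - \<delta>) * n k l + \<kappa>)"
    and ev_z: "\<forall>\<^sub>F k in sequentially. primitive (z k) \<and>
        exp (R k - \<kappa>) \<le> \<bar>of_int (snd (snd (z k)))\<bar> \<and> ht (z k) \<le> exp (R k + \<kappa>) \<and>
        exp (- v k - \<kappa>) \<le> \<bar>lform \<xi> (z k)\<bar> \<and> \<bar>lform \<xi> (z k)\<bar> \<le> exp (- v k + \<kappa>)"
begin

lemma delta_lt_1: "\<delta> < 1"
proof (rule ccontr)
  assume "\<not> \<delta> < 1"
  then have "1 * (1 + \<sigma>) \<le> \<delta> * (1 + \<sigma>)"
    using sigma_pos by (intro mult_right_mono) auto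
  then show False
    using delta_less by simp
qed

lemma delta_le_half: "\<delta> \<le> 1/2"
proof -
  have "\<delta> * (1 + \<sigma>) < (1/2) * (1 + \<sigma>)"
    using delta_less sigma_le by simp
  then show ?thesis
    using sigma_pos by (simp add: mult_less_cancel_right)
qed

lemma n_0: "n k 0 = R k + R (k - 1)"
  and n_Suc: "n k (Suc l) = n k l + R k"
  by (simp_all add: n_def algebra_simps)

lemma n_last: "k \<ge> 1 \<Longrightarrow> n k (s (k + 1)) = R (k + 1) + R k"
  using R_rec[of k] by (simp add: n_def algebra_simps)

lemma n_before_last: "k \<ge> 1 \<Longrightarrow> n k (s (k + 1) - 1) = R (k + 1)"
  using R_rec[of k] s_pos[of "k + 1"] by (simp add: n_def Suc_le_eq)

lemma n_ge: "R k \<le> n k l"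
  using R_pos[of k] R_pos[of "k - 1"] by (simp add: n_def algebra_simps add_increasing)

lemma R_lim_Suc: "filterlim (\<lambda>k. R (Suc k)) at_top sequentially"
  using R_lim by (rule filterlim_compose) (rule filterlim_Suc)

lemma ev_R_large:
  assumes "0 < \<gamma>"
  shows "\<forall>\<^sub>F k in sequentially. C \<le> \<gamma> * R k"
proof -
  have "\<forall>\<^sub>F k in sequentially. C / \<gamma> \<le> R k"
    using R_lim unfolding filterlim_at_top by blast
  then show ?thesis
    by eventually_elim (use assms in \<open>simp add: field_simps\<close>)
qed

lemma ev_pred:
  assumes "\<forall>\<^sub>F k in sequentially. P (k + 1) k"
  shows "\<forall>\<^sub>F k in sequentially. P k (k - 1)"
  by (subst eventually_sequentially_Suc[symmetric]) (use assms in simp)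

lemma freq_pred:
  assumes "\<exists>\<^sub>F k in sequentially. P (k + 1) k"
  shows "\<exists>\<^sub>F k in sequentially. P k (k - 1)"
proof (rule ccontr)
  assume "\<not> ?thesis"
  then have "\<forall>\<^sub>F k in sequentially. \<not> P (Suc k) (Suc k - 1)"
    unfolding frequently_def not_not eventually_sequentially_Suc[of "\<lambda>k. \<not> P k (k - 1)"] .
  then show False
    using assms by (simp add: frequently_def)
qed

text \<open>The form in which \<delta> < \<sigma>/(1+\<sigma>) is applied: the inequality says that
  R(k)/R(k+1) is at least \<delta>/(1-\<delta>), a number below \<sigma>.\<close>

lemma ev_delta_ratio: "\<forall>\<^sub>F k in sequentially. R (k + 1) \<le> (1 - \<delta>) * (R (k + 1) + R k)"
proof -
  have "\<delta> / (1 - \<delta>) < \<sigma>"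
    using delta_less delta_lt_1 by (simp add: field_simps)
  from ratio_ev[OF this] show ?thesis
    by eventually_elim (use delta_lt_1 in \<open>simp add: field_simps\<close>)
qed

lemma osol_iff: "omega2_sol \<xi> \<omega> (exp t) \<longleftrightarrow>
    (\<exists>x. x \<noteq> (0, 0, 0) \<and> \<bar>lform \<xi> x\<bar> \<le> exp (- \<omega> * t) \<and> ht x \<le> exp t)"
  unfolding omega2_sol_iff exp_powr_real by (simp add: mult.commute)

lemma lsol_iff: "lambda2_sol \<xi> \<mu> (exp t) \<longleftrightarrow>
    (\<exists>x. x \<noteq> (0, 0, 0) \<and> size0 x \<le> exp t \<and> err \<xi> x \<le> exp (- \<mu> * t))"
  unfolding lambda2_sol_iff exp_powr_real by (simp add: mult.commute)

section \<open>Approximations that are too good are multiples of the known ones\<close>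

text \<open>Shaped after the right side of \<open>dot3_bound\<close>. Since exp 3 is at least 4, the
  sum is at most 3/4; this fixes the 3 in the thresholds \<open>2 * \<kappa> + 3\<close>.\<close>

lemma small_sum:
  assumes "t \<le> -3" "u \<le> -3"
  shows "exp t + 2 * exp u < (1::real)"
proof -
  have e: "exp (-3) * exp 3 = (1::real)"
    by (simp flip: exp_add)
  have "4 \<le> exp (3::real)"
    using exp_ge_add_one_self[of 3] by simp
  then have "exp (-3) * 4 \<le> exp (-3) * exp (3::real)"
    by (intro mult_left_mono) auto
  then have "exp (-3::real) \<le> 1/4"
    using e by simp
  moreover have "exp t \<le> exp (-3)" "exp u \<le> exp (-3)"
    using assms by auto
  ultimately show ?thesis
    by linarith
qed

lemma primitive_nonzero: "primitive x \<Longrightarrow> x \<noteq> (0, 0, 0)"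
  by (auto simp: primitive_def)

text \<open>The test vector is the point shared by blocks k and k+1. It is orthogonal to
  \<open>z k\<close>, and the bounds on \<open>x\<close> make its pairing with \<open>x\<close> an
  integer below 1. If \<open>x\<close> were not a multiple of \<open>z k\<close>, their cross
  product would be a non-zero multiple of that point, too large for the product of the two
  heights.\<close>

lemma dual_minimal:
  "\<forall>\<^sub>F k in sequentially. \<forall>x. x \<noteq> (0, 0, 0) \<longrightarrow> ht x \<le> exp (R (k + 1) - (2 * \<kappa> + 3)) \<longrightarrow>
     \<bar>lform \<xi> x\<bar> \<le> exp (- (R k + R (k + 1)) - (2 * \<kappa> + 3)) \<longrightarrow>
     exp (- v k - \<kappa>) \<le> \<bar>lform \<xi> x\<bar>"
  using ev_z ev_y ev_delta_ratio eventually_ge_at_top[of 1]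
proof eventually_elim
  case (elim k)
  let ?y = "y k (s (k + 1))" let ?n = "R (k + 1) + R k"
  have y: "primitive ?y" "dot3 ?y (z k) = 0" "exp (?n - \<kappa>) \<le> size0 ?y" "size0 ?y \<le> exp (?n + \<kappa>)"
      "err \<xi> ?y \<le> exp (- (1 - \<delta>) * ?n + \<kappa>)"
    using elim(2)[rule_format, of "s (k + 1)"] unfolding n_last[OF elim(4)] by simp_all
  show ?case
  proof (intro allI impI)
    fix x assume x: "x \<noteq> (0, 0, 0)" "ht x \<le> exp (R (k + 1) - (2 * \<kappa> + 3))"
      "\<bar>lform \<xi> x\<bar> \<le> exp (- (R k + R (k + 1)) - (2 * \<kappa> + 3))"
    have 1: "size0 ?y * \<bar>lform \<xi> x\<bar> \<le> exp (?n + \<kappa>) * exp (- (R k + R (k + 1)) - (2 * \<kappa> + 3))"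
      by (rule mult_mono) (use y x in \<open>auto simp: size0_nonneg\<close>)
    have 2: "ht x * err \<xi> ?y \<le> exp (R (k + 1) - (2 * \<kappa> + 3)) * exp (- (1 - \<delta>) * ?n + \<kappa>)"
      by (rule mult_mono) (use y x in \<open>auto simp: err_nonneg\<close>)
    have "\<bar>of_int (dot3 x ?y)\<bar> \<le> exp (?n + \<kappa> + (- (R k + R (k + 1)) - (2 * \<kappa> + 3)))
         + 2 * exp (R (k + 1) - (2 * \<kappa> + 3) + (- (1 - \<delta>) * ?n + \<kappa>))"
      using dot3_bound[of x ?y \<xi>] 1 2 unfolding exp_add[symmetric] by linarith
    also have "\<dots> < 1"
      \<comment> \<open>The second exponent is controlled by \<open>ev_delta_ratio\<close>: the
        error of the shared point outweighs a height just below exp (R(k+1)).\<close>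
      by (rule small_sum) (use kappa elim(3) in \<open>simp_all add: algebra_simps\<close>)
    finally have xy: "dot3 x ?y = 0"
      by linarith
    have zy: "dot3 (z k) ?y = 0"
      using y(2) by (cases ?y; cases "z k") (simp add: mult.commute)
    from xy zy _ y(1) x(1) show "exp (- v k - \<kappa>) \<le> \<bar>lform \<xi> x\<bar>"
    proof (rule orthogonal_primitive_cases)
      show "primitive (z k)" using elim(1) by blast
    next
      fix m assume "m \<noteq> 0" "x = smul m (z k)"
      then show ?thesis
        using smul_mono(4)[of m \<xi> "z k"] elim(1) by auto
    next
      fix m assume m: "m \<noteq> 0" "cross x (z k) = smul m ?y"
      have "exp (?n - \<kappa>) \<le> size0 (smul m ?y)"
        using smul_mono(1)[OF m(1), of ?y] y by linarith
      also have "\<dots> = \<bar>of_int (fst (cross x (z k)))\<bar>"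
        unfolding m(2) by (cases ?y) simp
      also have "\<dots> \<le> 2 * ht x * ht (z k)"
        by (rule cross_first_bound)
      also have "\<dots> \<le> 2 * (exp (R (k + 1) - (2 * \<kappa> + 3)) * exp (R k + \<kappa>))"
        using mult_mono[of "ht x" "exp (R (k + 1) - (2 * \<kappa> + 3))" "ht (z k)" "exp (R k + \<kappa>)"] x elim(1)
        by (simp add: ht_nonneg)
      also have "\<dots> = 2 * exp (-3) * exp (?n - \<kappa>)"
        by (simp add: algebra_simps flip: exp_add)
      also have "\<dots> < 1 * exp (?n - \<kappa>)"
        using small_sum[of "-3" "-3"] by (intro mult_strict_right_mono) auto
      finally show ?thesis by simp
    qed
  qed
qed

text \<open>The four conditions serve in two pairs. \<open>t \<le> v k\<close> and
  \<open>e \<le> - R k\<close>, up to constants, make the pairing of \<open>x\<close> with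
  \<open>z k\<close> vanish. The other two make the third coordinate of the cross product with
  \<open>y k l\<close> smaller than that of \<open>z k\<close>, so that \<open>x\<close> is a
  multiple of \<open>y k l\<close>.\<close>

lemma primal_minimal:
  "\<forall>\<^sub>F k in sequentially. \<forall>l\<le>s (k + 1). \<forall>x t e. x \<noteq> (0, 0, 0) \<longrightarrow> size0 x \<le> exp t \<longrightarrow>
     err \<xi> x \<le> exp e \<longrightarrow> t \<le> R k + (1 - \<delta>) * n k l - (2 * \<kappa> + 3) \<longrightarrow> t \<le> v k - (2 * \<kappa> + 3) \<longrightarrow>
     e \<le> - R k - (2 * \<kappa> + 3) \<longrightarrow> e \<le> R k - n k l - (2 * \<kappa> + 3) \<longrightarrow>
     exp (n k l - \<kappa>) \<le> size0 x \<and> exp (- (1 - \<delta>) * n k l - \<kappa>) \<le> err \<xi> x"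
  using ev_z ev_y
proof eventually_elim
  case (elim k)
  show ?case
  proof (intro allI impI)
    fix l x t e
    assume l: "l \<le> s (k + 1)" and x: "x \<noteq> (0, 0, 0)" "size0 x \<le> exp t" "err \<xi> x \<le> exp e"
      and t: "t \<le> R k + (1 - \<delta>) * n k l - (2 * \<kappa> + 3)" "t \<le> v k - (2 * \<kappa> + 3)"
      and e: "e \<le> - R k - (2 * \<kappa> + 3)" "e \<le> R k - n k l - (2 * \<kappa> + 3)"
    let ?y = "y k l"
    note y = elim(2)[rule_format, OF l]
    have 1: "size0 x * \<bar>lform \<xi> (z k)\<bar> \<le> exp t * exp (- v k + \<kappa>)"
      by (rule mult_mono) (use elim(1) x in \<open>auto simp: size0_nonneg\<close>)
    have 2: "ht (z k) * err \<xi> x \<le> exp (R k + \<kappa>) * exp e"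
      by (rule mult_mono) (use elim(1) x in \<open>auto simp: err_nonneg\<close>)
    have "\<bar>of_int (dot3 (z k) x)\<bar> \<le> exp (t + (- v k + \<kappa>)) + 2 * exp (R k + \<kappa> + e)"
      using dot3_bound[of "z k" x \<xi>] 1 2 unfolding exp_add[symmetric] by linarith
    also have "\<dots> < 1"
      by (rule small_sum) (use kappa t e in \<open>simp_all add: algebra_simps\<close>)
    finally have "dot3 (z k) x = 0"
      by linarith
    then have xz: "dot3 x (z k) = 0"
      by (cases x; cases "z k") (simp add: mult.commute)
    from xz _ _ _ x(1) show "exp (n k l - \<kappa>) \<le> size0 x \<and> exp (- (1 - \<delta>) * n k l - \<kappa>) \<le> err \<xi> x"
    proof (rule orthogonal_primitive_cases)
      show "dot3 (y k l) (z k) = 0" "primitive (y k l)" "primitive (z k)"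
        using y elim(1) by auto
    next
      fix m assume "m \<noteq> 0" "x = smul m (y k l)"
      then show ?thesis
        using smul_mono(1)[of m "y k l"] smul_mono(3)[of m \<xi> "y k l"] y by auto
    next
      fix m assume m: "m \<noteq> 0" "cross x (y k l) = smul m (z k)"
      have "exp (R k - \<kappa>) \<le> 1 * \<bar>of_int (snd (snd (z k)))\<bar>"
        using elim(1) by simp
      also have "\<dots> \<le> \<bar>of_int m\<bar> * \<bar>of_int (snd (snd (z k)))\<bar>"
        by (intro mult_right_mono abs_of_int_ge_1 m) auto
      also have "\<dots> = \<bar>of_int (snd (snd (cross x (y k l))))\<bar>"
        unfolding m(2) by (cases "z k") (simp add: abs_mult)
      also have "\<dots> \<le> size0 x * err \<xi> (y k l) + size0 (y k l) * err \<xi> x"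
        by (rule cross_third_bound)
      also have "\<dots> \<le> exp t * exp (- (1 - \<delta>) * n k l + \<kappa>) + exp (n k l + \<kappa>) * exp e"
        by (intro add_mono mult_mono) (use x y in \<open>auto simp: size0_nonneg err_nonneg\<close>)
      also have "\<dots> = exp (R k - \<kappa>) * (exp (t + (- (1 - \<delta>) * n k l + \<kappa>) - R k + \<kappa>) + exp (n k l + \<kappa> + e - R k + \<kappa>))"
        unfolding distrib_left exp_add[symmetric] by (simp add: algebra_simps)
      also have "\<dots> \<le> exp (R k - \<kappa>) * (exp (t + (- (1 - \<delta>) * n k l + \<kappa>) - R k + \<kappa>) + 2 * exp (n k l + \<kappa> + e - R k + \<kappa>))"
        by (intro mult_left_mono add_left_mono) auto
      also have "\<dots> < exp (R k - \<kappa>) * 1"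
        by (intro mult_strict_left_mono small_sum) (use kappa t e in \<open>simp_all add: algebra_simps\<close>)
      finally show ?thesis by simp
    qed
  qed
qed

end

section \<open>Monotonicity in the exponent, and lattice points in a plane\<close>

lemma frequently_compose_filterlim:
  assumes "\<exists>\<^sub>F x in G. P (f x)" "filterlim f F G"
  shows "\<exists>\<^sub>F x in F. P x"
  using assms eventually_compose_filterlim[of "\<lambda>x. \<not> P x" F f G] unfolding frequently_def by blast

lemma omega2_sol_mono:
  assumes "omega2_sol \<xi> \<omega>' X" "\<omega> \<le> \<omega>'" "1 \<le> X"
  shows "omega2_sol \<xi> \<omega> X"
proof -
  have "X powr - \<omega>' \<le> X powr - \<omega>"
    using assms(2,3) by (intro powr_mono) auto
  then show ?thesis
    using assms(1) unfolding omega2_sol_iff by (blast intro: order_trans)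
qed

lemma lambda2_sol_mono:
  assumes "lambda2_sol \<xi> \<mu>' X" "\<mu> \<le> \<mu>'" "1 \<le> X"
  shows "lambda2_sol \<xi> \<mu> X"
proof -
  have "X powr - \<mu>' \<le> X powr - \<mu>"
    using assms(2,3) by (intro powr_mono) auto
  then show ?thesis
    using assms(1) unfolding lambda2_sol_iff by (blast intro: order_trans)
qed

lemma eventually_ge_1: "\<forall>\<^sub>F X :: real in at_top. 1 \<le> X"
  by (rule eventually_ge_at_top)

text \<open>The vector u = z x h, where h pairs to 1 with y, lies in the plane and has y x u = z.
  Dirichlet's theorem for u0/y0 gives a combination x = k u - p y with small first coordinate, and x
  x y = - k z bounds its other errors.\<close>

lemma plane_point:
  assumes y: "primitive y" "dot3 y z = 0" "0 < size0 y" and z: "z \<noteq> (0, 0, 0)" and M: "0 < M"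
  obtains x where "x \<noteq> (0, 0, 0)" "size0 x \<le> size0 y / real M"
    "err \<xi> x \<le> (size0 x * err \<xi> y + real M * ht z) / size0 y"
proof -
  obtain z0 z1 z2 y0 y1 y2 where zy: "z = (z0, z1, z2)" "y = (y0, y1, y2)"
    by (metis prod.exhaust)
  obtain h0 h1 h2 where h: "y0 * h0 + y1 * h1 + y2 * h2 = 1"
    using y(1) unfolding primitive_def zy by auto
  obtain u0 u1 u2 where u: "cross z (h0, h1, h2) = (u0, u1, u2)"
    by (metis prod.exhaust)
  have orth: "y0 * z0 + y1 * z1 + y2 * z2 = 0"
    using y(2) by (simp add: zy)
  \<comment> \<open>y x (z x h) = (y.h) z - (y.z) h, where y.h = 1 and y.z = 0.\<close>
  have uy: "u0 * y1 - u1 * y0 = - z2" "u2 * y0 - u0 * y2 = - z1" "u1 * y2 - u2 * y1 = - z0"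
  proof -
    have "z1 * h2 - z2 * h1 = u0" "z2 * h0 - z0 * h2 = u1" "z0 * h1 - z1 * h0 = u2"
      using u by (auto simp: zy)
    with h orth show "u0 * y1 - u1 * y0 = - z2" "u2 * y0 - u0 * y2 = - z1" "u1 * y2 - u2 * y1 = - z0"
      by algebra+
  qed
  have y0: "y0 \<noteq> 0"
    using y(3) by (auto simp: zy)
  obtain p k where k: "0 < k" "k \<le> int M" "\<bar>of_int k * (of_int u0 / of_int y0) - of_int p\<bar> < 1 / real M"
    using Dirichlet_approx[OF M] .
  define x0 x1 x2 where "x0 = k * u0 - p * y0" and "x1 = k * u1 - p * y1" and "x2 = k * u2 - p * y2"
  note x_def = this
  have xy: "x0 * y1 - x1 * y0 = - k * z2" "x2 * y0 - x0 * y2 = - k * z1" "x1 * y2 - x2 * y1 = - k * z0"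
    using uy unfolding x_def by algebra+
  have kM: "\<bar>of_int k\<bar> \<le> real M"
    using k by simp
  show thesis
  proof (rule that[of "(x0, x1, x2)"])
    show "(x0, x1, x2) \<noteq> (0, 0, 0)"
      using xy z k(1) by (auto simp: zy)
    have "real_of_int x0 = of_int y0 * (of_int k * (of_int u0 / of_int y0) - of_int p)"
      using y0 by (simp add: x_def field_simps)
    then have "\<bar>real_of_int x0\<bar> = \<bar>of_int y0\<bar> * \<bar>of_int k * (of_int u0 / of_int y0) - of_int p\<bar>"
      by (simp add: abs_mult)
    also have "\<dots> \<le> \<bar>of_int y0\<bar> * (1 / real M)"
      using k(3) by (intro mult_left_mono) auto
    finally show "size0 (x0, x1, x2) \<le> size0 y / real M"
      by (simp add: zy)
    let ?B = "\<bar>of_int x0\<bar> * err \<xi> y + real M * ht z"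
    \<comment> \<open>y0 (x0 \<eta> - xi) differs from x0 (y0 \<eta> - yi) by a coordinate of x x y,
      which is k times a coordinate of z.\<close>
    have gen: "\<bar>of_int x0 * \<eta> - of_int xi\<bar> \<le> ?B / \<bar>of_int y0\<bar>"
      if "x0 * yi - xi * y0 = k * zi" "\<bar>of_int y0 * \<eta> - of_int yi\<bar> \<le> err \<xi> y" "\<bar>of_int zi\<bar> \<le> ht z"
      for \<eta> :: real and xi yi zi :: int
    proof -
      have "of_int x0 * of_int yi - of_int xi * of_int y0 = of_int k * (of_int zi :: real)"
        using arg_cong[OF that(1), of "of_int :: int \<Rightarrow> real"] by simp
      then have "of_int y0 * (of_int x0 * \<eta> - of_int xi) = of_int x0 * (of_int y0 * \<eta> - of_int yi) + of_int k * of_int zi"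
        by (simp add: algebra_simps)
      then have "\<bar>of_int y0\<bar> * \<bar>of_int x0 * \<eta> - of_int xi\<bar> \<le> \<bar>of_int x0 * (of_int y0 * \<eta> - of_int yi)\<bar> + \<bar>of_int k * of_int zi\<bar>"
        by (metis abs_mult abs_triangle_ineq)
      also have "\<dots> \<le> ?B"
        unfolding abs_mult
        by (intro add_mono mult_mono kM that) auto
      finally show ?thesis
        using y0 by (simp add: field_simps)
    qed
    have "\<bar>of_int x0 * \<xi> - of_int x1\<bar> \<le> ?B / \<bar>of_int y0\<bar>"
      by (rule gen[of y1 _ "- z2"]) (use xy in \<open>auto simp: zy\<close>)
    moreover have "\<bar>of_int x0 * \<xi>\<^sup>2 - of_int x2\<bar> \<le> ?B / \<bar>of_int y0\<bar>"
      by (rule gen[of y2 _ "z1"]) (use xy in \<open>auto simp: zy algebra_simps\<close>)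
    ultimately show "err \<xi> (x0, x1, x2) \<le> (size0 (x0, x1, x2) * err \<xi> y + real M * ht z) / size0 y"
      by (simp add: zy)
  qed
qed

section \<open>The exponents of forms\<close>

context sturm_system
begin

text \<open>Another form of \<open>delta_less\<close>. It says that the claimed uniform exponents
  exceed 2 and 1/2 strictly, which leaves room in the later estimates.\<close>

lemma gain: "1 < (1 - \<delta>) * (1 + \<sigma>)"
  using delta_less by (simp add: algebra_simps)

lemma div_sigma: "2 - \<delta> \<le> (2 - \<delta>) / \<sigma>"
proof -
  have "(2 - \<delta>) * \<sigma> \<le> 2 - \<delta>"
    using sigma_le delta_le_half sigma_pos by (intro mult_left_le) auto
  then show ?thesis
    using sigma_pos by (simp add: pos_le_divide_eq)
qed

lemma R_lim_add: "filterlim (\<lambda>k. c + R k) at_top sequentially"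
  by (rule filterlim_tendsto_add_at_top[OF tendsto_const R_lim])

text \<open>\<open>z k\<close> serves for all t from its own height to that of
  \<open>z (k + 1)\<close>. The right end is the worst, where the ratio v(k)/R(k+1) is at least 2 -
  \<delta> + (1-\<delta>) \<tau> for each \<tau> < \<sigma> eventually.\<close>

lemma omega2_hat_lower:
  assumes "\<omega> < 1 + (1 - \<delta>) * (1 + \<sigma>)"
  shows "\<forall>\<^sub>F X in at_top. omega2_sol \<xi> \<omega> X"
proof -
  \<comment> \<open>Raising the exponent to a positive one makes \<open>\<omega>' * t\<close>
    increasing in \<open>t\<close>.\<close>
  define \<omega>' where "\<omega>' = max \<omega> 1"
  have w: "1 \<le> \<omega>'" "\<omega>' < 2 - \<delta> + (1 - \<delta>) * \<sigma>"
    using assms gain by (auto simp: \<omega>'_def algebra_simps)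
  then have "(\<omega>' - 2 + \<delta>) / (1 - \<delta>) < \<sigma>"
    using delta_lt_1 by (simp add: field_simps)
  then obtain \<tau> where \<tau>: "(\<omega>' - 2 + \<delta>) / (1 - \<delta>) < \<tau>" "\<tau> < \<sigma>"
    using dense by blast
  \<comment> \<open>The margin: v(k) - \<omega>' R(k+1) is at least \<gamma> R(k+1), which
    eventually absorbs all constants. The \<gamma> of the later proofs has the same role.\<close>
  define \<gamma> where "\<gamma> = 2 - \<delta> - \<omega>' + (1 - \<delta>) * \<tau>"
  have \<gamma>: "0 < \<gamma>"
    using \<tau>(1) delta_lt_1 by (simp add: \<gamma>_def field_simps)
  have A: "filterlim (\<lambda>k. R k + \<kappa>) at_top sequentially"
    using R_lim_add[of \<kappa>] by (simp add: add.commute)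
  have "\<forall>\<^sub>F t in at_top. omega2_sol \<xi> \<omega>' (exp t)"
    using eventually_bracket[OF A eventually_conj[OF ev_z eventually_conj[OF ratio_ev[OF \<tau>(2)]
        eventually_compose_filterlim[OF ev_R_large[OF \<gamma>, of "(1 + \<omega>') * \<kappa>"] filterlim_Suc]]]]
  proof eventually_elim
    case (elim t)
    then obtain k where zk: "primitive (z k)" "ht (z k) \<le> exp (R k + \<kappa>)" "\<bar>lform \<xi> (z k)\<bar> \<le> exp (- v k + \<kappa>)"
      and k: "\<tau> * R (k + 1) \<le> R k" "(1 + \<omega>') * \<kappa> \<le> \<gamma> * R (k + 1)" "R k + \<kappa> \<le> t" "t \<le> R (k + 1) + \<kappa>"
      by auto
    have 1: "\<omega>' * t \<le> \<omega>' * (R (k + 1) + \<kappa>)"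
      using k(4) w(1) by (intro mult_left_mono) auto
    have 2: "(1 - \<delta>) * (\<tau> * R (k + 1)) \<le> (1 - \<delta>) * R k"
      using k(1) delta_lt_1 by (intro mult_left_mono) auto
    have "- v k + \<kappa> \<le> - \<omega>' * t"
      using 1 2 k(2) unfolding v_def \<gamma>_def by (simp add: algebra_simps)
    moreover have "exp (R k + \<kappa>) \<le> exp t"
      using k(3) by simp
    ultimately show ?case
      unfolding osol_iff using zk primitive_nonzero by (intro exI[of _ "z k"]) (auto intro: order_trans)
  qed
  then have "\<forall>\<^sub>F X in at_top. omega2_sol \<xi> \<omega>' X"
    by (rule iffD2[OF eventually_at_top_exp])
  then show ?thesis
    using eventually_ge_1
  proof eventually_elim
    case (elim X)
    then show ?case
      using omega2_sol_mono[of \<xi> \<omega>' X \<omega>] by (simp add: \<omega>'_def)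
  qed
qed

text \<open>\<open>z k\<close> is tested at its own height, along the infinitely many k for which
  R(k)/R(k+1) is close to \<sigma>.\<close>

lemma omega2_lower:
  assumes "\<omega> < (2 - \<delta>) / \<sigma> + 1 - \<delta>"
  shows "\<exists>\<^sub>F X in at_top. omega2_sol \<xi> \<omega> X"
proof -
  define \<omega>' where "\<omega>' = max \<omega> (3/2)"
  have "3/2 < (2 - \<delta>) / \<sigma> + 1 - \<delta>"
    using delta_le_half div_sigma by linarith
  then have w: "3/2 \<le> \<omega>'" "\<omega>' < (2 - \<delta>) / \<sigma> + 1 - \<delta>"
    using assms unfolding \<omega>'_def by simp_all
  then have "\<sigma> < (2 - \<delta>) / (\<omega>' - 1 + \<delta>)"
    using sigma_pos delta_nonneg by (simp add: field_simps)
  then obtain \<tau> where \<tau>: "\<sigma> < \<tau>" "\<tau> < (2 - \<delta>) / (\<omega>' - 1 + \<delta>)"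
    using dense by blast
  define \<gamma> where "\<gamma> = (2 - \<delta>) / \<tau> + 1 - \<delta> - \<omega>'"
  have \<gamma>: "0 < \<gamma>"
    using \<tau> w(1) sigma_pos delta_nonneg by (simp add: \<gamma>_def field_simps)
  have A: "filterlim (\<lambda>k. exp (R k + \<kappa>)) at_top sequentially"
    using filterlim_compose[OF exp_at_top R_lim_add[of \<kappa>]] by (simp add: add.commute)
  have "\<exists>\<^sub>F k in sequentially. omega2_sol \<xi> \<omega>' (exp (R k + \<kappa>))"
  proof (rule frequently_rev_mp[OF ratio_freq[OF \<tau>(1)]])
    show "\<forall>\<^sub>F k in sequentially. R k \<le> \<tau> * R (k + 1) \<longrightarrow> omega2_sol \<xi> \<omega>' (exp (R k + \<kappa>))"
      using ev_z ev_R_large[OF \<gamma>, of "(1 + \<omega>') * \<kappa>"]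
    proof eventually_elim
      case (elim k)
      show ?case
      proof
        assume k: "R k \<le> \<tau> * R (k + 1)"
        have "(2 - \<delta>) * (R k / \<tau>) \<le> (2 - \<delta>) * R (k + 1)"
          using k \<tau>(1) sigma_pos delta_le_half by (intro mult_left_mono) (auto simp: field_simps)
        then have "- v k + \<kappa> \<le> - \<omega>' * (R k + \<kappa>)"
          using elim(2) unfolding v_def \<gamma>_def by (simp add: algebra_simps diff_divide_distrib)
        then show "omega2_sol \<xi> \<omega>' (exp (R k + \<kappa>))"
          unfolding osol_iff using elim(1) primitive_nonzero
          by (intro exI[of _ "z k"]) (auto intro: order_trans)
      qed
    qed
  qed
  from frequently_compose_filterlim[OF this A] show ?thesis
  proof (rule frequently_rev_mp)
    show "\<forall>\<^sub>F X in at_top. omega2_sol \<xi> \<omega>' X \<longrightarrow> omega2_sol \<xi> \<omega> X"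
      using eventually_ge_1
    proof eventually_elim
      case (elim X)
      then show ?case
        using omega2_sol_mono[of \<xi> \<omega>' X \<omega>] by (simp add: \<omega>'_def)
    qed
  qed
qed

text \<open>X is taken at the largest height allowed in \<open>dual_minimal\<close>, just below that
  of \<open>z (k + 1)\<close>. As \<omega> > 2 and R(k) \<le> R(k+1), the hypothesis on the value
  holds by itself; so no solution beats \<open>z k\<close>, and R(k)/R(k+1) stays above some \<tau>
  > \<sigma>, against \<open>ratio_freq\<close>.\<close>

lemma omega2_hat_upper:
  assumes "1 + (1 - \<delta>) * (1 + \<sigma>) < \<omega>"
  shows "\<not> (\<forall>\<^sub>F X in at_top. omega2_sol \<xi> \<omega> X)"
proof
  assume ev: "\<forall>\<^sub>F X in at_top. omega2_sol \<xi> \<omega> X"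
  let ?c = "2 * \<kappa> + 3"
  have w: "2 < \<omega>"
    using assms gain by simp
  have "\<sigma> < (\<omega> - 2 + \<delta>) / (1 - \<delta>)"
    using assms delta_lt_1 by (simp add: field_simps)
  then obtain \<tau> where \<tau>: "\<sigma> < \<tau>" "\<tau> < (\<omega> - 2 + \<delta>) / (1 - \<delta>)"
    using dense by blast
  define \<gamma> where "\<gamma> = \<omega> - (2 - \<delta> + (1 - \<delta>) * \<tau>)"
  have \<gamma>: "0 < \<gamma>"
    using \<tau>(2) delta_lt_1 by (simp add: \<gamma>_def field_simps)
  have A: "filterlim (\<lambda>k. exp (- ?c + R (Suc k))) at_top sequentially"
    by (rule filterlim_compose[OF exp_at_top]) (intro filterlim_tendsto_add_at_top[OF tendsto_const R_lim_Suc])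
  have "\<forall>\<^sub>F k in sequentially. \<not> R k \<le> \<tau> * R (k + 1)"
    using eventually_compose_filterlim[OF ev A] dual_minimal
      eventually_compose_filterlim[OF ev_R_large[OF \<gamma>, of "\<kappa> + \<omega> * ?c + 1"] filterlim_Suc]
      eventually_compose_filterlim[OF ev_R_large[of "\<omega> - 2" "(1 + \<omega>) * ?c"] filterlim_Suc, simplified, OF w]
  proof eventually_elim
    case (elim k)
    obtain x where x: "x \<noteq> (0, 0, 0)" "\<bar>lform \<xi> x\<bar> \<le> exp (- \<omega> * (- ?c + R (Suc k)))" "ht x \<le> exp (- ?c + R (Suc k))"
      using elim(1) unfolding osol_iff by blast
    have "- \<omega> * (- ?c + R (Suc k)) \<le> - (R k + R (k + 1)) - ?c"
      using elim(4) R_mono[of k] by (simp add: algebra_simps)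
    then have le: "exp (- \<omega> * (- ?c + R (Suc k))) \<le> exp (- (R k + R (k + 1)) - ?c)"
      by simp
    have "ht x \<le> exp (R (k + 1) - ?c)"
      using x(3) by (simp add: algebra_simps)
    then have "exp (- v k - \<kappa>) \<le> \<bar>lform \<xi> x\<bar>"
      using elim(2) x(1) order_trans[OF x(2) le] by blast
    then have "exp (- v k - \<kappa>) \<le> exp (- \<omega> * (- ?c + R (Suc k)))"
      using x(2) by (rule order_trans)
    then have *: "- v k - \<kappa> \<le> - \<omega> * (- ?c + R (k + 1))"
      by simp
    show ?case
    proof
      assume "R k \<le> \<tau> * R (k + 1)"
      then have "(1 - \<delta>) * R k \<le> (1 - \<delta>) * (\<tau> * R (k + 1))"
        using delta_lt_1 by (intro mult_left_mono) auto
      then show False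
        using * elim(3) unfolding v_def \<gamma>_def by (simp add: algebra_simps)
    qed
  qed
  then show False
    using ratio_freq[OF \<tau>(1)] by (simp add: frequently_def)
qed

text \<open>Bracketing t by R(k) - c and R(k+1) - c makes \<open>dual_minimal\<close> available for
  every large X. The value is at least about exp (- v(k)), and \<omega> R(k) exceeds v(k) because
  R(k+1) \<le> R(k)/\<tau>.\<close>

lemma omega2_upper:
  assumes "(2 - \<delta>) / \<sigma> + 1 - \<delta> < \<omega>"
  shows "\<not> (\<exists>\<^sub>F X in at_top. omega2_sol \<xi> \<omega> X)"
proof -
  let ?c = "2 * \<kappa> + 3"
  have w: "1 < \<omega>"
    using assms delta_le_half div_sigma by simp
  have "(2 - \<delta>) / (\<omega> - 1 + \<delta>) < \<sigma>"
    using assms sigma_pos w delta_nonneg by (simp add: field_simps)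
  then obtain \<tau> where \<tau>: "(2 - \<delta>) / (\<omega> - 1 + \<delta>) < \<tau>" "\<tau> < \<sigma>"
    using dense by blast
  have \<tau>0: "0 < \<tau>"
    using order_le_less_trans[OF _ \<tau>(1), of 0] w delta_nonneg delta_le_half by simp
  define \<gamma> where "\<gamma> = \<omega> - ((2 - \<delta>) / \<tau> + 1 - \<delta>)"
  have \<gamma>: "0 < \<gamma>"
    using \<tau>(1) \<tau>0 w delta_nonneg by (simp add: \<gamma>_def field_simps)
  have A: "filterlim (\<lambda>k. - ?c + R k) at_top sequentially"
    by (intro filterlim_tendsto_add_at_top[OF tendsto_const R_lim])
  have "\<forall>\<^sub>F t in at_top. \<not> omega2_sol \<xi> \<omega> (exp t)"
    using eventually_bracket[OF A eventually_conj[OF dual_minimal eventually_conj[OF ratio_ev[OF \<tau>(2)]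
        ev_R_large[OF \<gamma>, of "\<kappa> + (1 + \<omega>) * ?c + 1"]]]]
  proof eventually_elim
    case (elim t)
    then obtain k where D: "\<forall>x. x \<noteq> (0, 0, 0) \<longrightarrow> ht x \<le> exp (R (k + 1) - ?c) \<longrightarrow>
         \<bar>lform \<xi> x\<bar> \<le> exp (- (R k + R (k + 1)) - ?c) \<longrightarrow> exp (- v k - \<kappa>) \<le> \<bar>lform \<xi> x\<bar>"
      and k: "\<tau> * R (k + 1) \<le> R k" "\<kappa> + (1 + \<omega>) * ?c + 1 \<le> \<gamma> * R k" "- ?c + R k \<le> t" "t < - ?c + R (Suc k)"
      by blast
    have wt: "\<omega> * (- ?c + R k) \<le> \<omega> * t"
      using k(3) w by (intro mult_left_mono) auto
    have r: "R (k + 1) \<le> R k / \<tau>"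
      using k(1) \<tau>0 by (simp add: field_simps)
    have r2: "(2 - \<delta>) * R (k + 1) \<le> (2 - \<delta>) * (R k / \<tau>)"
      using r delta_le_half by (intro mult_left_mono) auto
    have r3: "\<delta> * R k \<le> (1 - \<delta>) * R (k + 1)"
      using R_mono[of k] R_pos[of k] delta_le_half by (intro mult_mono) auto
    have v_ge: "v k + (1 + \<omega>) * ?c + \<kappa> + 1 \<le> \<omega> * R k"
      using k(2) r2 unfolding v_def \<gamma>_def by (simp add: algebra_simps diff_divide_distrib)
    have "R k + R (k + 1) \<le> v k"
      using r3 unfolding v_def by (simp add: algebra_simps)
    then have le: "- \<omega> * t \<le> - (R k + R (k + 1)) - ?c"
      using v_ge wt kappa by (simp add: algebra_simps)
    have lt: "- \<omega> * t < - v k - \<kappa>"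
      using v_ge wt kappa by (simp add: algebra_simps)
    show ?case
    proof
      assume "omega2_sol \<xi> \<omega> (exp t)"
      then obtain x where x: "x \<noteq> (0, 0, 0)" "\<bar>lform \<xi> x\<bar> \<le> exp (- \<omega> * t)" "ht x \<le> exp t"
        unfolding osol_iff by blast
      have "exp (- v k - \<kappa>) \<le> \<bar>lform \<xi> x\<bar>"
      proof (rule D[rule_format, OF x(1)])
        show "ht x \<le> exp (R (k + 1) - ?c)"
          using k(4) by (intro order_trans[OF x(3)]) simp
        show "\<bar>lform \<xi> x\<bar> \<le> exp (- (R k + R (k + 1)) - ?c)"
          using le by (intro order_trans[OF x(2)]) simp
      qed
      also have "\<dots> \<le> exp (- \<omega> * t)"
        by (rule x(2))
      finally show False
        using lt by simp
    qed
  qed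
  then have "\<forall>\<^sub>F X in at_top. \<not> omega2_sol \<xi> \<omega> X"
    by (rule iffD2[OF eventually_at_top_exp])
  then show ?thesis
    unfolding frequently_def by blast
qed

end

section \<open>The exponents of points\<close>

lemma quotient_less_iff:
  fixes p :: real
  assumes "0 < p"
  shows "\<nu> / p - 1 < \<tau> \<longleftrightarrow> \<nu> < (1 + \<tau>) * p" "\<tau> < \<nu> / p - 1 \<longleftrightarrow> (1 + \<tau>) * p < \<nu>"
  using pos_divide_less_eq[OF assms, of \<nu> "1 + \<tau>"] pos_less_divide_eq[OF assms, of "1 + \<tau>" \<nu>]
  by linarith+

context sturm_system
begin

lemma ev_pred_le: "\<forall>\<^sub>F k in sequentially. R (k - 1) \<le> R k"
proof -
  have "R (k - 1) \<le> R k" for k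
    using R_mono[of "k - 1"] by (cases k) auto
  then show ?thesis by simp
qed

text \<open>For l = 0 the condition \<open>t \<le> v k\<close> in \<open>primal_minimal\<close>
  thereby follows from the first condition on \<open>t\<close>.\<close>

lemma ev_v_ge: "R k + (1 - \<delta>) * (R k + R (k - 1)) \<le> v k"
proof -
  have 1: "R (k - 1) \<le> R k"
    using R_mono[of "k - 1"] by (cases k) auto
  have "(1 - \<delta>) * R (k - 1) \<le> (1 - \<delta>) * R (k + 1)"
    using 1 R_mono[of k] delta_lt_1 by (intro mult_left_mono) auto
  then show ?thesis
    using R_mono[of k] unfolding v_def by (simp add: algebra_simps)
qed

lemma lambda2_lower:
  assumes "\<mu> < 1 - \<delta>"
  shows "\<exists>\<^sub>F X in at_top. lambda2_sol \<xi> \<mu> X"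
proof -
  define \<mu>' where "\<mu>' = max \<mu> 0"
  have m: "0 \<le> \<mu>'" "0 < 1 - \<delta> - \<mu>'"
    using assms delta_lt_1 by (auto simp: \<mu>'_def)
  have A: "filterlim (\<lambda>k. exp (n k 0 + \<kappa>)) at_top sequentially"
  proof (rule filterlim_compose[OF exp_at_top])
    show "filterlim (\<lambda>k. n k 0 + \<kappa>) at_top sequentially"
      by (rule filterlim_at_top_mono[OF R_lim_add[of \<kappa>]]) (simp add: n_ge)
  qed
  have "\<forall>\<^sub>F k in sequentially. lambda2_sol \<xi> \<mu>' (exp (n k 0 + \<kappa>))"
    using ev_y ev_R_large[OF m(2), of "(1 + \<mu>') * \<kappa>"]
  proof eventually_elim
    case (elim k)
    note y = elim(1)[rule_format, of 0, simplified]
    have "(1 - \<delta> - \<mu>') * R k \<le> (1 - \<delta> - \<mu>') * n k 0"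
      using m(2) n_ge by (intro mult_left_mono) auto
    then have "- (1 - \<delta>) * n k 0 + \<kappa> \<le> - \<mu>' * (n k 0 + \<kappa>)"
      using elim(2) by (simp add: algebra_simps)
    then have "exp (- (1 - \<delta>) * n k 0 + \<kappa>) \<le> exp (- \<mu>' * (n k 0 + \<kappa>))"
      by simp
    then have "err \<xi> (y k 0) \<le> exp (- \<mu>' * (n k 0 + \<kappa>))"
      using elim(1)[rule_format, of 0] by linarith
    moreover have "size0 (y k 0) \<le> exp (n k 0 + \<kappa>)" "y k 0 \<noteq> (0, 0, 0)"
      using elim(1)[rule_format, of 0] primitive_nonzero by auto
    ultimately show ?case
      unfolding lsol_iff by blast
  qed
  then have "\<exists>\<^sub>F k in sequentially. lambda2_sol \<xi> \<mu>' (exp (n k 0 + \<kappa>))"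
    by (intro eventually_frequently) auto
  from frequently_compose_filterlim[OF this A] show ?thesis
  proof (rule frequently_rev_mp)
    show "\<forall>\<^sub>F X in at_top. lambda2_sol \<xi> \<mu>' X \<longrightarrow> lambda2_sol \<xi> \<mu> X"
      using eventually_ge_1
    proof eventually_elim
      case (elim X)
      then show ?case
        using lambda2_sol_mono[of \<xi> \<mu>' X \<mu>] by (simp add: \<mu>'_def)
    qed
  qed
qed

text \<open>For given t, k is chosen by \<mu> t between c + R(k) and c + R(k+1), and then l is the
  least index at which the first condition of \<open>primal_minimal\<close> holds. A solution must
  then be a multiple of \<open>y k l\<close>, for which size and error allow no exponent above 1 -
  \<delta>. The number 1/(1-\<delta>+\<sigma>) is what makes such an l exist inside the
  block.\<close>

lemma lambda2_upper:
  assumes "1 - \<delta> < \<mu>" "1 / (1 - \<delta> + \<sigma>) < \<mu>"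
  shows "\<not> (\<exists>\<^sub>F X in at_top. lambda2_sol \<xi> \<mu> X)"
proof -
  let ?c = "2 * \<kappa> + 3"
  have m0: "0 < \<mu>"
    using assms(1) delta_lt_1 by linarith
  have "max 0 (1 / \<mu> - 1 + \<delta>) < \<sigma>"
    using assms(2) m0 delta_lt_1 sigma_pos by (simp add: field_simps)
  then obtain \<tau> where \<tau>: "max 0 (1 / \<mu> - 1 + \<delta>) < \<tau>" "\<tau> < \<sigma>"
    using dense by blast
  then have \<tau>0: "0 < \<tau>" by simp
  define \<gamma> where "\<gamma> = \<mu> * (1 - \<delta> + \<tau>) - 1"
  have \<gamma>: "0 < \<gamma>"
    using \<tau>(1) m0 by (simp add: \<gamma>_def field_simps)
  have A: "filterlim (\<lambda>k. (?c + R k) / \<mu>) at_top sequentially"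
    using filterlim_tendsto_pos_mult_at_top[OF tendsto_const[of "1 / \<mu>"] _ R_lim_add[of ?c]] m0
    by simp
  have g0: "0 < \<mu> - 1 + \<delta>"
    using assms(1) by simp
  have large: "\<forall>\<^sub>F t in at_top. 2 * \<kappa> + 1 \<le> (\<mu> - 1 + \<delta>) * t"
    using eventually_ge_at_top[of "(2 * \<kappa> + 1) / (\<mu> - 1 + \<delta>)"]
    by eventually_elim (use g0 in \<open>simp add: field_simps\<close>)
  have "\<forall>\<^sub>F t in at_top. \<not> lambda2_sol \<xi> \<mu> (exp t)"
    using large eventually_bracket[OF A eventually_conj[OF primal_minimal eventually_conj[OF ratio_ev[OF \<tau>(2)]
        eventually_conj[OF ev_R_large[OF \<gamma>, of "(1 + \<mu>) * ?c"] eventually_ge_at_top[of 1]]]]]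
  proof eventually_elim
    case (elim t)
    from elim(2) obtain k where P: "\<forall>l\<le>s (k + 1). \<forall>x t e. x \<noteq> (0, 0, 0) \<longrightarrow> size0 x \<le> exp t \<longrightarrow>
        err \<xi> x \<le> exp e \<longrightarrow> t \<le> R k + (1 - \<delta>) * n k l - ?c \<longrightarrow> t \<le> v k - ?c \<longrightarrow>
        e \<le> - R k - ?c \<longrightarrow> e \<le> R k - n k l - ?c \<longrightarrow>
        exp (n k l - \<kappa>) \<le> size0 x \<and> exp (- (1 - \<delta>) * n k l - \<kappa>) \<le> err \<xi> x"
      and k: "\<tau> * R (k + 1) \<le> R k" "(1 + \<mu>) * ?c \<le> \<gamma> * R k" "1 \<le> k"
        "(?c + R k) / \<mu> \<le> t" "t < (?c + R (Suc k)) / \<mu>"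
      by blast
    have t1: "?c + R k \<le> \<mu> * t" and t2: "\<mu> * t < ?c + R (k + 1)"
      using k(4,5) m0 by (simp_all add: field_simps)
    have gR: "\<gamma> * R k \<le> \<gamma> * R (k + 1)"
      using \<gamma> R_mono by (intro mult_left_mono) auto
    have "\<mu> * (\<tau> * R (k + 1)) \<le> \<mu> * R k"
      using k(1) m0 by (intro mult_left_mono) auto
    then have "\<mu> * t \<le> \<mu> * (R k + (1 - \<delta>) * R (k + 1) - ?c)"
      using t2 k(2) gR unfolding \<gamma>_def by (simp add: algebra_simps)
    then have t3: "t \<le> R k + (1 - \<delta>) * R (k + 1) - ?c"
      using m0 by simp
    define Q where "Q l \<longleftrightarrow> t \<le> R k + (1 - \<delta>) * n k l - ?c" for l
    define l where "l = (LEAST l. Q l)"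
    \<comment> \<open>Here n = R(k+1). The inequality reduces to \<mu> (1-\<delta>+\<tau>) > 1, with
      \<tau> slightly below \<sigma>.\<close>
    have Qlast: "Q (s (k + 1) - 1)"
      unfolding Q_def n_before_last[OF k(3)] by (rule t3)
    have Ql: "Q l" and ls: "l \<le> s (k + 1) - 1"
      using LeastI[of Q, OF Qlast] Least_le[of Q, OF Qlast] by (simp_all add: l_def)
    have "\<delta> * R k \<le> 1 * R (k + 1)"
      using R_mono[of k] R_pos[of k] delta_lt_1 delta_nonneg by (intro mult_mono) auto
    then have "R k + (1 - \<delta>) * R (k + 1) \<le> v k"
      unfolding v_def by (simp add: algebra_simps)
    then have c2: "t \<le> v k - ?c"
      using t3 by linarith
    have c3: "- \<mu> * t \<le> - R k - ?c"
      using t1 by simp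
    \<comment> \<open>For l > 0 the failure of \<open>Q\<close> at the preceding index bounds t from
      below, while R(k) - n(k,l) is minus the preceding size. The same inequality \<mu>
      (1-\<delta>+\<tau>) > 1 closes the gap.\<close>
    have c4: "- \<mu> * t \<le> R k - n k l - ?c"
    proof (cases l)
      case 0
      have "R (k - 1) \<le> R k"
        using R_mono[of "k - 1"] k(3) by simp
      then show ?thesis
        using t1 0 by (simp add: n_0)
    next
      case (Suc j)
      have "\<not> Q j"
        using not_less_Least[of j Q] Suc by (auto simp: l_def[symmetric])
      then have "R k + (1 - \<delta>) * n k j - ?c \<le> t"
        by (simp add: Q_def)
      then have 1: "\<mu> * (R k + (1 - \<delta>) * n k j - ?c) \<le> \<mu> * t"
        using m0 by (intro mult_left_mono) auto
      have "real (j + 1) \<le> real (s (k + 1) - 1)"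
        using ls Suc by simp
      then have "n k (j + 1) \<le> n k (s (k + 1) - 1)"
        unfolding n_def using R_pos[of k] by (intro add_right_mono mult_right_mono) auto
      then have "n k j \<le> R (k + 1)"
        using n_Suc[of k j] R_pos[of k] n_before_last[OF k(3)] by simp
      then have "\<tau> * n k j \<le> R k"
        using k(1) \<tau>0 by (meson mult_le_cancel_left_pos order_trans)
      then have "\<mu> * (\<tau> * n k j) \<le> \<mu> * R k"
        using m0 by (intro mult_left_mono) auto
      moreover have "\<gamma> * R k \<le> \<gamma> * n k j"
        using n_ge \<gamma> by (intro mult_left_mono) auto
      ultimately show ?thesis
        using 1 k(2) unfolding Suc n_Suc \<gamma>_def by (simp add: algebra_simps)
    qed
    show ?case
    proof
      assume "lambda2_sol \<xi> \<mu> (exp t)"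
      then obtain x where x: "x \<noteq> (0, 0, 0)" "size0 x \<le> exp t" "err \<xi> x \<le> exp (- \<mu> * t)"
        unfolding lsol_iff by blast
      have "l \<le> s (k + 1)"
        using ls by simp
      from P[rule_format, OF this x] Ql[unfolded Q_def] c2 c3 c4
      have "exp (n k l - \<kappa>) \<le> size0 x" "exp (- (1 - \<delta>) * n k l - \<kappa>) \<le> err \<xi> x"
        by blast+
      then have "exp (n k l - \<kappa>) \<le> exp t" "exp (- (1 - \<delta>) * n k l - \<kappa>) \<le> exp (- \<mu> * t)"
        using x by linarith+
      \<comment> \<open>Both the size and the error of \<open>y k l\<close> now bound t, and they
        force \<mu> t \<le> (1-\<delta>) t up to a constant.\<close>
      then have 1: "n k l \<le> t + \<kappa>" and 2: "\<mu> * t \<le> (1 - \<delta>) * n k l + \<kappa>"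
        by (simp_all add: algebra_simps)
      have "(1 - \<delta>) * n k l \<le> (1 - \<delta>) * (t + \<kappa>)"
        using 1 delta_lt_1 by (intro mult_left_mono) auto
      moreover have "0 \<le> \<delta> * \<kappa>"
        using kappa delta_nonneg by simp
      ultimately show False
        using 2 elim(1) by (simp add: algebra_simps)
    qed
  qed
  then have "\<forall>\<^sub>F X in at_top. \<not> lambda2_sol \<xi> \<mu> X"
    by (rule iffD2[OF eventually_at_top_exp])
  then show ?thesis
    unfolding frequently_def by blast
qed

text \<open>Up to the size \<open>T k\<close> the best point is the first one of block k. The
  claimed exponent is the limiting ratio of (1-\<delta>) n to R(k) + (1-\<delta>) n with n = R(k) +
  R(k-1), along k where R(k-1)/R(k) approaches \<sigma>.\<close>

lemma lambda2_hat_upper: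
  assumes "(1 - \<delta>) * (1 + \<sigma>) / (1 + (1 - \<delta>) * (1 + \<sigma>)) < \<mu>"
  shows "\<not> (\<forall>\<^sub>F X in at_top. lambda2_sol \<xi> \<mu> X)"
proof
  assume ev: "\<forall>\<^sub>F X in at_top. lambda2_sol \<xi> \<mu> X"
  let ?c = "2 * \<kappa> + 3"
  let ?E = "(1 - \<delta>) * (1 + \<sigma>)"
  \<comment> \<open>The exponent is lowered to some \<nu> below 1, so that inequalities may be
    multiplied by \<open>1 - \<nu>\<close>.\<close>
  have "?E / (1 + ?E) < min \<mu> 1"
    using assms gain by simp
  then obtain \<nu> where \<nu>: "?E / (1 + ?E) < \<nu>" "\<nu> < min \<mu> 1"
    using dense by blast
  have "1 / 2 < ?E / (1 + ?E)"
    using gain by (simp add: field_simps)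
  then have \<nu>2: "1/2 < \<nu>" "\<nu> < 1" "\<nu> \<le> \<mu>"
    using \<nu> by linarith+
  have ev': "\<forall>\<^sub>F X in at_top. lambda2_sol \<xi> \<nu> X"
    using ev eventually_ge_1 by eventually_elim (use \<nu>2(3) in \<open>blast intro: lambda2_sol_mono\<close>)
  have pos: "0 < (1 - \<nu>) * (1 - \<delta>)"
    using \<nu>2 delta_lt_1 by simp
  have "?E < \<nu> * (1 + ?E)"
    using \<nu>(1) gain by (simp add: pos_divide_less_eq)
  then have "\<sigma> < \<nu> / ((1 - \<nu>) * (1 - \<delta>)) - 1"
    unfolding quotient_less_iff[OF pos] by (simp add: algebra_simps)
  then obtain \<tau> where \<tau>: "\<sigma> < \<tau>" "\<tau> < \<nu> / ((1 - \<nu>) * (1 - \<delta>)) - 1"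
    using dense by blast
  define \<gamma> where "\<gamma> = \<nu> - (1 - \<nu>) * (1 - \<delta>) * (1 + \<tau>)"
  have \<gamma>: "0 < \<gamma>"
    using \<tau>(2) unfolding quotient_less_iff[OF pos] \<gamma>_def by (simp add: algebra_simps)
  \<comment> \<open>The largest \<open>t\<close> that \<open>primal_minimal\<close> admits for l =
    0.\<close>
  define T where "T k = R k + (1 - \<delta>) * n k 0 - ?c" for k
  have A: "filterlim (\<lambda>k. exp (T k)) at_top sequentially"
  proof (rule filterlim_compose[OF exp_at_top])
    have "0 \<le> (1 - \<delta>) * n k 0" for k
      using delta_lt_1 n_ge[of k 0] R_pos[of k] by (intro mult_nonneg_nonneg) auto
    then show "filterlim T at_top sequentially"
      by (intro filterlim_at_top_mono[OF R_lim_add[of "- ?c"]]) (simp add: T_def)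
  qed
  have g2: "0 < 2 * \<nu> - 1"
    using \<nu>2 by simp
  have "\<forall>\<^sub>F k in sequentially. \<not> R (k - 1) \<le> \<tau> * R k"
    using eventually_compose_filterlim[OF ev' A] primal_minimal ev_pred[of "\<lambda>k j. R k \<le> (1 - \<delta>) * (R k + R j)", OF ev_delta_ratio]
      ev_R_large[OF g2, of "?c * (1 + \<nu>)"] ev_R_large[OF \<gamma>, of "\<kappa> + \<nu> * ?c + 1"] ev_pred_le
  proof eventually_elim
    case (elim k)
    obtain x where x: "x \<noteq> (0, 0, 0)" "size0 x \<le> exp (T k)" "err \<xi> x \<le> exp (- \<nu> * T k)"
      using elim(1) unfolding lsol_iff by blast
    have 1: "T k \<le> R k + (1 - \<delta>) * n k 0 - ?c"
      by (simp add: T_def)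
    have 2: "T k \<le> v k - ?c"
      using ev_v_ge[of k] by (simp add: T_def n_0)
    have "2 * R k - ?c \<le> T k"
      using elim(3) by (simp add: T_def n_0)
    then have "\<nu> * (2 * R k - ?c) \<le> \<nu> * T k"
      using \<nu>2 by (intro mult_left_mono) auto
    then have 3: "- \<nu> * T k \<le> - R k - ?c"
      using elim(4) by (simp add: algebra_simps)
    then have 4: "- \<nu> * T k \<le> R k - n k 0 - ?c"
      using elim(6) by (simp add: n_0)
    have "exp (- (1 - \<delta>) * n k 0 - \<kappa>) \<le> err \<xi> x"
      using elim(2)[rule_format, of 0 x, OF _ x 1 2 3 4] by simp
    then have "exp (- (1 - \<delta>) * n k 0 - \<kappa>) \<le> exp (- \<nu> * T k)"
      using x(3) by linarith
    then have 5: "\<nu> * T k \<le> (1 - \<delta>) * n k 0 + \<kappa>"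
      by (simp add: algebra_simps)
    show ?case
    proof
      assume "R (k - 1) \<le> \<tau> * R k"
      then have "(1 - \<nu>) * (1 - \<delta>) * R (k - 1) \<le> (1 - \<nu>) * (1 - \<delta>) * (\<tau> * R k)"
        using \<nu>2 delta_lt_1 by (intro mult_left_mono) auto
      then show False
        using 5 elim(5) unfolding T_def n_0 \<gamma>_def by (simp add: algebra_simps)
    qed
  qed
  then show False
    using freq_pred[of "\<lambda>k j. R j \<le> \<tau> * R k", OF ratio_freq[OF \<tau>(1)]] unfolding frequently_def by blast
qed

text \<open>From its own size on, \<open>y k 0\<close> suffices until \<nu> t reaches (1-\<delta>)
  n(k,0). From there to the next block, \<open>plane_point\<close> in the plane of
  \<open>z k\<close> gives a point of size at most exp t and error about exp (R(k) - t).\<close>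

lemma lambda2_hat_lower:
  assumes "\<mu> < (1 - \<delta>) * (1 + \<sigma>) / (1 + (1 - \<delta>) * (1 + \<sigma>))"
  shows "\<forall>\<^sub>F X in at_top. lambda2_sol \<xi> \<mu> X"
proof -
  let ?E = "(1 - \<delta>) * (1 + \<sigma>)"
  define \<nu> where "\<nu> = max \<mu> (1/2)"
  have "1 / 2 < ?E / (1 + ?E)"
    using gain by (simp add: field_simps)
  then have \<nu>: "1/2 \<le> \<nu>" "\<nu> < ?E / (1 + ?E)" "\<mu> \<le> \<nu>"
    using assms by (auto simp: \<nu>_def)
  have "\<delta> * (1 + \<sigma>) \<le> 1"
    using delta_less sigma_le by linarith
  then have "(1 - \<delta>) * (1 + \<sigma>) \<le> (1 - \<delta>) * (1 + ?E)"
    using delta_lt_1 by (intro mult_left_mono) (auto simp: algebra_simps)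
  then have "?E / (1 + ?E) \<le> 1 - \<delta>"
    using gain by (simp add: pos_divide_le_eq)
  then have \<nu>1: "\<nu> < 1 - \<delta>" "\<nu> < 1"
    using \<nu> delta_nonneg by auto
  have pos: "0 < (1 - \<nu>) * (1 - \<delta>)"
    using \<nu>1 delta_lt_1 by simp
  have "\<nu> * (1 + ?E) < ?E"
    using \<nu>(2) gain by (simp add: pos_less_divide_eq)
  then have "\<nu> / ((1 - \<nu>) * (1 - \<delta>)) - 1 < \<sigma>"
    unfolding quotient_less_iff[OF pos] by (simp add: algebra_simps)
  then obtain \<tau> where \<tau>: "\<nu> / ((1 - \<nu>) * (1 - \<delta>)) - 1 < \<tau>" "\<tau> < \<sigma>"
    using dense by blast
  define \<gamma> where "\<gamma> = (1 - \<nu>) * (1 - \<delta>) * (1 + \<tau>) - \<nu>"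
  have \<gamma>: "0 < \<gamma>"
    using \<tau>(1) unfolding quotient_less_iff[OF pos] \<gamma>_def by (simp add: algebra_simps)
  have A: "filterlim (\<lambda>k. n k 0 + \<kappa>) at_top sequentially"
    by (rule filterlim_at_top_mono[OF R_lim_add[of \<kappa>]]) (simp add: n_ge)
  have g0: "0 < 1 - \<delta> - \<nu>"
    using \<nu>1 by simp
  have large: "\<forall>\<^sub>F t in at_top. 4 * \<kappa> + 1 \<le> (1 - \<delta> - \<nu>) * t"
    using eventually_ge_at_top[of "(4 * \<kappa> + 1) / (1 - \<delta> - \<nu>)"]
    by eventually_elim (use g0 in \<open>simp add: field_simps\<close>)
  have "\<forall>\<^sub>F t in at_top. lambda2_sol \<xi> \<nu> (exp t)"
    using large eventually_bracket[OF A eventually_conj[OF ev_y eventually_conj[OF ev_z eventually_conj[OF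
        ev_pred[of "\<lambda>k j. \<tau> * R k \<le> R j", OF ratio_ev[OF \<tau>(2)]]
        eventually_conj[OF ev_R_large[OF \<gamma>, of "4 * \<kappa> + 2"] eventually_ge_at_top[of 1]]]]]]
  proof eventually_elim
    case (elim t)
    from elim(2) obtain k where Y: "\<forall>l\<le>s (k + 1). primitive (y k l) \<and> dot3 (y k l) (z k) = 0 \<and>
        exp (n k l - \<kappa>) \<le> size0 (y k l) \<and> size0 (y k l) \<le> exp (n k l + \<kappa>) \<and>
        exp (- (1 - \<delta>) * n k l - \<kappa>) \<le> err \<xi> (y k l) \<and> err \<xi> (y k l) \<le> exp (- (1 - \<delta>) * n k l + \<kappa>)"
      and Z: "primitive (z k)" "ht (z k) \<le> exp (R k + \<kappa>)"
      and k: "\<tau> * R k \<le> R (k - 1)" "4 * \<kappa> + 2 \<le> \<gamma> * R k" "1 \<le> k"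
        "n k 0 + \<kappa> \<le> t" "t < n (Suc k) 0 + \<kappa>"
      by blast
    note y0 = Y[rule_format, of 0, OF le0]
    show ?case
    proof (cases "- (1 - \<delta>) * n k 0 + \<kappa> \<le> - \<nu> * t")
      case True
      then have "err \<xi> (y k 0) \<le> exp (- \<nu> * t)"
        using y0 by (meson exp_le_cancel_iff order_trans)
      moreover have "size0 (y k 0) \<le> exp t"
        using y0 k(4) by (meson exp_le_cancel_iff order_trans)
      ultimately show ?thesis
        unfolding lsol_iff using y0 primitive_nonzero by blast
    next
      case False
      then have t1: "(1 - \<delta>) * n k 0 - \<kappa> < \<nu> * t"
        by (simp add: algebra_simps)
      let ?y = "y k (s (k + 1))" let ?n = "R (k + 1) + R k"
      let ?Y = "size0 ?y"
      note y = Y[rule_format, of "s (k + 1)", OF order_refl, unfolded n_last[OF k(3)]]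
      have t2: "t < ?n + \<kappa>"
        using k(5) by (simp add: n_0)
      have Ypos: "0 < ?Y"
        using y by (meson exp_gt_zero less_le_trans)
      \<comment> \<open>The least M for which \<open>plane_point\<close> yields size at most exp t.
        The quotient is at least exp (-2 \<kappa>) because \<open>t\<close> stays below the size of
        the last point, so rounding up costs only a constant factor.\<close>
      define M where "M = nat \<lceil>?Y / exp t\<rceil>"
      have Mge: "?Y / exp t \<le> real M"
        unfolding M_def by (rule real_nat_ceiling_ge)
      have Yt: "0 < ?Y / exp t"
        using Ypos by simp
      then have M: "0 < M"
        using Mge by (cases M) auto
      have "real M = of_int \<lceil>?Y / exp t\<rceil>"
        unfolding M_def using Yt by (simp add: le_of_int_ceiling)
      then have Mle: "real M \<le> ?Y / exp t + 1"
        by linarith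
      have "1 = exp (2 * \<kappa>) * exp (- 2 * \<kappa>)"
        by (simp flip: exp_add)
      also have "\<dots> \<le> exp (2 * \<kappa>) * exp (?n - \<kappa> - t)"
        using t2 by (intro mult_left_mono) auto
      also have "\<dots> = exp (2 * \<kappa>) * (exp (?n - \<kappa>) / exp t)"
        by (simp add: exp_diff)
      also have "\<dots> \<le> exp (2 * \<kappa>) * (?Y / exp t)"
        using y by (intro mult_left_mono divide_right_mono) auto
      finally have one: "1 \<le> exp (2 * \<kappa>) * (?Y / exp t)" .
      have "1 * (?Y / exp t) \<le> exp (2 * \<kappa>) * (?Y / exp t)"
        using kappa Yt by (intro mult_right_mono) auto
      with one Mle have "real M \<le> 2 * exp (2 * \<kappa>) * (?Y / exp t)"
        by linarith
      also have "\<dots> \<le> exp 1 * exp (2 * \<kappa>) * (?Y / exp t)"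
        using exp_ge_add_one_self[of 1] Yt by (intro mult_right_mono) auto
      finally have Mle2: "real M \<le> exp (1 + 2 * \<kappa>) * (?Y / exp t)"
        by (simp add: exp_add)
      obtain x where x: "x \<noteq> (0, 0, 0)" "size0 x \<le> ?Y / real M"
          "err \<xi> x \<le> (size0 x * err \<xi> ?y + real M * ht (z k)) / ?Y"
        using plane_point[of ?y "z k" M] y Ypos Z(1) primitive_nonzero M by metis
      have "?Y / real M \<le> exp t"
        using Mge M by (simp add: field_simps)
      then have xt: "size0 x \<le> exp t"
        using x(2) by linarith
      have "err \<xi> x \<le> size0 x * err \<xi> ?y / ?Y + real M * ht (z k) / ?Y"
        using x(3) by (simp add: add_divide_distrib)
      also have "size0 x * err \<xi> ?y / ?Y \<le> exp t * exp (- (1 - \<delta>) * ?n + \<kappa>) / exp (?n - \<kappa>)"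
        using xt y by (intro frac_le mult_mono) (auto simp: err_nonneg)
      also have "\<dots> = exp (t + (- (1 - \<delta>) * ?n + \<kappa>) - (?n - \<kappa>))"
        by (simp only: exp_add exp_diff)
      \<comment> \<open>As \<open>t < ?n + \<kappa>\<close>, this is at most exp (- (1-\<delta>) t)
        up to a constant, and \<nu> < 1 - \<delta> leaves room.\<close>
      also have "\<dots> \<le> exp (- \<nu> * t - 1)"
      proof -
        have "(1 - \<delta>) * (t - \<kappa>) \<le> (1 - \<delta>) * ?n"
          using t2 delta_lt_1 by (intro mult_left_mono) auto
        moreover have "0 \<le> \<delta> * \<kappa>"
          using kappa delta_nonneg by simp
        ultimately show ?thesis
          using elim(1) t2 by (simp add: algebra_simps)
      qed
      also have "real M * ht (z k) / ?Y \<le> exp (1 + 2 * \<kappa>) * (?Y / exp t) * exp (R k + \<kappa>) / ?Y"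
        using Mle2 Z(2) Ypos by (intro divide_right_mono mult_mono) (auto simp: ht_nonneg)
      also have "exp (1 + 2 * \<kappa>) * (?Y / exp t) * exp (R k + \<kappa>) / ?Y = exp (1 + 2 * \<kappa>) * exp (R k + \<kappa>) / exp t"
        using Ypos by simp
      also have "\<dots> = exp (1 + 2 * \<kappa> + (R k + \<kappa>) - t)"
        by (simp only: exp_add exp_diff)
      \<comment> \<open>Failure of the first case gives t > (1-\<delta>) n(k,0) / \<nu> up to a
        constant. With R(k-1) \<ge> \<tau> R(k) this yields R(k) < (1-\<nu>) t, as required.\<close>
      also have "\<dots> \<le> exp (- \<nu> * t - 1)"
      proof -
        have "(1 - \<nu>) * ((1 - \<delta>) * n k 0 - \<kappa>) \<le> (1 - \<nu>) * (\<nu> * t)"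
          using t1 \<nu>1 by (intro mult_left_mono) auto
        moreover have "(1 - \<nu>) * (1 - \<delta>) * (\<tau> * R k) \<le> (1 - \<nu>) * (1 - \<delta>) * R (k - 1)"
          using k(1) \<nu>1 delta_lt_1 by (intro mult_left_mono) auto
        ultimately have "(\<nu> + \<gamma>) * R k - (1 - \<nu>) * \<kappa> \<le> (1 - \<nu>) * (\<nu> * t)"
          unfolding \<gamma>_def n_0 by (simp add: algebra_simps)
        moreover have "(1 - \<nu>) * \<kappa> \<le> 1 * \<kappa>"
          using \<nu> kappa by (intro mult_right_mono) auto
        moreover have "\<nu> * (3 * \<kappa> + 2) \<le> 1 * (3 * \<kappa> + 2)"
          using \<nu>1 kappa by (intro mult_right_mono) auto
        ultimately have "\<nu> * (R k + 3 * \<kappa> + 2) \<le> \<nu> * ((1 - \<nu>) * t)"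
          using k(2) kappa by (simp add: algebra_simps)
        then have "R k + 3 * \<kappa> + 2 \<le> (1 - \<nu>) * t"
          using \<nu>(1) by simp
        then show ?thesis
          by (simp add: algebra_simps)
      qed
      also have "exp (- \<nu> * t - 1) + exp (- \<nu> * t - 1) = 2 * exp (- \<nu> * t - 1)"
        by simp
      also have "\<dots> \<le> exp 1 * exp (- \<nu> * t - 1)"
        using exp_ge_add_one_self[of 1] by (intro mult_right_mono) auto
      also have "\<dots> = exp (- \<nu> * t)"
        by (simp flip: exp_add)
      finally have "err \<xi> x \<le> exp (- \<nu> * t)" by simp
      then show ?thesis
        unfolding lsol_iff using x(1) xt by blast
    qed
  qed
  then have "\<forall>\<^sub>F X in at_top. lambda2_sol \<xi> \<nu> X"
    by (rule iffD2[OF eventually_at_top_exp])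
  then show ?thesis
    using eventually_ge_1 by eventually_elim (use \<nu>(3) in \<open>blast intro: lambda2_sol_mono\<close>)
qed

lemma exponents:
  "omega2 \<xi> = ereal ((2 - \<delta>) / \<sigma> + 1 - \<delta>)"
  "omega2_hat \<xi> = ereal (1 + (1 - \<delta>) * (1 + \<sigma>))"
  "lambda2_hat \<xi> = ereal ((1 - \<delta>) * (1 + \<sigma>) / (1 + (1 - \<delta>) * (1 + \<sigma>)))"
  "ereal (1 - \<delta>) \<le> lambda2 \<xi>"
  "lambda2 \<xi> \<le> ereal (max (1 - \<delta>) (1 / (1 - \<delta> + \<sigma>)))"
proof -
  show "omega2 \<xi> = ereal ((2 - \<delta>) / \<sigma> + 1 - \<delta>)"
    unfolding omega2_def using omega2_lower omega2_upper by (intro Sup_ereal_eqI) auto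
  show "omega2_hat \<xi> = ereal (1 + (1 - \<delta>) * (1 + \<sigma>))"
    unfolding omega2_hat_def using omega2_hat_lower omega2_hat_upper by (intro Sup_ereal_eqI) auto
  show "lambda2_hat \<xi> = ereal ((1 - \<delta>) * (1 + \<sigma>) / (1 + (1 - \<delta>) * (1 + \<sigma>)))"
    unfolding lambda2_hat_def using lambda2_hat_lower lambda2_hat_upper by (intro Sup_ereal_eqI) auto
  show "lambda2 \<xi> \<le> ereal (max (1 - \<delta>) (1 / (1 - \<delta> + \<sigma>)))"
    unfolding lambda2_def
  proof (rule Sup_least)
    fix u assume "u \<in> ereal ` {\<mu>. \<exists>\<^sub>F X in at_top. lambda2_sol \<xi> \<mu> X}"
    then obtain \<mu> where "u = ereal \<mu>" "\<exists>\<^sub>F X in at_top. lambda2_sol \<xi> \<mu> X"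
      by auto
    then show "u \<le> ereal (max (1 - \<delta>) (1 / (1 - \<delta> + \<sigma>)))"
      using lambda2_upper[of \<mu>] by (auto simp: not_less[symmetric])
  qed
  show "ereal (1 - \<delta>) \<le> lambda2 \<xi>"
  proof (rule dense_le)
    fix u assume "u < ereal (1 - \<delta>)"
    then show "u \<le> lambda2 \<xi>"
      unfolding lambda2_def using lambda2_lower by (cases u) (auto intro!: SUP_upper)
  qed
qed

end

section \<open>The recurrence with coefficients \<open>s\<close>\<close>

text \<open>The continuant recurrence started from 1, 1, so that \<open>det (w k) = a ^ q k\<close>.
  The continued fractions in \<sigma> are ratios of the solution started from 1, \<open>s 1\<close>;
  \<open>cf_qr\<close> removes the difference in the limit.\<close>

fun convergent_q :: "(nat \<Rightarrow> nat) \<Rightarrow> nat \<Rightarrow> nat" where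
  "convergent_q s 0 = 1"
| "convergent_q s (Suc 0) = 1"
| "convergent_q s (Suc (Suc k)) = s (Suc (Suc k)) * convergent_q s (Suc k) + convergent_q s k"

locale bounded_quotients =
  fixes s :: "nat \<Rightarrow> nat" and S :: nat
  assumes s_pos: "\<And>k. s k > 0" and s_le: "\<And>k. s k \<le> S"
begin

abbreviation "q \<equiv> convergent_q s"

lemma q_rec: "k \<ge> 1 \<Longrightarrow> q (k + 1) = s (k + 1) * q k + q (k - 1)"
  by (cases k) auto

lemma q_pos: "0 < q k"
  by (induction s k rule: convergent_q.induct) auto

lemma le_s_mult: "j \<le> s k * j"
  using mult_right_mono[of 1 "s k" j] s_pos[of k] by simp

lemma q_add: "q k + q (k + 1) \<le> q (k + 2)"
  using le_s_mult[of "q (Suc k)" "Suc (Suc k)"] by simp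

lemma q_mono: "q k \<le> q (k + 1)"
proof (cases k)
  case (Suc j)
  show ?thesis
    unfolding Suc using q_add[of j] by (simp del: convergent_q.simps)
qed simp

lemma q_ge: "k \<le> q k"
proof (induction k rule: induct_nat_012)
  case (ge2 k)
  then show ?case
    using q_add[of k] q_pos[of k] by (simp del: convergent_q.simps)
qed auto

lemma q_lim: "filterlim (\<lambda>k. real (q k)) at_top sequentially"
  by (rule filterlim_at_top_mono[OF filterlim_real_sequentially]) (simp add: q_ge)

text \<open>The Casoratian of \<open>r\<close> and \<open>q\<close> is \<open>O(q)\<close>, so \<open>r k / q k\<close> converges with rate \<open>1 / q k\<close>.\<close>

lemma perturbed_recurrence:
  fixes r :: "nat \<Rightarrow> real"
  assumes r: "\<And>k. k \<ge> 1 \<Longrightarrow> \<bar>r (k + 1) - real (s (k + 1)) * r k - r (k - 1)\<bar> \<le> E"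
  obtains C B where "\<And>k. \<bar>r k - C * real (q k)\<bar> \<le> B"
proof -
  define W where "W k = r (k + 1) * real (q k) - r k * real (q (k + 1))" for k
  have E: "0 \<le> E"
    using r[of 1] by linarith
  have Wstep: "\<bar>W (Suc k)\<bar> \<le> \<bar>W k\<bar> + E * real (q (Suc k))" for k
  proof -
    let ?e = "r (k + 2) - real (s (k + 2)) * r (k + 1) - r k"
    have "W (Suc k) = - W k + ?e * real (q (Suc k))"
      by (simp add: W_def algebra_simps)
    then have "\<bar>W (Suc k)\<bar> \<le> \<bar>W k\<bar> + \<bar>?e\<bar> * real (q (Suc k))"
      by (metis abs_mult abs_of_nat abs_minus_cancel abs_triangle_ineq)
    moreover have "\<bar>?e\<bar> * real (q (Suc k)) \<le> E * real (q (Suc k))"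
      using r[of "k + 1"] by (intro mult_right_mono) auto
    ultimately show ?thesis by linarith
  qed
  \<comment> \<open>Two steps of \<open>Wstep\<close> are taken at once. They add at most E (q(k+1)
    + q(k+2)) \<le> 3 E s(k+2) q(k+1), which is covered by D (q(k+2) - q(k)) = D s(k+2)
    q(k+1).\<close>
  define D where "D = \<bar>W 0\<bar> + \<bar>W 1\<bar> + 3 * E"
  have D0: "0 \<le> D"
    using E by (simp add: D_def)
  have W: "\<bar>W k\<bar> \<le> D * real (q k)" for k
  proof (induction k rule: induct_nat_012)
    case (ge2 k)
    let ?s = "real (s (Suc (Suc k)))"
    have s1: "1 \<le> ?s"
      using s_pos[of "Suc (Suc k)"] by simp
    have q2: "real (q (Suc (Suc k))) = ?s * real (q (Suc k)) + real (q k)"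
      by simp
    have "E * real (q k) \<le> E * real (q (Suc k))"
      using E q_mono[of k] by (intro mult_left_mono) auto
    moreover have "E * real (q (Suc k)) \<le> E * (?s * real (q (Suc k)))"
      using E mult_right_mono[OF s1, of "real (q (Suc k))"] by (intro mult_left_mono) auto
    moreover have "3 * E * (?s * real (q (Suc k))) \<le> D * (?s * real (q (Suc k)))"
      using s1 by (intro mult_right_mono) (auto simp: D_def)
    moreover have "\<bar>W (Suc (Suc k))\<bar> \<le> D * real (q k) + E * real (q (Suc k)) + E * real (q (Suc (Suc k)))"
      using Wstep[of "Suc k"] Wstep[of k] ge2 by linarith
    ultimately show ?case
      unfolding q2 distrib_left by linarith
  qed (use E in \<open>auto simp: D_def\<close>)
  define u where "u k = r k / real (q k)" for k
  \<comment> \<open>Chosen to telescope: c(k) - c(k+1) = 2 D (1/q(k) - 1/q(k+2)), at least D/q(k)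
    because q(k+2) \<ge> 2 q(k). So the intervals around u(k) of radius c(k) are nested, and
    \<open>C\<close> is a common point of them.\<close>
  define c where "c k = 2 * D * (1 / real (q k) + 1 / real (q (k + 1)))" for k
  have step: "\<bar>u (Suc k) - u k\<bar> \<le> c k - c (Suc k)" for k
  proof -
    have pos: "0 < real (q k)" "0 < real (q (Suc k))" "0 < real (q (Suc (Suc k)))"
      using q_pos by (auto simp del: convergent_q.simps)
    have "u (Suc k) - u k = W k / (real (q k) * real (q (Suc k)))"
      using pos by (simp add: u_def W_def field_simps)
    then have "\<bar>u (Suc k) - u k\<bar> = \<bar>W k\<bar> / (real (q k) * real (q (Suc k)))"
      by simp
    also have "\<dots> \<le> D * real (q k) / (real (q k) * real (q (Suc k)))"
      using W[of k] pos by (intro divide_right_mono) auto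
    also have "\<dots> = D * (1 / real (q (Suc k)))"
      using pos by (simp del: convergent_q.simps)
    also have "\<dots> \<le> D * (1 / real (q k))"
      using D0 pos q_mono[of k] by (intro mult_left_mono divide_left_mono) auto
    also have "\<dots> = D * (2 / real (q k) - 2 / (2 * real (q k)))"
      using pos by simp
    also have "\<dots> \<le> D * (2 / real (q k) - 2 / real (q (Suc (Suc k))))"
      using D0 pos q_mono[of k] q_add[of k]
      by (intro mult_left_mono diff_left_mono divide_left_mono) (auto simp del: convergent_q.simps)
    also have "\<dots> = c k - c (Suc k)"
      by (simp add: c_def algebra_simps)
    finally show ?thesis .
  qed
  have inc: "u k - c k \<le> u (k + m) - c (k + m)" and dec: "u (k + m) + c (k + m) \<le> u k + c k" for k m
    by (induction m) (use step in \<open>smt (verit) add_Suc_right add_0_right\<close>)+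
  have c0: "0 \<le> c k" for k
    using D0 by (simp add: c_def)
  have cross: "u j - c j \<le> u k + c k" for j k
    using inc[of j "k"] dec[of k "j"] c0[of "j + k"] by (simp add: add.commute)
  define C where "C = (SUP j. u j - c j)"
  have bdd: "bdd_above (range (\<lambda>j. u j - c j))"
    using cross by (intro bdd_aboveI) auto
  have lo: "u k - c k \<le> C" and up: "C \<le> u k + c k" for k
    unfolding C_def using cross bdd by (auto intro!: cSUP_upper cSUP_least)
  show thesis
  proof (rule that[of C "4 * D"])
    fix k
    have pos: "0 < real (q k)" "0 < real (q (Suc k))"
      using q_pos by auto
    have "\<bar>u k - C\<bar> \<le> c k"
      using lo[of k] up[of k] by linarith
    also have "\<dots> \<le> 2 * D * (1 / real (q k) + 1 / real (q k))"
      unfolding c_def using D0 pos q_mono[of k] by (intro mult_left_mono add_left_mono divide_left_mono) auto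
    finally have "\<bar>u k - C\<bar> * real (q k) \<le> 2 * D * (1 / real (q k) + 1 / real (q k)) * real (q k)"
      using pos by (intro mult_right_mono) auto
    moreover have "r k - C * real (q k) = (u k - C) * real (q k)"
      using pos by (simp add: u_def algebra_simps)
    then have "\<bar>r k - C * real (q k)\<bar> = \<bar>u k - C\<bar> * real (q k)"
      by (simp add: abs_mult)
    ultimately show "\<bar>r k - C * real (q k)\<bar> \<le> 4 * D"
      using pos by (simp add: field_simps)
  qed
qed

section \<open>Continued fractions and the ratios of consecutive \<open>q k\<close>\<close>

definition "cf k = contfrac (map (\<lambda>i. real (s i)) (rev [1..<k + 2]))"

lemma cf_0: "cf 0 = real (s 1)"
  by (simp add: cf_def)

lemma cf_Suc: "cf (Suc k) = real (s (k + 2)) + 1 / cf k"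
  by (simp add: cf_def)

lemma cf_ge_1: "1 \<le> cf k"
proof (induction k)
  case 0
  then show ?case using s_pos[of 1] by (simp add: cf_0)
next
  case (Suc k)
  have "1 \<le> real (s (k + 2))"
    using s_pos[of "k + 2"] by simp
  moreover have "0 \<le> 1 / cf k"
    using Suc by simp
  ultimately show ?case
    unfolding cf_Suc by linarith
qed

lemma cf_le: "cf k \<le> real S + 1"
proof (cases k)
  case 0
  then show ?thesis using s_le[of 1] by (simp add: cf_0)
next
  case (Suc j)
  have "1 / cf j \<le> 1"
    using cf_ge_1[of j] by (simp add: field_simps)
  then show ?thesis
    using s_le[of "j + 2"] unfolding Suc cf_Suc by (intro add_mono) auto
qed

lemma cf_ge: "1 + 1 / (real S + 1) \<le> cf (Suc k)"
proof -
  have "1 / (real S + 1) \<le> 1 / cf k"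
    using cf_ge_1[of k] cf_le[of k] by (intro divide_left_mono) auto
  moreover have "1 \<le> real (s (k + 2))"
    using s_pos[of "k + 2"] by simp
  ultimately show ?thesis
    unfolding cf_Suc by linarith
qed

definition "qr k = real (q (k + 1)) / real (q k)"

lemma qr_ge_1: "1 \<le> qr k"
  using q_pos[of k] q_mono[of k] by (simp add: qr_def)

lemma qr_Suc: "qr (Suc k) = real (s (k + 2)) + 1 / qr k"
  using q_pos[of k] q_pos[of "Suc k"] by (simp add: qr_def field_simps)

text \<open>Both sequences iterate x \<mapsto> s(k+2) + 1/x, which divides their difference by the
  product of the two terms. Boundedness of \<open>s\<close> keeps that product at least \<rho> > 1;
  the comparison starts at index 1 because \<open>cf 0 = s 1\<close> may equal 1.\<close>

lemma cf_qr: "(\<lambda>k. cf k - qr k) \<longlonglongrightarrow> 0"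
proof -
  define \<rho> where "\<rho> = 1 + 1 / (real S + 1)"
  have l: "1 < \<rho>"
    by (simp add: \<rho>_def)
  have bound: "\<bar>cf (Suc k) - qr (Suc k)\<bar> \<le> \<bar>cf 1 - qr 1\<bar> * (1 / \<rho>) ^ k" for k
  proof (induction k)
    case (Suc k)
    let ?k = "Suc k"
    have p: "\<rho> \<le> cf ?k" "1 \<le> qr ?k"
      using cf_ge[of k] qr_ge_1[of ?k] by (auto simp: \<rho>_def)
    have "cf (Suc ?k) - qr (Suc ?k) = - (cf ?k - qr ?k) / (cf ?k * qr ?k)"
      using p l unfolding cf_Suc[of ?k] qr_Suc[of ?k] by (simp add: field_simps)
    then have "\<bar>cf (Suc ?k) - qr (Suc ?k)\<bar> = \<bar>cf ?k - qr ?k\<bar> / (cf ?k * qr ?k)"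
      using p l by (simp add: abs_mult)
    also have "\<dots> \<le> \<bar>cf ?k - qr ?k\<bar> / (\<rho> * 1)"
      using p l by (intro divide_left_mono mult_mono mult_pos_pos) auto
    also have "\<dots> \<le> \<bar>cf 1 - qr 1\<bar> * (1 / \<rho>) ^ k / \<rho>"
      using Suc l by (simp add: divide_right_mono)
    finally show ?case
      by (simp add: field_simps)
  qed simp
  have "(\<lambda>k. \<bar>cf 1 - qr 1\<bar> * (1 / \<rho>) ^ k) \<longlonglongrightarrow> \<bar>cf 1 - qr 1\<bar> * 0"
    using l by (intro tendsto_mult tendsto_const LIMSEQ_realpow_zero) auto
  then have "(\<lambda>k. cf (Suc k) - qr (Suc k)) \<longlonglongrightarrow> 0"
    using bound by (intro Lim_null_comparison[of "\<lambda>k. cf (Suc k) - qr (Suc k)"]) auto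
  then show ?thesis
    by (simp add: filterlim_sequentially_Suc[of "\<lambda>k. cf k - qr k"])
qed

lemma limsup_cf:
  obtains L where "limsup (\<lambda>k. ereal (cf k)) = ereal L" "1 \<le> L" "sturm_sigma s = 1 / L"
proof -
  let ?l = "limsup (\<lambda>k. ereal (cf k))"
  have "ereal 1 \<le> ?l"
    by (rule le_Limsup) (auto simp: cf_ge_1)
  moreover have "?l \<le> ereal (real S + 1)"
    by (rule Limsup_bounded) (simp only: ereal_less_eq cf_le eventually_True)
  ultimately obtain L where L: "?l = ereal L"
    by (cases ?l) auto
  moreover have "sturm_sigma s = 1 / L"
    using L unfolding sturm_sigma_def cf_def[symmetric] by simp
  ultimately show thesis
    using that \<open>ereal 1 \<le> ?l\<close> by simp
qed

lemma sigma_bounds: "0 < sturm_sigma s" "sturm_sigma s \<le> 1"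
  by (rule limsup_cf; simp)+

lemma ratio_eventually:
  assumes "\<tau> < sturm_sigma s"
  shows "\<forall>\<^sub>F k in sequentially. \<tau> * real (q (k + 1)) \<le> real (q k)"
proof (cases "\<tau> \<le> 0")
  case True
  then have "\<tau> * real (q (k + 1)) \<le> real (q k)" for k
    by (rule order_trans[OF mult_nonpos_nonneg]) auto
  then show ?thesis by simp
next
  case False
  obtain L where L: "limsup (\<lambda>k. ereal (cf k)) = ereal L" "1 \<le> L" "sturm_sigma s = 1 / L"
    by (rule limsup_cf)
  have "L < 1 / \<tau>"
    using assms False L by (simp add: field_simps)
  then obtain m where m: "L < m" "m < 1 / \<tau>"
    using dense by blast
  have "\<forall>\<^sub>F k in sequentially. ereal (cf k) < ereal m"
    using L(1) m(1) by (intro Limsup_lessD) auto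
  moreover have "\<forall>\<^sub>F k in sequentially. \<bar>cf k - qr k\<bar> < 1 / \<tau> - m"
    using tendstoD[OF cf_qr, of "1 / \<tau> - m"] m(2) by (simp add: dist_real_def)
  ultimately show ?thesis
  proof eventually_elim
    case (elim k)
    then have "qr k \<le> 1 / \<tau>"
      by simp
    then show ?case
      using False q_pos[of k] by (simp add: qr_def field_simps)
  qed
qed

lemma ratio_frequently:
  assumes "sturm_sigma s < \<tau>"
  shows "\<exists>\<^sub>F k in sequentially. real (q k) \<le> \<tau> * real (q (k + 1))"
proof (rule ccontr)
  assume "\<not> ?thesis"
  then have ev: "\<forall>\<^sub>F k in sequentially. \<tau> * real (q (k + 1)) < real (q k)"
    by (simp add: frequently_def not_le)
  obtain L where L: "limsup (\<lambda>k. ereal (cf k)) = ereal L" "1 \<le> L" "sturm_sigma s = 1 / L"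
    by (rule limsup_cf)
  have t: "0 < \<tau>"
    using assms sigma_bounds by linarith
  have "1 / \<tau> < L"
    using assms t L by (simp add: field_simps)
  then obtain m where m: "1 / \<tau> < m" "m < L"
    using dense by blast
  have "\<forall>\<^sub>F k in sequentially. \<bar>cf k - qr k\<bar> < m - 1 / \<tau>"
    using tendstoD[OF cf_qr, of "m - 1 / \<tau>"] m(1) by (simp add: dist_real_def)
  with ev have "\<forall>\<^sub>F k in sequentially. ereal (cf k) \<le> ereal m"
  proof eventually_elim
    case (elim k)
    have "qr k < 1 / \<tau>"
      using elim(1) t q_pos[of k] by (simp add: qr_def field_simps)
    then show ?case
      using elim(2) by simp
  qed
  then have "limsup (\<lambda>k. ereal (cf k)) \<le> ereal m"
    by (rule Limsup_bounded)
  then show False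
    using L(1) m(2) by simp
qed

end

section \<open>Products of integer matrices of order two\<close>

definition mat2 :: "int \<Rightarrow> int \<Rightarrow> int \<Rightarrow> int \<Rightarrow> int^2^2" where
  "mat2 p q r t = vector [vector [p, q], vector [r, t]]"

lemma mat2_nth [simp]:
  "mat2 p q r t $ 1 $ 1 = p" "mat2 p q r t $ 1 $ 2 = q"
  "mat2 p q r t $ 2 $ 1 = r" "mat2 p q r t $ 2 $ 2 = t"
  by (simp_all add: mat2_def vector_2)

lemma mult_nth: "((A :: int^2^2) ** B) $ i $ j = A $ i $ 1 * B $ 1 $ j + A $ i $ 2 * B $ 2 $ j"
  by (simp add: matrix_matrix_mult_def UNIV_2)

lemma transpose_nth: "transpose A $ i $ j = A $ j $ i"
  by (simp add: transpose_def)

lemma mat2_eq_iff: "(A :: int^2^2) = B \<longleftrightarrow>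
    A $ 1 $ 1 = B $ 1 $ 1 \<and> A $ 1 $ 2 = B $ 1 $ 2 \<and> A $ 2 $ 1 = B $ 2 $ 1 \<and> A $ 2 $ 2 = B $ 2 $ 2"
  by (auto simp: vec_eq_iff forall_2)

lemma symmetric_mat_iff: "symmetric_mat A \<longleftrightarrow> A $ 1 $ 2 = A $ 2 $ 1"
  by (auto simp: symmetric_mat_def mat2_eq_iff transpose_nth)

lemma mat_power_0 [simp]: "mat_power A 0 = mat 1"
  by (simp add: mat_power_def)

lemma mat_power_Suc: "mat_power A (Suc n) = A ** mat_power A n"
  by (simp add: mat_power_def)

lemma mat_power_Suc2: "mat_power A (Suc n) = mat_power A n ** A"
proof (induction n)
  case (Suc n)
  have "mat_power A (Suc (Suc n)) = A ** mat_power A (Suc n)"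
    by (rule mat_power_Suc)
  also have "\<dots> = A ** (mat_power A n ** A)"
    by (simp only: Suc)
  also have "\<dots> = mat_power A (Suc n) ** A"
    by (simp add: mat_power_Suc matrix_mul_assoc)
  finally show ?case .
qed (simp add: mat_power_Suc)

lemma det_mat_power: "det (mat_power A n) = det A ^ n"
  by (induction n) (simp_all add: mat_power_Suc det_mul)

section \<open>Symmetry along powers and the orthogonal form\<close>

text \<open>A two-term recurrence along the powers of \<open>A\<close>. Stated entrywise, it passes
  to anything linear in the entries: symmetry, or the pairing with a fixed vector.\<close>

lemma cayley_hamilton:
  fixes A X :: "int^2^2"
  shows "(A ** (A ** X)) $ i $ j = (A $ 1 $ 1 + A $ 2 $ 2) * (A ** X) $ i $ j - det A * X $ i $ j"
proof -
  have "i = 1 \<or> i = 2"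
    by (rule exhaust_2)
  then show ?thesis
    by (elim disjE) (simp_all add: mult_nth det_2 algebra_simps)
qed

lemma symmetric_power:
  assumes "symmetric_mat X" "symmetric_mat (A ** X)"
  shows "symmetric_mat (mat_power A n ** X)"
proof -
  have "symmetric_mat (mat_power A n ** X) \<and> symmetric_mat (mat_power A (Suc n) ** X)"
  proof (induction n)
    case 0
    then show ?case using assms by (simp add: mat_power_Suc)
  next
    case (Suc n)
    have "mat_power A (Suc (Suc n)) ** X = A ** (A ** (mat_power A n ** X))"
      "mat_power A (Suc n) ** X = A ** (mat_power A n ** X)"
      by (simp_all add: mat_power_Suc matrix_mul_assoc)
    then show ?case
      using Suc unfolding symmetric_mat_iff by (simp add: cayley_hamilton)
  qed
  then show ?thesis ..
qed

text \<open>The quadratic form of which \<open>(1, \<xi>)\<close> is a zero when it is an eigenvector of \<open>A\<close>;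
  it is orthogonal to the symmetric matrices \<open>Y\<close> for which \<open>A Y\<close> is symmetric.\<close>

definition form_vec :: "int^2^2 \<Rightarrow> ivec" where
  "form_vec A = (- A $ 2 $ 1, A $ 1 $ 1 - A $ 2 $ 2, A $ 1 $ 2)"

definition sym_vec :: "int^2^2 \<Rightarrow> ivec" where
  "sym_vec Y = (Y $ 1 $ 1, Y $ 1 $ 2, Y $ 2 $ 2)"

lemma dot3_form_vec:
  assumes "symmetric_mat Y"
  shows "dot3 (form_vec A) (sym_vec Y) = (A ** Y) $ 1 $ 2 - (A ** Y) $ 2 $ 1"
  using assms by (simp add: symmetric_mat_iff form_vec_def sym_vec_def mult_nth algebra_simps)

text \<open>In the recurrence for A (A N) the trace term is symmetric and drops out; what remains
  measures how far \<open>N\<close> is from being symmetric.\<close>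

lemma dot3_form_vec_mult:
  assumes "symmetric_mat (A ** N)"
  shows "dot3 (form_vec A) (sym_vec (A ** N)) = det A * (N $ 2 $ 1 - N $ 1 $ 2)"
  unfolding dot3_form_vec[OF assms]
  using assms unfolding symmetric_mat_iff cayley_hamilton by (simp add: algebra_simps)

section \<open>Positive matrices whose norm is multiplicative up to a constant\<close>

text \<open>Neighbouring entries have ratios in [1, K]. This class is closed under products: column
  ratios of a product are inherited from the left factor and row ratios from the right one, with the
  same \<open>K\<close>. The norm is the lower right entry, and all entries are comparable to
  it.\<close>

definition tame :: "int \<Rightarrow> int^2^2 \<Rightarrow> bool" where
  "tame K A \<longleftrightarrow> 0 < A $ 1 $ 1 \<and> A $ 1 $ 1 \<le> A $ 1 $ 2 \<and> A $ 1 $ 2 \<le> K * A $ 1 $ 1 \<and>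
     A $ 1 $ 1 \<le> A $ 2 $ 1 \<and> A $ 2 $ 1 \<le> K * A $ 1 $ 1 \<and> A $ 1 $ 2 \<le> A $ 2 $ 2 \<and>
     A $ 2 $ 2 \<le> K * A $ 1 $ 2 \<and> A $ 2 $ 1 \<le> A $ 2 $ 2 \<and> A $ 2 $ 2 \<le> K * A $ 2 $ 1"

lemma tame_pos:
  assumes "tame K A"
  shows "0 < A $ 1 $ 1" "0 < A $ 1 $ 2" "0 < A $ 2 $ 1" "0 < A $ 2 $ 2"
  using assms by (auto simp: tame_def)

lemma tame_mult:
  assumes A: "tame K A" and B: "tame K B"
  shows "tame K (A ** B)"
proof -
  have rows: "u * x + v * y \<le> u * x' + v * y'" if "0 < u" "0 < v" "x \<le> x'" "y \<le> y'" for u v x y x' y' :: int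
    using that by (intro add_mono mult_left_mono) auto
  have rowsK: "u * x + v * y \<le> K * (u * x' + v * y')" if "0 < u" "0 < v" "x \<le> K * x'" "y \<le> K * y'" for u v x y x' y' :: int
    using rows[OF that] by (simp add: algebra_simps)
  have cols: "x * u + y * v \<le> x' * u + y' * v" if "0 < u" "0 < v" "x \<le> x'" "y \<le> y'" for u v x y x' y' :: int
    using that by (intro add_mono mult_right_mono) auto
  have colsK: "x * u + y * v \<le> K * (x' * u + y' * v)" if "0 < u" "0 < v" "x \<le> K * x'" "y \<le> K * y'" for u v x y x' y' :: int
    using cols[OF that] by (simp add: algebra_simps)
  note pos = tame_pos[OF A] tame_pos[OF B]
  note h = A[unfolded tame_def] B[unfolded tame_def]
  show ?thesis
    unfolding tame_def mult_nth
    by (intro conjI rows rowsK cols colsK add_pos_pos mult_pos_pos) (simp_all only: h pos)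
qed

lemma tame_power:
  assumes "tame K A"
  shows "tame K (mat_power A (Suc n))"
proof (induction n)
  case 0
  then show ?case using assms by (simp add: mat_power_Suc)
next
  case (Suc n)
  show ?case
    unfolding mat_power_Suc[of A "Suc n"] by (rule tame_mult[OF assms Suc])
qed

lemma tame_power_mult:
  assumes "tame K A" "tame K B"
  shows "tame K (mat_power A n ** B)"
proof (cases n)
  case (Suc m)
  show ?thesis
    unfolding Suc by (rule tame_mult[OF tame_power[OF assms(1)] assms(2)])
qed (use assms in simp)

lemma mat_norm_tame:
  assumes "tame K A"
  shows "mat_norm A = of_int (A $ 2 $ 2)"
proof -
  have le: "\<bar>A $ i $ j\<bar> \<le> A $ 2 $ 2" for i j
    using assms exhaust_2[of i] exhaust_2[of j] by (auto simp: tame_def)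
  have fin: "finite {\<bar>A $ i $ j\<bar> | i j. True}"
    by (rule finite_subset[of _ "{0..A $ 2 $ 2}"]) (use le in auto)
  have "Max {\<bar>A $ i $ j\<bar> | i j. True} = A $ 2 $ 2"
  proof (rule Max_eqI[OF fin])
    show "A $ 2 $ 2 \<in> {\<bar>A $ i $ j\<bar> | i j. True}"
      using tame_pos(4)[OF assms] by (intro CollectI exI[of _ 2]) simp
  qed (use le in auto)
  then show ?thesis
    by (simp add: mat_norm_def)
qed

text \<open>The lower right entry of the product is A21 B12 + A22 B22, and the first summand lies
  between 0 and the second.\<close>

lemma tame_norm_mult:
  assumes "tame K A" "tame K B"
  shows "mat_norm A * mat_norm B \<le> mat_norm (A ** B)" "mat_norm (A ** B) \<le> 2 * mat_norm A * mat_norm B"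
proof -
  have eq: "mat_norm (A ** B) = of_int (A $ 2 $ 1 * B $ 1 $ 2 + A $ 2 $ 2 * B $ 2 $ 2)"
    using mat_norm_tame[OF tame_mult[OF assms]] by (simp add: mult_nth)
  have "0 \<le> A $ 2 $ 1 * B $ 1 $ 2" "A $ 2 $ 1 * B $ 1 $ 2 \<le> A $ 2 $ 2 * B $ 2 $ 2"
    using tame_pos[OF assms(1)] tame_pos[OF assms(2)] assms
    by (auto intro!: mult_mono simp: tame_def)
  then have "A $ 2 $ 2 * B $ 2 $ 2 \<le> A $ 2 $ 1 * B $ 1 $ 2 + A $ 2 $ 2 * B $ 2 $ 2"
    "A $ 2 $ 1 * B $ 1 $ 2 + A $ 2 $ 2 * B $ 2 $ 2 \<le> 2 * A $ 2 $ 2 * B $ 2 $ 2"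
    by simp_all
  then show "mat_norm A * mat_norm B \<le> mat_norm (A ** B)" "mat_norm (A ** B) \<le> 2 * mat_norm A * mat_norm B"
    unfolding eq mat_norm_tame[OF assms(1)] mat_norm_tame[OF assms(2)]
    by (simp_all only: of_int_mult[symmetric] of_int_le_iff of_int_numeral[symmetric, where ?'a = real])
qed

lemma tame_norm_ge_1: "tame K A \<Longrightarrow> 1 \<le> mat_norm A"
  using tame_pos(4)[of K A] by (simp add: mat_norm_tame)

lemma tame_ln_norm:
  assumes "tame K A" "tame K B"
  shows "\<bar>ln (mat_norm (mat_power A n ** B)) - (real n * ln (mat_norm A) + ln (mat_norm B))\<bar> \<le> real n * ln 2"
    "real n * ln (mat_norm A) + ln (mat_norm B) \<le> ln (mat_norm (mat_power A n ** B))"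
proof -
  have "real n * ln (mat_norm A) + ln (mat_norm B) \<le> ln (mat_norm (mat_power A n ** B)) \<and>
     ln (mat_norm (mat_power A n ** B)) \<le> real n * ln (mat_norm A) + ln (mat_norm B) + real n * ln 2"
  proof (induction n)
    case (Suc n)
    let ?X = "mat_power A n ** B"
    have X: "tame K ?X"
      by (rule tame_power_mult[OF assms])
    have eq: "mat_power A (Suc n) ** B = A ** ?X"
      by (simp add: mat_power_Suc matrix_mul_assoc)
    have p: "0 < mat_norm A" "0 < mat_norm ?X" "0 < mat_norm (A ** ?X)"
      using tame_norm_ge_1[OF assms(1)] tame_norm_ge_1[OF X] tame_norm_ge_1[OF tame_mult[OF assms(1) X]]
      by linarith+
    have "ln (mat_norm A * mat_norm ?X) \<le> ln (mat_norm (A ** ?X))"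
      "ln (mat_norm (A ** ?X)) \<le> ln (2 * mat_norm A * mat_norm ?X)"
      using p tame_norm_mult[OF assms(1) X] by (subst ln_le_cancel_iff; simp)+
    then have "ln (mat_norm A) + ln (mat_norm ?X) \<le> ln (mat_norm (A ** ?X))"
      "ln (mat_norm (A ** ?X)) \<le> ln 2 + ln (mat_norm A) + ln (mat_norm ?X)"
      using p by (simp_all add: ln_mult)
    then show ?case
      using Suc unfolding eq by (simp add: algebra_simps)
  qed simp
  then show "\<bar>ln (mat_norm (mat_power A n ** B)) - (real n * ln (mat_norm A) + ln (mat_norm B))\<bar> \<le> real n * ln 2"
    "real n * ln (mat_norm A) + ln (mat_norm B) \<le> ln (mat_norm (mat_power A n ** B))"
    by linarith+
qed

section \<open>Congruences modulo \<open>a\<close> and primitivity\<close>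

text \<open>Modulo \<open>a\<close> the whole second row vanishes. Hence A11 - A22, the middle
  coordinate of \<open>form_vec A\<close>, is also 1 modulo \<open>a\<close>.\<close>

definition unipotent_mod :: "int \<Rightarrow> int^2^2 \<Rightarrow> bool" where
  "unipotent_mod a A \<longleftrightarrow> a dvd A $ 2 $ 1 \<and> a dvd A $ 2 $ 2 \<and> a dvd A $ 1 $ 1 - 1"

lemma unipotent_mod_mult:
  assumes "unipotent_mod a A" "unipotent_mod a B"
  shows "unipotent_mod a (A ** B)"
proof -
  have "(A ** B) $ 1 $ 1 - 1 = (A $ 1 $ 1 - 1) * B $ 1 $ 1 + (B $ 1 $ 1 - 1) + A $ 1 $ 2 * B $ 2 $ 1"
    by (simp add: mult_nth algebra_simps)
  moreover have "a dvd (A $ 1 $ 1 - 1) * B $ 1 $ 1 + (B $ 1 $ 1 - 1) + A $ 1 $ 2 * B $ 2 $ 1"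
    using assms unfolding unipotent_mod_def by (intro dvd_add) auto
  ultimately have "a dvd (A ** B) $ 1 $ 1 - 1"
    by (simp only:)
  then show ?thesis
    using assms unfolding unipotent_mod_def by (simp add: mult_nth[of A B 2])
qed

lemma unipotent_mod_power_mult:
  assumes "unipotent_mod a A" "unipotent_mod a B"
  shows "unipotent_mod a (mat_power A n ** B)"
proof (induction n)
  case (Suc n)
  then show ?case
    using unipotent_mod_mult[OF assms(1)] by (simp add: mat_power_Suc flip: matrix_mul_assoc)
qed (simp add: assms)

lemma primitiveI:
  assumes "\<And>d. d dvd x0 \<Longrightarrow> d dvd x1 \<Longrightarrow> d dvd x2 \<Longrightarrow> is_unit d"
  shows "primitive (x0, x1, x2)"
proof -
  have "is_unit (gcd x0 (gcd x1 x2))"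
    by (rule assms) (meson dvd_trans gcd_dvd1 gcd_dvd2)+
  then have g: "gcd x0 (gcd x1 x2) = 1"
    by simp
  obtain u v where uv: "u * x0 + v * gcd x1 x2 = gcd x0 (gcd x1 x2)"
    using bezout_int by blast
  obtain u' v' where uv': "u' * x1 + v' * x2 = gcd x1 x2"
    using bezout_int by blast
  have "u * x0 + v * (u' * x1 + v' * x2) = 1"
    using uv uv' g by simp
  then have "dot3 (x0, x1, x2) (u, v * u', v * v') = 1"
    by (simp add: algebra_simps)
  then show ?thesis
    unfolding primitive_def by blast
qed

text \<open>The source of every content bound: a determinant or a pairing shows that a common
  divisor divides a power of \<open>a\<close>, and a coordinate congruent to 1 or -1 makes it
  coprime to \<open>a\<close>.\<close>

lemma coprime_dvd_power_unit:
  fixes d a c :: int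
  assumes "a dvd c - 1 \<or> a dvd c + 1" "d dvd c" "d dvd a ^ n"
  shows "is_unit d"
proof -
  have "coprime d a"
  proof (rule coprimeI)
    fix e assume e: "e dvd d" "e dvd a"
    have "e dvd c"
      using e(1) assms(2) by (rule dvd_trans)
    moreover have "e dvd c - 1 \<or> e dvd c + 1"
      using assms(1) e(2) by (meson dvd_trans)
    ultimately show "is_unit e"
      by (metis dvd_add_right_iff dvd_diff_right_iff)
  qed
  then have "coprime d (a ^ n)"
    by simp
  then show ?thesis
    using assms(3) by (meson coprime_common_divisor dvd_refl)
qed

section \<open>Column slopes enclosing \<open>\<xi>\<close>, and the errors of symmetric
  products\<close>

definition brackets :: "int^2^2 \<Rightarrow> real \<Rightarrow> bool" where
  "brackets A \<xi> \<longleftrightarrow> of_int (A $ 2 $ 1) \<le> \<xi> * of_int (A $ 1 $ 1) \<and> \<xi> * of_int (A $ 1 $ 2) \<le> of_int (A $ 2 $ 2)"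

definition lower_slope :: "int^2^2 \<Rightarrow> real" where
  "lower_slope A = of_int (A $ 2 $ 1) / of_int (A $ 1 $ 1)"

definition upper_slope :: "int^2^2 \<Rightarrow> real" where
  "upper_slope A = of_int (A $ 2 $ 2) / of_int (A $ 1 $ 2)"

lemma brackets_iff:
  assumes "tame K A"
  shows "brackets A \<xi> \<longleftrightarrow> lower_slope A \<le> \<xi> \<and> \<xi> \<le> upper_slope A"
  using tame_pos[OF assms] unfolding brackets_def lower_slope_def upper_slope_def
  by (simp add: pos_divide_le_eq pos_le_divide_eq)

text \<open>The columns of the product are positive combinations of the columns of \<open>A\<close>,
  so their slopes lie between those of \<open>A\<close>.\<close>

lemma slopes_mult:
  assumes "tame K A" "tame K B" "0 < det A"
  shows "lower_slope A \<le> lower_slope (A ** B)" "upper_slope (A ** B) \<le> upper_slope A"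
proof -
  note pos = tame_pos[OF assms(1)] tame_pos[OF assms(2)] tame_pos[OF tame_mult[OF assms(1,2)]]
  have d: "A $ 1 $ 2 * A $ 2 $ 1 \<le> A $ 1 $ 1 * A $ 2 $ 2"
    using assms(3) by (simp add: det_2)
  have "A $ 2 $ 1 * (A ** B) $ 1 $ 1 \<le> (A ** B) $ 2 $ 1 * A $ 1 $ 1"
    using mult_right_mono[OF d, of "B $ 2 $ 1"] pos by (simp add: mult_nth algebra_simps)
  then have "of_int (A $ 2 $ 1) * of_int ((A ** B) $ 1 $ 1) \<le> of_int ((A ** B) $ 2 $ 1) * (of_int (A $ 1 $ 1) :: real)"
    by (metis of_int_le_iff of_int_mult)
  then show "lower_slope A \<le> lower_slope (A ** B)"
    unfolding lower_slope_def using pos by (simp add: frac_le_eq divide_le_0_iff mult.commute)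
  have "(A ** B) $ 2 $ 2 * A $ 1 $ 2 \<le> A $ 2 $ 2 * (A ** B) $ 1 $ 2"
    using mult_right_mono[OF d, of "B $ 1 $ 2"] pos by (simp add: mult_nth algebra_simps)
  then have "of_int ((A ** B) $ 2 $ 2) * of_int (A $ 1 $ 2) \<le> of_int (A $ 2 $ 2) * (of_int ((A ** B) $ 1 $ 2) :: real)"
    by (metis of_int_le_iff of_int_mult)
  then show "upper_slope (A ** B) \<le> upper_slope A"
    unfolding upper_slope_def using pos by (simp add: frac_le_eq divide_le_0_iff mult.commute)
qed

lemma slopes_le:
  assumes "tame K A" "0 < det A"
  shows "lower_slope A \<le> upper_slope A"
proof -
  note pos = tame_pos[OF assms(1)]
  have "A $ 1 $ 2 * A $ 2 $ 1 \<le> A $ 1 $ 1 * A $ 2 $ 2"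
    using assms(2) by (simp add: det_2)
  then have "of_int (A $ 1 $ 2) * of_int (A $ 2 $ 1) \<le> of_int (A $ 1 $ 1) * (of_int (A $ 2 $ 2) :: real)"
    by (metis of_int_le_iff of_int_mult)
  then show ?thesis
    unfolding lower_slope_def upper_slope_def using pos by (simp add: frac_le_eq divide_le_0_iff mult.commute)
qed

lemma brackets_mult:
  assumes "tame K A" "tame K B" "0 < det A" "brackets (A ** B) \<xi>"
  shows "brackets A \<xi>"
  using assms(4) slopes_mult[OF assms(1-3)]
  unfolding brackets_iff[OF assms(1)] brackets_iff[OF tame_mult[OF assms(1,2)]] by linarith

lemma tame_entries_le:
  assumes "tame K A"
  shows "A $ 2 $ 2 \<le> K ^ 2 * A $ 1 $ 1" "A $ 2 $ 2 \<le> K ^ 2 * A $ 1 $ 2" "1 \<le> K"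
proof -
  note pos = tame_pos[OF assms]
  have "0 < K * A $ 1 $ 1"
    using assms pos unfolding tame_def by linarith
  then show K: "1 \<le> K"
    using pos by (simp add: zero_less_mult_iff)
  have "K * A $ 1 $ 2 \<le> K * (K * A $ 1 $ 1)"
    using assms K unfolding tame_def by (intro mult_left_mono) auto
  then show "A $ 2 $ 2 \<le> K ^ 2 * A $ 1 $ 1"
    using assms unfolding tame_def by (simp add: power2_eq_square mult.assoc)
  have "K * A $ 1 $ 2 \<le> K ^ 2 * A $ 1 $ 2"
    using K pos by (simp add: power2_eq_square)
  then show "A $ 2 $ 2 \<le> K ^ 2 * A $ 1 $ 2"
    using assms unfolding tame_def by linarith
qed

text \<open>The interval of slopes has length det A / (A11 A12). Multiplying by one of these two
  entries leaves the other in the denominator, and it is comparable to the norm.\<close>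

lemma brackets_columns:
  assumes "tame K A" "0 < det A" "brackets A \<xi>"
  shows "\<bar>\<xi> * of_int (A $ 1 $ 1) - of_int (A $ 2 $ 1)\<bar> \<le> of_int K ^ 2 * of_int (det A) / mat_norm A"
    "\<bar>\<xi> * of_int (A $ 1 $ 2) - of_int (A $ 2 $ 2)\<bar> \<le> of_int K ^ 2 * of_int (det A) / mat_norm A"
proof -
  define p q r t where "p = real_of_int (A $ 1 $ 1)" and "q = real_of_int (A $ 1 $ 2)"
    and "r = real_of_int (A $ 2 $ 1)" and "t = real_of_int (A $ 2 $ 2)"
  note defs = p_def q_def r_def t_def
  have pos: "0 < p" "0 < q" "0 < t"
    using tame_pos[OF assms(1)] by (simp_all add: defs)
  have D: "real_of_int (det A) = p * t - q * r"
    by (simp add: defs det_2)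
  have D0: "0 < p * t - q * r"
    using assms(2) by (simp flip: D)
  have b: "r \<le> \<xi> * p" "\<xi> * q \<le> t"
    using assms(3) by (simp_all add: brackets_def defs)
  have tp: "t \<le> of_int K ^ 2 * p" and tq: "t \<le> of_int K ^ 2 * q"
    using tame_entries_le(1,2)[OF assms(1)] unfolding defs
    by (metis of_int_le_iff of_int_mult of_int_power)+
  have 1: "(\<xi> * p - r) * q \<le> p * t - q * r"
    using mult_left_mono[OF b(2), of p] pos by (simp add: algebra_simps)
  have 2: "(t - \<xi> * q) * p \<le> p * t - q * r"
    using mult_left_mono[OF b(1), of q] pos by (simp add: algebra_simps)
  have "(\<xi> * p - r) * t \<le> (\<xi> * p - r) * (of_int K ^ 2 * q)"
    using tq b by (intro mult_left_mono) auto
  also have "\<dots> \<le> of_int K ^ 2 * (p * t - q * r)"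
    using mult_left_mono[OF 1, of "of_int K ^ 2"] by (simp add: algebra_simps)
  finally have "\<bar>\<xi> * p - r\<bar> \<le> of_int K ^ 2 * (p * t - q * r) / t"
    using pos b by (simp add: pos_le_divide_eq)
  then show "\<bar>\<xi> * of_int (A $ 1 $ 1) - of_int (A $ 2 $ 1)\<bar> \<le> of_int K ^ 2 * of_int (det A) / mat_norm A"
    unfolding D mat_norm_tame[OF assms(1)] by (simp add: defs)
  have "(t - \<xi> * q) * t \<le> (t - \<xi> * q) * (of_int K ^ 2 * p)"
    using tp b by (intro mult_left_mono) auto
  also have "\<dots> \<le> of_int K ^ 2 * (p * t - q * r)"
    using mult_left_mono[OF 2, of "of_int K ^ 2"] by (simp add: algebra_simps)
  finally have "\<bar>\<xi> * q - t\<bar> \<le> of_int K ^ 2 * (p * t - q * r) / t"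
    using pos b by (simp add: pos_le_divide_eq)
  then show "\<bar>\<xi> * of_int (A $ 1 $ 2) - of_int (A $ 2 $ 2)\<bar> \<le> of_int K ^ 2 * of_int (det A) / mat_norm A"
    unfolding D mat_norm_tame[OF assms(1)] by (simp add: defs)
qed

text \<open>The row (\<xi>, -1) times \<open>A\<close> is small, hence so is its product with
  \<open>A ** M\<close>. Symmetry reads the two entries of the latter as successive errors y0 \<xi>
  - y1 and y1 \<xi> - y2. The last claim bounds \<open>size0\<close> from below.\<close>

lemma symmetric_product_err:
  assumes A: "tame K A" "0 < det A" "brackets A \<xi>" and sym: "symmetric_mat (A ** M)"
    and M: "\<And>i j. \<bar>real_of_int (M $ i $ j)\<bar> \<le> \<nu>"
  defines "\<eta> \<equiv> 2 * \<nu> * of_int K ^ 2 * of_int (det A) / mat_norm A"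
  shows "\<bar>of_int ((A ** M) $ 1 $ 1) * \<xi> - of_int ((A ** M) $ 1 $ 2)\<bar> \<le> \<eta>"
    "\<bar>of_int ((A ** M) $ 1 $ 2) * \<xi> - of_int ((A ** M) $ 2 $ 2)\<bar> \<le> \<eta>"
    "err \<xi> (sym_vec (A ** M)) \<le> (1 + \<bar>\<xi>\<bar>) * \<eta>"
    "size0 (sym_vec (A ** M)) \<le> 2 * \<nu> * mat_norm A"
    "\<bar>of_int (det M)\<bar> * mat_norm A \<le> \<nu> * ((\<bar>\<xi>\<bar> + \<bar>\<xi>\<bar> ^ 2) * size0 (sym_vec (A ** M)) + (2 + \<bar>\<xi>\<bar>) * \<eta>)"
proof -
  let ?e = "of_int K ^ 2 * of_int (det A) / mat_norm A"
  let ?p = "real_of_int (A $ 1 $ 1)" let ?q = "real_of_int (A $ 1 $ 2)"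
  let ?r = "real_of_int (A $ 2 $ 1)" let ?t = "real_of_int (A $ 2 $ 2)"
  have \<nu>: "0 \<le> \<nu>"
    using M[of 1 1] by linarith
  note col = brackets_columns[OF A]
  have e0: "0 \<le> ?e"
    using col(1) by linarith
  have lin: "\<bar>u * of_int (M $ i $ j) + v * of_int (M $ i' $ j')\<bar> \<le> 2 * \<nu> * e"
    if "\<bar>u\<bar> \<le> e" "\<bar>v\<bar> \<le> e" for u v e :: real and i j i' j'
  proof -
    have "\<bar>x * of_int (M $ i $ j)\<bar> \<le> e * \<nu>" if "\<bar>x\<bar> \<le> e" for x i j
      unfolding abs_mult using that M[of i j] \<nu> by (intro mult_mono) auto
    from this[OF that(1), of i j] this[OF that(2), of i' j'] show ?thesis
      by (simp add: algebra_simps)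
  qed
  have \<eta>: "\<eta> = 2 * \<nu> * ?e"
    by (simp add: \<eta>_def)
  have y: "real_of_int ((A ** M) $ 2 $ 1) = real_of_int ((A ** M) $ 1 $ 2)"
    using sym by (simp add: symmetric_mat_iff)
  show 1: "\<bar>of_int ((A ** M) $ 1 $ 1) * \<xi> - of_int ((A ** M) $ 1 $ 2)\<bar> \<le> \<eta>"
    using lin[OF col, of 1 1 2 1] unfolding \<eta> y[symmetric] by (simp add: mult_nth algebra_simps)
  show 2: "\<bar>of_int ((A ** M) $ 1 $ 2) * \<xi> - of_int ((A ** M) $ 2 $ 2)\<bar> \<le> \<eta>"
    using lin[OF col, of 1 2 2 2] unfolding \<eta> by (simp add: mult_nth algebra_simps)
  define y0 y1 y2 where "y0 = real_of_int ((A ** M) $ 1 $ 1)" and "y1 = real_of_int ((A ** M) $ 1 $ 2)"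
    and "y2 = real_of_int ((A ** M) $ 2 $ 2)"
  have near1: "\<bar>y0 * \<xi> - y1\<bar> \<le> \<eta>" and near2: "\<bar>y1 * \<xi> - y2\<bar> \<le> \<eta>"
    using 1 2 by (simp_all add: y0_def y1_def y2_def)
  have \<eta>0: "0 \<le> \<eta>"
    using 1 by linarith
  have "\<bar>\<xi> * (y0 * \<xi> - y1)\<bar> \<le> \<bar>\<xi>\<bar> * \<eta>"
    unfolding abs_mult using near1 by (intro mult_left_mono) auto
  moreover have eq: "y0 * \<xi>\<^sup>2 - y2 = \<xi> * (y0 * \<xi> - y1) + (y1 * \<xi> - y2)"
    by (simp add: algebra_simps power2_eq_square)
  ultimately have "\<bar>y0 * \<xi>\<^sup>2 - y2\<bar> \<le> (1 + \<bar>\<xi>\<bar>) * \<eta>"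
    unfolding eq distrib_right using near2 by linarith
  moreover have "\<bar>y0 * \<xi> - y1\<bar> \<le> (1 + \<bar>\<xi>\<bar>) * \<eta>"
    using near1 \<eta>0 by (simp add: distrib_right add_increasing2)
  ultimately show "err \<xi> (sym_vec (A ** M)) \<le> (1 + \<bar>\<xi>\<bar>) * \<eta>"
    by (simp add: sym_vec_def y0_def y1_def y2_def)
  have pq: "\<bar>?p\<bar> \<le> mat_norm A" "\<bar>?q\<bar> \<le> mat_norm A"
    using A(1) unfolding mat_norm_tame[OF A(1)] tame_def by auto
  show "size0 (sym_vec (A ** M)) \<le> 2 * \<nu> * mat_norm A"
    using lin[OF pq, of 1 1 2 1] by (simp add: sym_vec_def mult_nth)
  have y1: "\<bar>y1\<bar> \<le> \<bar>\<xi>\<bar> * \<bar>y0\<bar> + \<eta>"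
    using near1 abs_mult[of y0 \<xi>] by (simp add: mult.commute)
  have "\<bar>y2\<bar> \<le> \<bar>\<xi>\<bar> * \<bar>y1\<bar> + \<eta>"
    using near2 abs_mult[of y1 \<xi>] by (simp add: mult.commute)
  also have "\<bar>\<xi>\<bar> * \<bar>y1\<bar> \<le> \<bar>\<xi>\<bar> * (\<bar>\<xi>\<bar> * \<bar>y0\<bar> + \<eta>)"
    using y1 by (intro mult_left_mono) auto
  finally have y2: "\<bar>y2\<bar> \<le> \<bar>\<xi>\<bar> * (\<bar>\<xi>\<bar> * \<bar>y0\<bar> + \<eta>) + \<eta>"
    by simp
  \<comment> \<open>The lower right entry of (A M) adj M = det M A; it recovers the norm of
    \<open>A\<close> from the product.\<close>
  have "real_of_int (det M) * ?t = y2 * of_int (M $ 1 $ 1) - y1 * of_int (M $ 1 $ 2)"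
    unfolding y1_def y2_def y[symmetric] by (simp add: mult_nth det_2 algebra_simps)
  then have "\<bar>real_of_int (det M)\<bar> * \<bar>?t\<bar> \<le> \<bar>y2 * of_int (M $ 1 $ 1)\<bar> + \<bar>y1 * of_int (M $ 1 $ 2)\<bar>"
    unfolding abs_mult[symmetric, of "real_of_int (det M)"] by linarith
  also have "\<dots> \<le> \<bar>y2\<bar> * \<nu> + \<bar>y1\<bar> * \<nu>"
    unfolding abs_mult by (intro add_mono mult_left_mono M) auto
  also have "\<dots> \<le> (\<bar>\<xi>\<bar> * (\<bar>\<xi>\<bar> * \<bar>y0\<bar> + \<eta>) + \<eta>) * \<nu> + (\<bar>\<xi>\<bar> * \<bar>y0\<bar> + \<eta>) * \<nu>"
    using y1 y2 \<nu> by (intro add_mono mult_right_mono)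
  also have "\<dots> = \<nu> * ((\<bar>\<xi>\<bar> + \<bar>\<xi>\<bar> ^ 2) * \<bar>y0\<bar> + (2 + \<bar>\<xi>\<bar>) * \<eta>)"
    by (simp add: algebra_simps power2_eq_square)
  finally show "\<bar>of_int (det M)\<bar> * mat_norm A \<le> \<nu> * ((\<bar>\<xi>\<bar> + \<bar>\<xi>\<bar> ^ 2) * size0 (sym_vec (A ** M)) + (2 + \<bar>\<xi>\<bar>) * \<eta>)"
    using mat_norm_tame[OF A(1)] tame_pos(4)[OF A(1)] by (simp add: sym_vec_def y0_def)
qed

text \<open>On the conic y0 y2 = y1^2 the determinant vanishes, so it is linear in the errors up to
  a square. As determinants of the points are known, this bounds their errors from below.\<close>

lemma det_le_err:
  assumes "symmetric_mat Y" "1 \<le> size0 (sym_vec Y)"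
  shows "\<bar>of_int (det Y)\<bar> \<le> size0 (sym_vec Y) * err \<xi> (sym_vec Y) * (1 + 2 * \<bar>\<xi>\<bar> + err \<xi> (sym_vec Y))"
proof -
  define y0 y1 y2 where "y0 = real_of_int (Y $ 1 $ 1)" and "y1 = real_of_int (Y $ 1 $ 2)"
    and "y2 = real_of_int (Y $ 2 $ 2)"
  define e where "e = err \<xi> (sym_vec Y)"
  define e1 e2 where "e1 = y0 * \<xi> - y1" and "e2 = y0 * \<xi>\<^sup>2 - y2"
  have e: "\<bar>e1\<bar> \<le> e" "\<bar>e2\<bar> \<le> e" "0 \<le> e"
    by (auto simp: e_def e1_def e2_def sym_vec_def y0_def y1_def y2_def)
  have s: "size0 (sym_vec Y) = \<bar>y0\<bar>"
    by (simp add: sym_vec_def y0_def)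
  have "real_of_int (det Y) = y0 * y2 - y1 * y1"
    using assms(1) by (simp add: det_2 symmetric_mat_iff y0_def y1_def y2_def)
  also have "\<dots> = - (y0 * e2) + 2 * (\<xi> * (y0 * e1)) - e1 * e1"
    by (simp add: e1_def e2_def algebra_simps power2_eq_square)
  finally have "\<bar>real_of_int (det Y)\<bar> \<le> \<bar>y0 * e2\<bar> + 2 * \<bar>\<xi> * (y0 * e1)\<bar> + \<bar>e1 * e1\<bar>"
    by linarith
  also have "\<dots> \<le> \<bar>y0\<bar> * e + 2 * (\<bar>\<xi>\<bar> * (\<bar>y0\<bar> * e)) + \<bar>y0\<bar> * (e * e)"
  proof (intro add_mono)
    show "\<bar>y0 * e2\<bar> \<le> \<bar>y0\<bar> * e" "2 * \<bar>\<xi> * (y0 * e1)\<bar> \<le> 2 * (\<bar>\<xi>\<bar> * (\<bar>y0\<bar> * e))"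
      unfolding abs_mult using e by (auto intro!: mult_left_mono)
    have "\<bar>e1 * e1\<bar> \<le> e * e"
      unfolding abs_mult using e by (intro mult_mono) auto
    also have "\<dots> \<le> \<bar>y0\<bar> * (e * e)"
      using assms(2) e unfolding s by (simp add: mult_le_cancel_right1)
    finally show "\<bar>e1 * e1\<bar> \<le> \<bar>y0\<bar> * (e * e)" .
  qed
  finally show ?thesis
    unfolding s e_def[symmetric] by (simp add: algebra_simps)
qed

section \<open>A family of admissible Sturmian sequences\<close>

fun sturm_w :: "(nat \<Rightarrow> nat) \<Rightarrow> int \<Rightarrow> int \<Rightarrow> nat \<Rightarrow> int^2^2" where
  "sturm_w s a b 0 = mat2 1 b a (a * (b + 1))"
| "sturm_w s a b (Suc 0) = mat2 1 (b + 1) a (a * (b + 2))"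
| "sturm_w s a b (Suc (Suc k)) = mat_power (sturm_w s a b (Suc k)) (s (Suc (Suc k))) ** sturm_w s a b k"

locale sturm_matrices = bounded_quotients +
  fixes a b :: int
  assumes a_pos: "1 \<le> a" and b_pos: "1 \<le> b"
begin

abbreviation "w \<equiv> sturm_w s a b"

text \<open>Admissibility amounts to three linear equations in the four entries. With this solution,
  \<open>w 1 ** N\<close> and \<open>w 0 ** transpose N\<close> have rows (a(b+1)-1, -a), (-a, 0)
  and (a(b+2)-1, -a), (-a, 0). The determinant is -a and the off-diagonal entries differ by
  a.\<close>

definition N :: "int^2^2" where
  "N = mat2 (a * (b + 1) * (b + 2) - 1) (- a * (b + 2)) (- a * (b + 1)) a"

definition Nk :: "nat \<Rightarrow> int^2^2" where
  "Nk k = (if even k then N else transpose N)"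

definition word :: "nat \<Rightarrow> nat \<Rightarrow> int^2^2" where
  "word k l = mat_power (w k) (l + 1) ** w (k - 1)"

definition pt :: "nat \<Rightarrow> nat \<Rightarrow> int^2^2" where
  "pt k l = word k l ** Nk k"

text \<open>The largest entry of \<open>w 1\<close>, hence a bound for all entry ratios in
  \<open>w 0\<close> and \<open>w 1\<close>.\<close>

abbreviation "K \<equiv> a * (b + 2)"

lemma w_rec: "k \<ge> 1 \<Longrightarrow> w (k + 1) = mat_power (w k) (s (k + 1)) ** w (k - 1)"
  by (cases k) auto

lemma K_ge: "1 \<le> K" "b + 2 \<le> K" "a \<le> K"
proof -
  show "b + 2 \<le> K"
    using mult_right_mono[OF a_pos, of "b + 2"] b_pos by simp
  then show "1 \<le> K"
    using b_pos by linarith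
  show "a \<le> K"
    using mult_left_mono[of 1 "b + 2" a] a_pos b_pos by simp
qed

lemma le_K_mult: "x \<le> K \<Longrightarrow> 1 \<le> u \<Longrightarrow> x \<le> K * u"
  using mult_left_mono[of 1 u K] K_ge(1) by simp

lemma tame_w: "tame K (w k)"
proof (induction k rule: induct_nat_012)
  have ab: "b \<le> a * b" "a \<le> a * b"
    using a_pos b_pos by simp_all
  note facts = ab a_pos b_pos K_ge[unfolded distrib_left]
  case 0
  show ?case
    unfolding tame_def sturm_w.simps mat2_nth
    by (intro conjI le_K_mult; (unfold distrib_left)?; use facts in linarith)
  case 1
  show ?case
    unfolding tame_def sturm_w.simps mat2_nth
    by (intro conjI le_K_mult; (unfold distrib_left)?; use facts in linarith)
next
  case (ge2 k)
  then show ?case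
    by (simp add: tame_power_mult)
qed

lemma tame_word: "tame K (word k l)"
  unfolding word_def by (rule tame_power_mult[OF tame_w tame_w])

lemma det_w: "det (w k) = a ^ q k"
proof (induction k rule: induct_nat_012)
  case (ge2 k)
  then show ?case
    by (simp add: det_mul det_mat_power power_add mult.commute flip: power_mult)
qed (simp_all add: det_2 algebra_simps)

lemma det_word: "det (word k l) = a ^ ((l + 1) * q k + q (k - 1))"
  by (simp add: word_def det_mul det_mat_power det_w power_add algebra_simps power_mult flip: power_mult)

lemma det_w_pos: "0 < det (w k)" and det_word_pos: "0 < det (word k l)"
  using a_pos by (simp_all add: det_w det_word)

lemma unipotent_w: "unipotent_mod a (w k)"
proof (induction k rule: induct_nat_012)
  case (ge2 k)
  then show ?case by (simp add: unipotent_mod_power_mult)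
qed (simp_all add: unipotent_mod_def)

lemma det_Nk: "det (Nk k) = - a"
  by (simp add: Nk_def N_def det_2 transpose_nth algebra_simps)

lemma Nk_diff: "\<bar>Nk k $ 2 $ 1 - Nk k $ 1 $ 2\<bar> = a"
  using a_pos by (simp add: Nk_def N_def transpose_nth algebra_simps)

lemma Nk_Suc: "Nk (Suc k) = transpose (Nk k)"
  by (simp add: Nk_def transpose_transpose)

lemma word_step: "word k (Suc l) = w k ** word k l"
  by (simp add: word_def mat_power_Suc matrix_mul_assoc)

lemma pt_step: "pt k (Suc l) = w k ** pt k l"
  by (simp add: pt_def word_step matrix_mul_assoc)

lemma word_last:
  assumes "k \<ge> 1"
  shows "word k (s (k + 1) - 1) = w (k + 1)"
proof -
  have "s (k + 1) - 1 + 1 = s (k + 1)"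
    using s_pos[of "k + 1"] by simp
  then show ?thesis
    unfolding word_def w_rec[OF assms] by (simp only:)
qed

section \<open>Symmetry of the points and their planes\<close>

text \<open>Admissibility is inherited by (w(k+1), w(k)) when \<open>N\<close> and its transpose
  alternate. Transposing w(k+1) w(k+2) N(k+1) also shows that consecutive blocks share a point, so
  that point lies in both planes.\<close>

lemma symmetric_triple:
  "symmetric_mat (w (k + 1) ** Nk k) \<and> symmetric_mat (w k ** Nk (k + 1)) \<and>
   symmetric_mat (w (k + 1) ** w k ** Nk (k + 1))"
  and pt_next: "pt (k + 1) (s (k + 2)) = pt (k + 2) 0"
proof -
  have step: "symmetric_mat (w (k + 2) ** Nk (k + 1)) \<and> symmetric_mat (w (k + 1) ** Nk (k + 2)) \<and>
      symmetric_mat (w (k + 2) ** w (k + 1) ** Nk (k + 2)) \<and>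
      w (k + 1) ** (w (k + 2) ** Nk (k + 1)) = w (k + 2) ** w (k + 1) ** Nk (k + 2)"
    if IH: "symmetric_mat (w (k + 1) ** Nk k)" "symmetric_mat (w k ** Nk (k + 1))"
      "symmetric_mat (w (k + 1) ** w k ** Nk (k + 1))" for k
  proof -
    let ?X = "w k ** Nk (k + 1)"
    have pow: "symmetric_mat (mat_power (w (k + 1)) j ** ?X)" for j
      by (rule symmetric_power) (use IH in \<open>simp_all add: matrix_mul_assoc\<close>)
    have w2: "w (k + 2) = mat_power (w (k + 1)) (s (k + 2)) ** w k"
      by simp
    have 1: "symmetric_mat (w (k + 2) ** Nk (k + 1))"
      unfolding w2 using pow by (simp add: matrix_mul_assoc)
    have N2: "Nk (k + 2) = Nk k"
      by (simp add: Nk_def)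
    have 2: "symmetric_mat (w (k + 1) ** Nk (k + 2))"
      unfolding N2 by (rule IH(1))
    have "w (k + 1) ** (w (k + 2) ** Nk (k + 1)) = mat_power (w (k + 1)) (Suc (s (k + 2))) ** ?X"
      unfolding w2 by (simp add: mat_power_Suc matrix_mul_assoc)
    then have 3: "symmetric_mat (w (k + 1) ** (w (k + 2) ** Nk (k + 1)))"
      using pow by simp
    \<comment> \<open>This moves w(k+1), transposed, to the right of N(k+1), where the symmetry of
      w(k+2) N(k+1) allows it to be taken back to the left.\<close>
    have "w (k + 1) ** Nk (k + 2) = transpose (w (k + 1) ** Nk (k + 2))"
      using 2 by (simp add: symmetric_mat_def)
    also have "\<dots> = Nk (k + 1) ** transpose (w (k + 1))"
      by (simp add: matrix_transpose_mul Nk_Suc[of "k + 1", simplified] transpose_transpose)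
    finally have "w (k + 2) ** w (k + 1) ** Nk (k + 2) = (w (k + 2) ** Nk (k + 1)) ** transpose (w (k + 1))"
      by (simp add: matrix_mul_assoc[symmetric])
    also have "\<dots> = transpose (w (k + 2) ** Nk (k + 1)) ** transpose (w (k + 1))"
      using 1 by (simp add: symmetric_mat_def)
    also have "\<dots> = transpose (w (k + 1) ** (w (k + 2) ** Nk (k + 1)))"
      by (rule matrix_transpose_mul[symmetric])
    also have "\<dots> = w (k + 1) ** (w (k + 2) ** Nk (k + 1))"
      using 3 by (simp add: symmetric_mat_def)
    finally show ?thesis
      using 1 2 3 by simp
  qed
  have all: "symmetric_mat (w (k + 1) ** Nk k) \<and> symmetric_mat (w k ** Nk (k + 1)) \<and>
   symmetric_mat (w (k + 1) ** w k ** Nk (k + 1))" for k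
  proof (induction k)
    case 0
    then show ?case
      by (simp add: symmetric_mat_iff Nk_def N_def mult_nth transpose_nth algebra_simps)
  next
    case (Suc k)
    then show ?case using step[of k] by simp
  qed
  then show "symmetric_mat (w (k + 1) ** Nk k) \<and> symmetric_mat (w k ** Nk (k + 1)) \<and>
   symmetric_mat (w (k + 1) ** w k ** Nk (k + 1))" .
  have "pt (k + 1) (s (k + 2)) = w (k + 1) ** (w (k + 2) ** Nk (k + 1))"
    unfolding pt_def word_def by (simp add: mat_power_Suc matrix_mul_assoc)
  also have "\<dots> = pt (k + 2) 0"
    using step[of k] all[of k] unfolding pt_def word_def by (simp add: mat_power_Suc)
  finally show "pt (k + 1) (s (k + 2)) = pt (k + 2) 0" .
qed

lemma symmetric_pt: "symmetric_mat (pt (k + 1) l)"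
proof -
  have "symmetric_mat (mat_power (w (k + 1)) (l + 1) ** (w k ** Nk (k + 1)))"
    using symmetric_triple[of k] by (intro symmetric_power) (auto simp: matrix_mul_assoc)
  then show ?thesis
    by (simp add: pt_def word_def matrix_mul_assoc)
qed

lemma form_pt_orthogonal: "dot3 (form_vec (w (k + 1))) (sym_vec (pt (k + 1) l)) = 0"
  using symmetric_pt[of k "Suc l"] symmetric_pt[of k l]
  by (simp add: dot3_form_vec pt_step symmetric_mat_iff)

lemma dot3_cayley:
  fixes A X :: "int^2^2"
  shows "dot3 z (sym_vec (A ** (A ** X))) =
    (A $ 1 $ 1 + A $ 2 $ 2) * dot3 z (sym_vec (A ** X)) - det A * dot3 z (sym_vec X)"
  by (cases z) (simp add: sym_vec_def cayley_hamilton algebra_simps)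

text \<open>The recurrence along w(k+2) expresses the second point of block k+2 by the first one,
  which pairs to 0 as it also belongs to block k+1, and by w(k+1) N(k+2), whose pairing
  \<open>dot3_form_vec_mult\<close> gives exactly.\<close>

lemma form_pt_next:
  "\<bar>dot3 (form_vec (w (k + 1))) (sym_vec (pt (k + 2) 1))\<bar> = a * a ^ (q (k + 2) + q (k + 1))"
proof -
  let ?z = "form_vec (w (k + 1))" let ?X = "w (k + 1) ** Nk (k + 2)"
  have "pt (k + 2) 1 = w (k + 2) ** (w (k + 2) ** ?X)" "pt (k + 2) 0 = w (k + 2) ** ?X"
    by (simp_all add: pt_def word_def mat_power_Suc matrix_mul_assoc numeral_2_eq_2)
  then have "dot3 ?z (sym_vec (pt (k + 2) 1)) =
      (w (k + 2) $ 1 $ 1 + w (k + 2) $ 2 $ 2) * dot3 ?z (sym_vec (pt (k + 2) 0)) - det (w (k + 2)) * dot3 ?z (sym_vec ?X)"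
    by (simp only: dot3_cayley)
  also have "dot3 ?z (sym_vec (pt (k + 2) 0)) = 0"
    unfolding pt_next[symmetric] by (rule form_pt_orthogonal)
  also have "dot3 ?z (sym_vec ?X) = det (w (k + 1)) * (Nk (k + 2) $ 2 $ 1 - Nk (k + 2) $ 1 $ 2)"
    using symmetric_triple[of "k + 1"] by (intro dot3_form_vec_mult) (simp add: add.assoc)
  finally have "\<bar>dot3 ?z (sym_vec (pt (k + 2) 1))\<bar> = \<bar>det (w (k + 2))\<bar> * \<bar>det (w (k + 1))\<bar> * \<bar>Nk (k + 2) $ 2 $ 1 - Nk (k + 2) $ 1 $ 2\<bar>"
    by (simp only: mult_zero_right diff_0 abs_minus_cancel abs_mult mult.assoc)
  then show ?thesis
    unfolding Nk_diff det_w using a_pos by (simp add: power_add mult.commute del: convergent_q.simps)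
qed

section \<open>Primitivity of the points and of the normal vectors\<close>

lemma pt_mod: "a dvd pt k l $ 1 $ 1 + 1"
proof -
  have u: "a dvd word k l $ 1 $ 1 - 1"
    using unipotent_mod_power_mult[OF unipotent_w unipotent_w] by (simp add: word_def unipotent_mod_def)
  have n: "Nk k $ 1 $ 1 = a * ((b + 1) * (b + 2)) - 1" "a dvd Nk k $ 2 $ 1"
    by (simp_all add: Nk_def N_def transpose_nth)
  have "pt k l $ 1 $ 1 + 1 = a * (word k l $ 1 $ 1 * ((b + 1) * (b + 2))) - (word k l $ 1 $ 1 - 1) + word k l $ 1 $ 2 * Nk k $ 2 $ 1"
    unfolding pt_def mult_nth n(1) by (simp add: algebra_simps)
  moreover have "a dvd a * (word k l $ 1 $ 1 * ((b + 1) * (b + 2))) - (word k l $ 1 $ 1 - 1) + word k l $ 1 $ 2 * Nk k $ 2 $ 1"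
    by (rule dvd_add[OF dvd_diff[OF dvd_triv_left u] dvd_mult[OF n(2)]])
  ultimately show ?thesis
    by (simp only:)
qed

lemma det_pt: "det (pt k l) = - (a ^ Suc ((l + 1) * q k + q (k - 1)))"
  by (simp add: pt_def det_mul det_word det_Nk)

lemma pt_content:
  assumes "d dvd pt (k + 1) l $ 1 $ 1" "d dvd pt (k + 1) l $ 1 $ 2" "d dvd pt (k + 1) l $ 2 $ 2"
  shows "is_unit d"
proof (rule coprime_dvd_power_unit[OF _ assms(1)])
  show "a dvd pt (k + 1) l $ 1 $ 1 - 1 \<or> a dvd pt (k + 1) l $ 1 $ 1 + 1"
    using pt_mod by blast
  have "d dvd det (pt (k + 1) l)"
    unfolding det_2 using assms by (intro dvd_diff dvd_mult2) auto
  then show "d dvd a ^ Suc ((l + 1) * q (k + 1) + q (k + 1 - 1))"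
    unfolding det_pt by simp
qed

lemma primitive_pt: "primitive (sym_vec (pt (k + 1) l))"
  unfolding sym_vec_def by (rule primitiveI, rule pt_content)

text \<open>A common divisor divides the pairing of \<open>form_pt_next\<close>, a power of
  \<open>a\<close>, while the middle coordinate is 1 modulo \<open>a\<close>.\<close>

lemma primitive_form: "primitive (form_vec (w (k + 1)))"
  unfolding form_vec_def
proof (rule primitiveI)
  fix d assume d: "d dvd - w (k + 1) $ 2 $ 1" "d dvd w (k + 1) $ 1 $ 1 - w (k + 1) $ 2 $ 2" "d dvd w (k + 1) $ 1 $ 2"
  show "is_unit d"
  proof (rule coprime_dvd_power_unit[OF _ d(2)])
    have "w (k + 1) $ 1 $ 1 - w (k + 1) $ 2 $ 2 - 1 = (w (k + 1) $ 1 $ 1 - 1) - w (k + 1) $ 2 $ 2"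
      by simp
    moreover have "a dvd (w (k + 1) $ 1 $ 1 - 1) - w (k + 1) $ 2 $ 2"
      using unipotent_w[of "k + 1"] unfolding unipotent_mod_def by (metis dvd_diff)
    ultimately show "a dvd w (k + 1) $ 1 $ 1 - w (k + 1) $ 2 $ 2 - 1 \<or> a dvd w (k + 1) $ 1 $ 1 - w (k + 1) $ 2 $ 2 + 1"
      by (simp only:) simp
    obtain z0 z1 z2 y0 y1 y2 where zy: "form_vec (w (k + 1)) = (z0, z1, z2)" "sym_vec (pt (k + 2) 1) = (y0, y1, y2)"
      by (metis prod.exhaust)
    have "d dvd z0" "d dvd z1" "d dvd z2"
      using d zy(1) by (auto simp: form_vec_def)
    then have "d dvd dot3 (form_vec (w (k + 1))) (sym_vec (pt (k + 2) 1))"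
      unfolding zy by (simp add: dvd_add)
    then have "d dvd a * a ^ (q (k + 2) + q (k + 1))"
      unfolding form_pt_next[symmetric] by simp
    then show "d dvd a ^ Suc (q (k + 2) + q (k + 1))"
      by simp
  qed
qed

end

section \<open>Growth of the sequence\<close>

lemma ex_exp_bound:
  fixes u1 u2 u3 u4 :: real
  obtains \<kappa> where "0 \<le> \<kappa>" "u1 \<le> exp \<kappa>" "u2 \<le> exp \<kappa>" "u3 \<le> exp \<kappa>" "u4 \<le> exp \<kappa>"
proof -
  let ?k = "\<bar>u1\<bar> + \<bar>u2\<bar> + \<bar>u3\<bar> + \<bar>u4\<bar>"
  have "?k \<le> exp ?k"
    using exp_ge_add_one_self[of ?k] by linarith
  then show thesis
    by (intro that[of ?k]) linarith+
qed

lemma size0_ge_1: "0 < size0 x \<Longrightarrow> 1 \<le> size0 x"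
proof -
  assume "0 < size0 x"
  moreover obtain x0 x1 x2 where "x = (x0, x1, x2)"
    by (metis prod.exhaust)
  ultimately show "1 \<le> size0 x"
    by simp
qed

context sturm_matrices
begin

definition r :: "nat \<Rightarrow> real" where
  "r k = ln (mat_norm (w k))"

lemma norm_w: "mat_norm (w k) = exp (r k)"
  using tame_norm_ge_1[OF tame_w, of k] by (simp add: r_def)

lemma r_rec:
  assumes "k \<ge> 1"
  shows "\<bar>r (k + 1) - real (s (k + 1)) * r k - r (k - 1)\<bar> \<le> real S * ln 2"
    "real (s (k + 1)) * r k + r (k - 1) \<le> r (k + 1)"
    "r (k + 1) \<le> real (s (k + 1)) * r k + r (k - 1) + real (s (k + 1)) * ln 2"
proof -
  note t = tame_ln_norm[OF tame_w[of k] tame_w[of "k - 1"], of "s (k + 1)", folded w_rec[OF assms] r_def]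
  show "\<bar>r (k + 1) - real (s (k + 1)) * r k - r (k - 1)\<bar> \<le> real S * ln 2"
  proof -
    have "real (s (k + 1)) * ln 2 \<le> real S * ln 2"
      using s_le[of "k + 1"] by (intro mult_right_mono) auto
    then show ?thesis
      using t(1) by linarith
  qed
  show "real (s (k + 1)) * r k + r (k - 1) \<le> r (k + 1)"
    "r (k + 1) \<le> real (s (k + 1)) * r k + r (k - 1) + real (s (k + 1)) * ln 2"
    using t by linarith+
qed

lemma r_0: "r 0 = ln (real_of_int (a * (b + 1)))" and r_1: "r 1 = ln (real_of_int (a * (b + 2)))"
  using mat_norm_tame[OF tame_w, of 0] mat_norm_tame[OF tame_w, of 1] by (simp_all add: r_def)

lemma r_0_1: "0 < r 0" "r 0 \<le> r 1"
proof -
  have "1 \<le> a * b"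
    using mult_mono[of 1 a 1 b] a_pos b_pos by simp
  then have "2 \<le> a * (b + 1)"
    unfolding distrib_left using a_pos by linarith
  then have 2: "2 \<le> real_of_int (a * (b + 1))"
    by linarith
  then show "0 < r 0"
    unfolding r_0 by simp
  have "a * (b + 1) \<le> a * (b + 2)"
    using a_pos by simp
  then have "real_of_int (a * (b + 1)) \<le> real_of_int (a * (b + 2))"
    by (simp only: of_int_le_iff)
  then show "r 0 \<le> r 1"
    unfolding r_0 r_1 using 2 by simp
qed

lemma r_lower: "r 0 * real (q k) \<le> r k"
proof (induction k rule: induct_nat_012)
  case (ge2 k)
  have "real (s (k + 2)) * (r 0 * real (q (k + 1))) \<le> real (s (k + 2)) * r (k + 1)"
    using ge2 by (intro mult_left_mono) auto
  then show ?case
    using r_rec(2)[of "k + 1"] ge2 by (simp add: algebra_simps)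
qed (use r_0_1 in auto)

text \<open>Adding ln 2 absorbs the factor 2 lost in each product, which turns the upper estimate
  into a plain recurrence inequality.\<close>

lemma r_upper: "r k + ln 2 \<le> (r 1 + ln 2) * real (q k)"
proof (induction k rule: induct_nat_012)
  case (ge2 k)
  have "real (s (k + 2)) * (r (k + 1) + ln 2) \<le> real (s (k + 2)) * ((r 1 + ln 2) * real (q (k + 1)))"
    using ge2 by (intro mult_left_mono) auto
  then show ?case
    using r_rec(3)[of "k + 1"] ge2 by (simp add: algebra_simps)
qed (use r_0_1 in auto)

text \<open>The growth rate: ln of the norm of \<open>w k\<close> is C q(k) + O(1). Beyond this
  property only the enclosure by \<open>C_ge\<close> and \<open>C_le\<close> is used.\<close>

definition C :: real where
  "C = (SOME C. \<exists>B. \<forall>k. \<bar>r k - C * real (q k)\<bar> \<le> B)"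

lemma C_bound: "\<exists>B. \<forall>k. \<bar>r k - C * real (q k)\<bar> \<le> B"
proof -
  obtain C0 B where "\<And>k. \<bar>r k - C0 * real (q k)\<bar> \<le> B"
    using perturbed_recurrence[OF r_rec(1)] by blast
  then show ?thesis
    unfolding C_def by (intro someI[of "\<lambda>C. \<exists>B. \<forall>k. \<bar>r k - C * real (q k)\<bar> \<le> B" C0]) blast
qed

lemma le_if_linear_bound:
  assumes "\<And>k. x * real (q k) \<le> y * real (q k) + B"
  shows "x \<le> y"
proof (rule ccontr)
  assume "\<not> x \<le> y"
  then obtain k :: nat where k: "B < real k * (x - y)"
    using reals_Archimedean3[of "x - y"] by auto
  have "real k * (x - y) \<le> real (q k) * (x - y)"
    using \<open>\<not> x \<le> y\<close> q_ge[of k] by (intro mult_right_mono) auto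
  then show False
    using assms[of k] k by (simp add: algebra_simps)
qed

lemma C_ge: "r 0 \<le> C" and C_le: "C \<le> r 1 + ln 2"
proof -
  obtain B where B: "\<And>k. \<bar>r k - C * real (q k)\<bar> \<le> B"
    using C_bound by blast
  show "r 0 \<le> C"
  proof (rule le_if_linear_bound[of _ _ B])
    fix k
    show "r 0 * real (q k) \<le> C * real (q k) + B"
      using B[of k] r_lower[of k] by linarith
  qed
  show "C \<le> r 1 + ln 2"
  proof (rule le_if_linear_bound[of _ _ B])
    fix k
    have "0 \<le> ln (2::real)" by simp
    then show "C * real (q k) \<le> (r 1 + ln 2) * real (q k) + B"
      using B[of k] r_upper[of k] by linarith
  qed
qed

lemma C_pos: "0 < C"
  using C_ge r_0_1 by linarith

text \<open>The ratio of ln det w(k) = q(k) ln a to the main term C q(k) of the logarithmic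
  norm.\<close>

definition \<delta> :: real where
  "\<delta> = ln (real_of_int a) / C"

lemma delta_nonneg: "0 \<le> \<delta>"
  using a_pos C_pos by (simp add: \<delta>_def)

lemma delta_bounds:
  "\<delta> \<le> ln (real_of_int a) / ln (real_of_int (a * (b + 1)))"
  "ln (real_of_int a) / (ln (real_of_int (a * (b + 2))) + ln 2) \<le> \<delta>"
proof -
  have a: "0 \<le> ln (real_of_int a)"
    using a_pos by simp
  show "\<delta> \<le> ln (real_of_int a) / ln (real_of_int (a * (b + 1)))"
    unfolding \<delta>_def r_0[symmetric] using C_ge C_pos r_0_1 a by (intro divide_left_mono) auto
  show "ln (real_of_int a) / (ln (real_of_int (a * (b + 2))) + ln 2) \<le> \<delta>"
    unfolding \<delta>_def r_1[symmetric] using C_le C_pos a by (intro divide_left_mono) auto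
qed

definition R :: "nat \<Rightarrow> real" where
  "R k = C * real (q k)"

definition ht_exp :: "nat \<Rightarrow> nat \<Rightarrow> real" where
  "ht_exp k l = (real l + 1) * R k + R (k - 1)"

lemma R_rec: "k \<ge> 1 \<Longrightarrow> R (k + 1) = real (s (k + 1)) * R k + R (k - 1)"
  by (simp only: R_def q_rec) (simp add: algebra_simps)

lemma R_pos: "0 < R k"
  using C_pos q_pos by (simp add: R_def)

lemma R_mono: "R k \<le> R (k + 1)"
  unfolding R_def using C_pos q_mono[of k] by (intro mult_left_mono) auto

lemma R_lim: "filterlim R at_top sequentially"
  unfolding R_def using filterlim_tendsto_pos_mult_at_top[OF tendsto_const C_pos q_lim] .

lemma ht_exp_ge: "R k \<le> ht_exp k l"
  using R_pos[of k] R_pos[of "k - 1"] by (simp add: ht_exp_def algebra_simps add_increasing)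

lemma ht_exp_last: "ht_exp (k + 1) (s (k + 2)) = ht_exp (k + 2) 0"
  using R_rec[of "k + 1"] by (simp add: ht_exp_def algebra_simps)

lemma det_word_exp: "real_of_int (det (word k l)) = exp (\<delta> * ht_exp k l)"
proof -
  have eq: "\<delta> * ht_exp k l = real ((l + 1) * q k + q (k - 1)) * ln (real_of_int a)"
    using C_pos by (simp add: \<delta>_def ht_exp_def R_def field_simps)
  then show ?thesis
    unfolding det_word eq exp_of_nat_mult using a_pos by simp
qed

lemma det_w_exp: "real_of_int (det (w k)) = exp (\<delta> * R k)"
proof -
  have "\<delta> * R k = real (q k) * ln (real_of_int a)"
    using C_pos by (simp add: \<delta>_def R_def)
  then show ?thesis
    using a_pos by (simp add: det_w exp_of_nat_mult)
qed

text \<open>Powers accumulate an error proportional to the exponent; since \<open>l\<close> is at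
  most \<open>S\<close>, one constant serves all words.\<close>

lemma norm_bound:
  obtains B where "0 \<le> B" "\<And>k. exp (R k - B) \<le> mat_norm (w k)" "\<And>k. mat_norm (w k) \<le> exp (R k + B)"
    "\<And>k l. l \<le> S \<Longrightarrow> exp (ht_exp k l - B) \<le> mat_norm (word k l)"
    "\<And>k l. l \<le> S \<Longrightarrow> mat_norm (word k l) \<le> exp (ht_exp k l + B)"
proof -
  obtain B0 where B0: "\<And>k. \<bar>r k - R k\<bar> \<le> B0"
    using C_bound unfolding R_def by blast
  have b0: "0 \<le> B0"
    using B0[of 0] by linarith
  define B where "B = (real S + 2) * B0 + (real S + 1) * ln 2"
  have BB: "B0 \<le> B"
    using b0 by (simp add: B_def algebra_simps add_increasing)
  have word: "\<bar>ln (mat_norm (word k l)) - ht_exp k l\<bar> \<le> B" if "l \<le> S" for k l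
  proof -
    have "\<bar>ln (mat_norm (word k l)) - (real (l + 1) * r k + r (k - 1))\<bar> \<le> real (l + 1) * ln 2"
      unfolding word_def r_def by (rule tame_ln_norm[OF tame_w tame_w])
    moreover have "real (l + 1) * ln 2 \<le> (real S + 1) * ln 2"
      using that by (intro mult_right_mono) auto
    moreover have "\<bar>real (l + 1) * (r k - R k)\<bar> \<le> (real S + 1) * B0"
      unfolding abs_mult using that B0 by (intro mult_mono) auto
    moreover have "real (l + 1) * r k + r (k - 1) - ht_exp k l = real (l + 1) * (r k - R k) + (r (k - 1) - R (k - 1))"
      by (simp add: ht_exp_def algebra_simps)
    moreover have "B = (real S + 1) * B0 + B0 + (real S + 1) * ln 2"
      by (simp add: B_def algebra_simps)
    ultimately show ?thesis
      using B0[of "k - 1"] by linarith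
  qed
  have pos: "0 < mat_norm (word k l)" for k l
    using tame_norm_ge_1[OF tame_word, of k l] by linarith
  show thesis
  proof (rule that)
    show "0 \<le> B" using b0 BB by linarith
    show "exp (R k - B) \<le> mat_norm (w k)" "mat_norm (w k) \<le> exp (R k + B)" for k
      unfolding norm_w using B0[of k] BB by auto
    show "exp (ht_exp k l - B) \<le> mat_norm (word k l)" "mat_norm (word k l) \<le> exp (ht_exp k l + B)" if "l \<le> S" for k l
    proof -
      have "exp (ht_exp k l - B) \<le> exp (ln (mat_norm (word k l)))" "exp (ln (mat_norm (word k l))) \<le> exp (ht_exp k l + B)"
        using word[OF that, of k] by simp_all
      then show "exp (ht_exp k l - B) \<le> mat_norm (word k l)" "mat_norm (word k l) \<le> exp (ht_exp k l + B)"
        unfolding exp_ln[OF pos] .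
    qed
  qed
qed

section \<open>The number \<open>\<xi>\<close> and the estimates for points and forms\<close>

definition \<xi> :: real where
  "\<xi> = (SUP k. lower_slope (w (k + 1)))"

lemma w_prefix: "\<exists>V. tame K V \<and> w (k + 2) = w (k + 1) ** V"
proof -
  obtain j where j: "s (k + 2) = Suc j"
    using s_pos[of "k + 2"] by (cases "s (k + 2)") auto
  have "w (k + 2) = w (k + 1) ** (mat_power (w (k + 1)) j ** w k)"
    using j by (simp add: mat_power_Suc matrix_mul_assoc)
  then show ?thesis
    using tame_power_mult[OF tame_w tame_w] by blast
qed

lemma brackets_w: "brackets (w (k + 1)) \<xi>"
proof -
  have step: "lower_slope (w (k + 1)) \<le> lower_slope (w (k + 2))" "upper_slope (w (k + 2)) \<le> upper_slope (w (k + 1))" for k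
    using w_prefix[of k] slopes_mult[OF tame_w _ det_w_pos] by metis+
  have inc: "incseq (\<lambda>k. lower_slope (w (k + 1)))" and dec: "decseq (\<lambda>k. upper_slope (w (k + 1)))"
    using step by (auto intro!: incseq_SucI decseq_SucI simp del: sturm_w.simps)
  have cross: "lower_slope (w (j + 1)) \<le> upper_slope (w (k + 1))" for j k
  proof -
    have "lower_slope (w (j + 1)) \<le> lower_slope (w (max j k + 1))"
      using incseqD[OF inc, of j "max j k"] by simp
    also have "\<dots> \<le> upper_slope (w (max j k + 1))"
      by (rule slopes_le[OF tame_w det_w_pos])
    also have "\<dots> \<le> upper_slope (w (k + 1))"
      using decseqD[OF dec, of k "max j k"] by simp
    finally show ?thesis .
  qed
  have "bdd_above (range (\<lambda>k. lower_slope (w (k + 1))))"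
    using cross by (intro bdd_aboveI) auto
  then show ?thesis
    unfolding brackets_iff[OF tame_w] \<xi>_def using cross by (auto intro!: cSUP_upper cSUP_least)
qed

text \<open>Downward induction from l = s(k+3) - 1, where the word is w(k+3). Since w(k+2) begins
  with w(k+1), each word is a prefix of the next one, and a prefix has the larger interval.\<close>

lemma brackets_word:
  assumes "l < s (k + 3)"
  shows "brackets (word (k + 2) l) \<xi>"
proof -
  have "l \<le> s (k + 3) - 1"
    using assms by simp
  then show ?thesis
  proof (induction rule: inc_induct)
    case base
    have "word (k + 2) (s (k + 3) - 1) = w (k + 3)"
      using word_last[of "k + 2"] by (simp add: eval_nat_numeral del: sturm_w.simps)
    then show ?case
      using brackets_w[of "k + 2"] by (simp add: eval_nat_numeral del: sturm_w.simps)
  next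
    case (step l)
    obtain V where V: "tame K V" "w (k + 2) = w (k + 1) ** V"
      using w_prefix by blast
    have "word (k + 2) (Suc l) = mat_power (w (k + 2)) (l + 1) ** w (k + 2) ** w (k + 1)"
      by (simp add: word_def mat_power_Suc2[of _ "Suc l"] del: sturm_w.simps)
    also have "\<dots> = mat_power (w (k + 2)) (l + 1) ** (w (k + 1) ** V) ** w (k + 1)"
      by (simp only: V(2)[symmetric])
    also have "\<dots> = word (k + 2) l ** (V ** w (k + 1))"
      by (simp add: word_def matrix_mul_assoc del: sturm_w.simps)
    finally have "brackets (word (k + 2) l ** (V ** w (k + 1))) \<xi>"
      using step by simp
    then show ?case
      using brackets_mult[OF tame_word tame_mult[OF V(1) tame_w] det_word_pos] by blast
  qed
qed

lemma mat_norm_word_pos: "0 < mat_norm (word k l)"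
  using tame_norm_ge_1[OF tame_word, of k l] by linarith

abbreviation pt_estimate :: "real \<Rightarrow> nat \<Rightarrow> nat \<Rightarrow> bool" where
  "pt_estimate \<kappa> k l \<equiv>
     exp (ht_exp k l - \<kappa>) \<le> size0 (sym_vec (pt k l)) \<and> size0 (sym_vec (pt k l)) \<le> exp (ht_exp k l + \<kappa>) \<and>
     exp (- (1 - \<delta>) * ht_exp k l - \<kappa>) \<le> err \<xi> (sym_vec (pt k l)) \<and>
     err \<xi> (sym_vec (pt k l)) \<le> exp (- (1 - \<delta>) * ht_exp k l + \<kappa>)"

lemma pt_bounds:
  assumes "\<delta> \<le> 1"
  obtains \<kappa> where "0 \<le> \<kappa>" "\<forall>\<^sub>F k in sequentially. \<forall>l<s (k + 1). pt_estimate \<kappa> k l"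
proof -
  obtain B where B: "0 \<le> B" "\<And>k l. l \<le> S \<Longrightarrow> exp (ht_exp k l - B) \<le> mat_norm (word k l)"
    "\<And>k l. l \<le> S \<Longrightarrow> mat_norm (word k l) \<le> exp (ht_exp k l + B)"
    using norm_bound by metis
  define \<nu> where "\<nu> = (\<Sum>i\<in>UNIV. \<Sum>j\<in>UNIV. \<bar>real_of_int (N $ i $ j)\<bar>)"
  have Nle: "\<bar>real_of_int (N $ i $ j)\<bar> \<le> \<nu>" for i j
    using exhaust_2[of i] exhaust_2[of j] by (auto simp: \<nu>_def UNIV_2)
  then have \<nu>: "\<bar>real_of_int (Nk k $ i $ j)\<bar> \<le> \<nu>" for k i j
    by (simp add: Nk_def transpose_nth)
  have \<nu>0: "0 \<le> \<nu>"
    using Nle[of 1 1] by linarith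
  \<comment> \<open>\<open>c3\<close> and \<open>U\<close> bound error and size from above,
    \<open>c2\<close> and \<open>c4\<close> the size and the error from below; \<open>c1\<close>
    belongs to the auxiliary \<eta>.\<close>
  define c1 where "c1 = 2 * \<nu> * of_int K ^ 2 * exp B"
  define c3 where "c3 = (1 + \<bar>\<xi>\<bar>) * c1"
  define M where "M = \<nu> * (\<bar>\<xi>\<bar> + \<bar>\<xi>\<bar> ^ 2) + 1"
  define c2 where "c2 = exp (- B) / (2 * M)"
  define U where "U = 2 * \<nu> * exp B + 1"
  define c4 where "c4 = 1 / (U * (1 + 2 * \<bar>\<xi>\<bar> + c3))"
  have c1: "0 \<le> c1" and c3: "0 \<le> c3"
    using \<nu>0 by (simp_all add: c1_def c3_def)
  have M: "0 < M"
    using \<nu>0 by (simp add: M_def add_nonneg_pos)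
  have c2: "0 < c2" and U: "0 < U"
    using M \<nu>0 by (simp_all add: c2_def U_def add_nonneg_pos)
  have c4: "0 < c4"
    using U c3 by (simp add: c4_def)
  have a1: "1 \<le> real_of_int a"
    using a_pos by simp
  obtain \<kappa> where \<kappa>: "0 \<le> \<kappa>" "U \<le> exp \<kappa>" "c3 \<le> exp \<kappa>" "1 / c2 \<le> exp \<kappa>" "1 / c4 \<le> exp \<kappa>"
    using ex_exp_bound .
  have inv: "exp (- \<kappa>) \<le> c2" "exp (- \<kappa>) \<le> c4"
    using \<kappa>(4,5) c2 c4 by (simp_all add: exp_minus field_simps)
  \<comment> \<open>Makes the \<eta> term in the last estimate of
    \<open>symmetric_product_err\<close> at most half the norm, so the first coordinate carries the
    other half.\<close>
  have big: "\<forall>\<^sub>F k in sequentially. 2 * (\<nu> * ((2 + \<bar>\<xi>\<bar>) * c1)) * exp B \<le> R k"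
    using R_lim unfolding filterlim_at_top by blast
  have "\<forall>\<^sub>F k in sequentially. \<forall>l<s (k + 1). pt_estimate \<kappa> k l"
    using big eventually_ge_at_top[of 2]
  proof eventually_elim
    case (elim k)
    show ?case
    proof (intro allI impI)
      fix l assume l: "l < s (k + 1)"
      obtain j where j: "k = j + 2"
        using elim(2) by (metis le_add_diff_inverse add.commute)
      have lS: "l \<le> S"
        using l s_le[of "k + 1"] by linarith
      let ?n = "ht_exp k l" let ?A = "word k l" let ?Y = "sym_vec (pt k l)"
      let ?e = "exp (- (1 - \<delta>) * ?n)"
      define \<eta> where "\<eta> = 2 * \<nu> * of_int K ^ 2 * of_int (det ?A) / mat_norm ?A"
      have br: "brackets ?A \<xi>"
        using brackets_word[of l j] l by (simp add: j eval_nat_numeral)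
      have sym: "symmetric_mat (pt k l)"
        using symmetric_pt[of "j + 1" l] by (simp add: j)
      note E = symmetric_product_err[OF tame_word det_word_pos br sym[unfolded pt_def] \<nu>, folded pt_def \<eta>_def]
      note Bl = B(2,3)[OF lS, of k]
      have n0: "0 \<le> ?n"
        using ht_exp_ge[of k l] R_pos[of k] by linarith
      have "\<eta> \<le> 2 * \<nu> * of_int K ^ 2 * exp (\<delta> * ?n) / exp (?n - B)"
        unfolding \<eta>_def det_word_exp using Bl \<nu>0 by (intro divide_left_mono mult_pos_pos mat_norm_word_pos) auto
      also have "\<dots> = 2 * \<nu> * of_int K ^ 2 * exp (\<delta> * ?n - (?n - B))"
        by (simp add: exp_diff)
      also have "\<delta> * ?n - (?n - B) = - (1 - \<delta>) * ?n + B"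
        by (simp add: algebra_simps)
      also have "2 * \<nu> * of_int K ^ 2 * exp (- (1 - \<delta>) * ?n + B) = c1 * ?e"
        unfolding c1_def exp_add by simp
      finally have \<eta>: "\<eta> \<le> c1 * ?e" .
      have "- (1 - \<delta>) * ?n \<le> 0"
        using n0 assms by (simp add: mult_nonpos_nonneg)
      then have "?e \<le> 1"
        by simp
      then have ce: "c1 * ?e \<le> c1" "c3 * ?e \<le> c3"
        using c1 c3 by (simp_all add: mult_left_le)
      have "err \<xi> ?Y \<le> (1 + \<bar>\<xi>\<bar>) * (c1 * ?e)"
        using E(3) mult_left_mono[OF \<eta>, of "1 + \<bar>\<xi>\<bar>"] by linarith
      then have err: "err \<xi> ?Y \<le> c3 * ?e"
        by (simp add: c3_def)
      also have "\<dots> \<le> exp \<kappa> * ?e"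
        using \<kappa>(3) by (intro mult_right_mono) auto
      finally have 4: "err \<xi> ?Y \<le> exp (- (1 - \<delta>) * ?n + \<kappa>)"
        by (simp only: exp_add mult.commute)
      have "size0 ?Y \<le> 2 * \<nu> * exp (?n + B)"
        using E(4) mult_left_mono[OF Bl(2), of "2 * \<nu>"] \<nu>0 by simp
      also have "\<dots> \<le> U * exp ?n"
        by (simp add: U_def exp_add algebra_simps)
      finally have sizeU: "size0 ?Y \<le> U * exp ?n" .
      also have "\<dots> \<le> exp \<kappa> * exp ?n"
        using \<kappa>(2) by (intro mult_right_mono) auto
      finally have 2: "size0 ?Y \<le> exp (?n + \<kappa>)"
        by (simp only: exp_add mult.commute)
      have "2 * (\<nu> * ((2 + \<bar>\<xi>\<bar>) * c1)) * exp B \<le> ?n"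
        using elim(1) ht_exp_ge[of k l] by linarith
      also have "\<dots> \<le> exp ?n"
        using exp_ge_add_one_self[of ?n] by linarith
      finally have "2 * (\<nu> * ((2 + \<bar>\<xi>\<bar>) * c1)) \<le> exp (?n - B)"
        by (simp add: exp_diff pos_le_divide_eq)
      then have half: "2 * (\<nu> * ((2 + \<bar>\<xi>\<bar>) * c1)) \<le> mat_norm ?A"
        using Bl(1) by linarith
      have "1 * mat_norm ?A \<le> \<bar>of_int (det (Nk k))\<bar> * mat_norm ?A"
        using a1 mat_norm_word_pos[of k l] by (intro mult_right_mono) (auto simp: det_Nk)
      also note E(5)
      also have "\<nu> * ((\<bar>\<xi>\<bar> + \<bar>\<xi>\<bar>\<^sup>2) * size0 ?Y + (2 + \<bar>\<xi>\<bar>) * \<eta>) = (M - 1) * size0 ?Y + \<nu> * ((2 + \<bar>\<xi>\<bar>) * \<eta>)"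
        by (simp add: M_def algebra_simps)
      also have "\<dots> \<le> M * size0 ?Y + \<nu> * ((2 + \<bar>\<xi>\<bar>) * c1)"
        using \<eta> ce \<nu>0 size0_nonneg[of ?Y] by (intro add_mono mult_left_mono mult_right_mono) auto
      finally have "mat_norm ?A \<le> 2 * M * size0 ?Y"
        using half by simp
      then have "exp (?n - B) \<le> 2 * M * size0 ?Y"
        using Bl(1) by linarith
      then have low: "c2 * exp ?n \<le> size0 ?Y"
        using M by (simp add: c2_def exp_diff exp_minus field_simps)
      then have pos: "0 < size0 ?Y"
        using c2 by (smt (verit) exp_gt_zero mult_pos_pos)
      have "exp (- \<kappa>) * exp ?n \<le> size0 ?Y"
        using low mult_right_mono[OF inv(1), of "exp ?n"] exp_ge_zero[of ?n] by linarith
      then have 1: "exp (?n - \<kappa>) \<le> size0 ?Y"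
        by (simp add: exp_diff exp_minus field_simps)
      have "\<bar>real_of_int (det (pt k l))\<bar> = exp (\<delta> * ?n) * real_of_int a"
        using a1 by (simp add: pt_def det_mul det_Nk abs_mult det_word_exp)
      then have "exp (\<delta> * ?n) * 1 \<le> \<bar>real_of_int (det (pt k l))\<bar>"
        using a1 by simp
      also have "\<dots> \<le> size0 ?Y * err \<xi> ?Y * (1 + 2 * \<bar>\<xi>\<bar> + err \<xi> ?Y)"
        by (rule det_le_err[OF sym size0_ge_1[OF pos]])
      also have "\<dots> \<le> (U * exp ?n) * err \<xi> ?Y * (1 + 2 * \<bar>\<xi>\<bar> + c3)"
        using sizeU err ce U by (intro mult_mono add_left_mono mult_nonneg_nonneg) (auto simp: err_nonneg size0_nonneg)
      finally have "exp (\<delta> * ?n) * 1 \<le> U * exp ?n * err \<xi> ?Y * (1 + 2 * \<bar>\<xi>\<bar> + c3)" .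
      then have "exp (\<delta> * ?n) * c4 \<le> exp ?n * err \<xi> ?Y"
      proof -
        assume le: "exp (\<delta> * ?n) * 1 \<le> U * exp ?n * err \<xi> ?Y * (1 + 2 * \<bar>\<xi>\<bar> + c3)"
        have "0 < U * (1 + 2 * \<bar>\<xi>\<bar> + c3)"
          using U c3 by (intro mult_pos_pos) auto
        then have "exp (\<delta> * ?n) / (U * (1 + 2 * \<bar>\<xi>\<bar> + c3)) \<le> exp ?n * err \<xi> ?Y"
          using le by (subst pos_divide_le_eq) (simp_all add: mult_ac)
        then show ?thesis
          by (simp add: c4_def)
      qed
      then have "exp (\<delta> * ?n) * exp (- \<kappa>) \<le> exp ?n * err \<xi> ?Y"
        using mult_left_mono[OF inv(2), of "exp (\<delta> * ?n)"] exp_ge_zero[of "\<delta> * ?n"] by linarith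
      then have "exp (- ?n) * (exp (\<delta> * ?n) * exp (- \<kappa>)) \<le> exp (- ?n) * (exp ?n * err \<xi> ?Y)"
        by (intro mult_left_mono) auto
      then have 3: "exp (- (1 - \<delta>) * ?n - \<kappa>) \<le> err \<xi> ?Y"
        unfolding mult.assoc[symmetric] exp_add[symmetric] by (simp add: algebra_simps)
      show "exp (?n - \<kappa>) \<le> size0 ?Y \<and> size0 ?Y \<le> exp (?n + \<kappa>) \<and>
         exp (- (1 - \<delta>) * ?n - \<kappa>) \<le> err \<xi> ?Y \<and> err \<xi> ?Y \<le> exp (- (1 - \<delta>) * ?n + \<kappa>)"
        using 1 2 3 4 by blast
    qed
  qed
  then show thesis
    using that \<kappa>(1) by blast
qed

text \<open>For \<open>l = s (k + 1)\<close> the point is the first one of the next block.\<close>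

lemma pt_bounds_closed:
  assumes "\<delta> \<le> 1"
  obtains \<kappa> where "0 \<le> \<kappa>" "\<forall>\<^sub>F k in sequentially. \<forall>l\<le>s (k + 1). pt_estimate \<kappa> k l"
proof -
  obtain \<kappa> where \<kappa>: "0 \<le> \<kappa>" and ev: "\<forall>\<^sub>F k in sequentially. \<forall>l<s (k + 1). pt_estimate \<kappa> k l"
    using pt_bounds[OF assms] .
  have "\<forall>\<^sub>F k in sequentially. \<forall>l\<le>s (k + 1). pt_estimate \<kappa> k l"
    using ev eventually_compose_filterlim[OF ev filterlim_Suc] eventually_ge_at_top[of 1]
  proof eventually_elim
    case (elim k)
    obtain j where j: "k = j + 1"
      using elim(3) by (metis le_add_diff_inverse add.commute)
    have nxt: "pt k (s (k + 1)) = pt (Suc k) 0" "ht_exp k (s (k + 1)) = ht_exp (Suc k) 0"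
      using pt_next[of j] ht_exp_last[of j] by (simp_all add: j)
    show ?case
    proof (intro allI impI)
      fix l assume "l \<le> s (k + 1)"
      then consider "l < s (k + 1)" | "l = s (k + 1)" by linarith
      then show "pt_estimate \<kappa> k l"
      proof cases
        case 1
        then show ?thesis using elim(1) by blast
      next
        case 2
        show ?thesis
          unfolding 2 nxt using elim(2) s_pos by blast
      qed
    qed
  qed
  then show thesis
    using that \<kappa> by blast
qed

definition val_exp :: "nat \<Rightarrow> real" where
  "val_exp k = (2 - \<delta>) * R (k + 1) + (1 - \<delta>) * R k"

abbreviation form_estimate :: "real \<Rightarrow> nat \<Rightarrow> bool" where
  "form_estimate \<kappa> k \<equiv>
     exp (R k - \<kappa>) \<le> \<bar>of_int (snd (snd (form_vec (w k))))\<bar> \<and> ht (form_vec (w k)) \<le> exp (R k + \<kappa>) \<and>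
     exp (- val_exp k - \<kappa>) \<le> \<bar>lform \<xi> (form_vec (w k))\<bar> \<and> \<bar>lform \<xi> (form_vec (w k))\<bar> \<le> exp (- val_exp k + \<kappa>)"

text \<open>In the pairing of \<open>z k\<close> with \<open>pt (Suc k) 1\<close> the error term is
  at most 1/2 while the pairing is at least 1. So the value at \<xi> times the size exp (2 R(k+1) +
  R(k)) equals the known pairing up to a factor 2.\<close>

lemma form_bounds:
  assumes "\<delta> \<le> 1 / 2"
  obtains \<kappa> where "0 \<le> \<kappa>" "\<forall>\<^sub>F k in sequentially.
     form_estimate \<kappa> k"
proof -
  have "\<delta> \<le> 1"
    using assms by simp
  then obtain \<kappa>1 where \<kappa>1: "0 \<le> \<kappa>1" and ev: "\<forall>\<^sub>F k in sequentially. \<forall>l\<le>s (k + 1). pt_estimate \<kappa>1 k l"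
    using pt_bounds_closed by blast
  obtain B where B: "0 \<le> B" "\<And>k. exp (R k - B) \<le> mat_norm (w k)" "\<And>k. mat_norm (w k) \<le> exp (R k + B)"
    using norm_bound by metis
  obtain \<kappa>2 where \<kappa>2: "0 \<le> \<kappa>2" "real_of_int K ^ 2 \<le> exp \<kappa>2" "2 * real_of_int a \<le> exp \<kappa>2" "2 \<le> exp \<kappa>2"
    using ex_exp_bound[of "real_of_int K ^ 2" "2 * real_of_int a" 2 1] by metis
  define \<kappa> where "\<kappa> = B + \<kappa>1 + \<kappa>2"
  have z2: "exp (R k - \<kappa>) \<le> \<bar>of_int (snd (snd (form_vec (w k))))\<bar>" and zh: "ht (form_vec (w k)) \<le> exp (R k + B)" for k
  proof -
    have "real_of_int (w k $ 2 $ 2) \<le> real_of_int (K ^ 2 * w k $ 1 $ 2)"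
      using tame_entries_le(2)[OF tame_w] by (simp only: of_int_le_iff)
    then have "mat_norm (w k) \<le> of_int K ^ 2 * of_int (w k $ 1 $ 2)"
      by (simp only: mat_norm_tame[OF tame_w] of_int_mult of_int_power)
    also have "\<dots> \<le> exp \<kappa>2 * of_int (w k $ 1 $ 2)"
      using \<kappa>2(2) tame_pos(2)[OF tame_w, of k] by (intro mult_right_mono) auto
    finally have "exp (R k - B) \<le> exp \<kappa>2 * of_int (w k $ 1 $ 2)"
      using B(2)[of k] by linarith
    then have "exp (- \<kappa>2) * exp (R k - B) \<le> of_int (w k $ 1 $ 2)"
      by (simp add: exp_minus field_simps)
    moreover have "exp (R k - \<kappa>) \<le> exp (- \<kappa>2 + (R k - B))"
      using \<kappa>1 by (simp add: \<kappa>_def)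
    ultimately show "exp (R k - \<kappa>) \<le> \<bar>of_int (snd (snd (form_vec (w k))))\<bar>"
      unfolding exp_add form_vec_def snd_conv by linarith
    have "ht (form_vec (w k)) \<le> of_int (w k $ 2 $ 2)"
      using tame_w[of k] tame_pos[OF tame_w, of k] unfolding tame_def form_vec_def by auto
    then show "ht (form_vec (w k)) \<le> exp (R k + B)"
      using B(3)[of k] by (simp add: mat_norm_tame[OF tame_w])
  qed
  \<comment> \<open>With \<delta> \<le> 1/2 the error term has exponent at most - R(k)/2 + B +
    \<kappa>1, and this brings it below -2.\<close>
  have big: "\<forall>\<^sub>F k in sequentially. 4 * (B + \<kappa>1) + 8 \<le> R k"
    using R_lim unfolding filterlim_at_top by blast
  have "\<forall>\<^sub>F k in sequentially.
     form_estimate \<kappa> k"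
    using big eventually_compose_filterlim[OF ev filterlim_Suc] eventually_ge_at_top[of 1]
  proof eventually_elim
    case (elim k)
    obtain j where j: "k = j + 1"
      using elim(3) by (metis le_add_diff_inverse add.commute)
    let ?z = "form_vec (w k)" let ?Y = "sym_vec (pt (Suc k) 1)"
    have n: "ht_exp (Suc k) 1 = 2 * R (k + 1) + R k"
      by (simp add: ht_exp_def)
    have "1 \<le> s (Suc k + 1)"
      using s_pos[of "Suc k + 1"] by simp
    note y = elim(2)[rule_format, OF this, unfolded n]
    have "\<bar>dot3 ?z ?Y\<bar> = a * (a ^ q (k + 1) * a ^ q k)"
      using form_pt_next[of j] unfolding power_add[symmetric] by (simp add: j)
    then have "\<bar>real_of_int (dot3 ?z ?Y)\<bar> = of_int a * (of_int (det (w (k + 1))) * of_int (det (w k)))"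
      unfolding det_w of_int_mult[symmetric] of_int_abs[symmetric] by (simp only:)
    then have dot: "\<bar>real_of_int (dot3 ?z ?Y)\<bar> = of_int a * exp (\<delta> * (R (k + 1) + R k))"
      unfolding det_w_exp by (simp add: exp_add algebra_simps)
    have "ht ?z * err \<xi> ?Y \<le> exp (R k + B) * exp (- (1 - \<delta>) * (2 * R (k + 1) + R k) + \<kappa>1)"
      using zh y by (intro mult_mono) (auto simp: ht_nonneg err_nonneg)
    also have "\<dots> = exp (R k + B + (- (1 - \<delta>) * (2 * R (k + 1) + R k) + \<kappa>1))"
      by (rule exp_add[symmetric])
    also have "\<dots> \<le> exp (- 2)"
    proof -
      define X where "X = (1 - \<delta>) * (2 * R (k + 1) + R k)"
      have "(1 / 2) * (3 * R k) \<le> X"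
        unfolding X_def using assms R_mono[of k] R_pos[of k] by (intro mult_mono) auto
      then show ?thesis
        using elim(1) unfolding exp_le_cancel_iff minus_mult_left[symmetric] X_def[symmetric] using B(1) \<kappa>1 by simp
    qed
    also have "\<dots> \<le> 1 / 4"
    proof -
      have "(2::real) * 2 \<le> exp 1 * exp 1"
        using exp_ge_add_one_self[of 1] by (intro mult_mono) auto
      then have "4 \<le> exp (2::real)"
        by (simp flip: exp_add)
      then show ?thesis
        by (simp add: exp_minus field_simps)
    qed
    finally have small: "2 * ht ?z * err \<xi> ?Y \<le> 1 / 2"
      by simp
    have "1 * 1 \<le> of_int a * exp (\<delta> * (R (k + 1) + R k))"
      using a_pos delta_nonneg R_pos[of k] R_pos[of "k + 1"] by (intro mult_mono) auto
    then have lo: "exp (\<delta> * (R (k + 1) + R k)) / 2 \<le> size0 ?Y * \<bar>lform \<xi> ?z\<bar>"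
      and up: "size0 ?Y * \<bar>lform \<xi> ?z\<bar> \<le> 2 * of_int a * exp (\<delta> * (R (k + 1) + R k))"
    proof -
      assume one: "1 * 1 \<le> of_int a * exp (\<delta> * (R (k + 1) + R k))"
      have "1 * exp (\<delta> * (R (k + 1) + R k)) \<le> of_int a * exp (\<delta> * (R (k + 1) + R k))"
        using a_pos by (intro mult_right_mono) auto
      then show "exp (\<delta> * (R (k + 1) + R k)) / 2 \<le> size0 ?Y * \<bar>lform \<xi> ?z\<bar>"
        using dot3_bound[of ?z ?Y \<xi>] small one unfolding dot by linarith
      show "size0 ?Y * \<bar>lform \<xi> ?z\<bar> \<le> 2 * of_int a * exp (\<delta> * (R (k + 1) + R k))"
        using dot3_bound'[of ?Y \<xi> ?z] small one unfolding dot by linarith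
    qed
    have v: "- val_exp k = \<delta> * (R (k + 1) + R k) - (2 * R (k + 1) + R k)"
      by (simp add: val_exp_def algebra_simps)
    have "exp (2 * R (k + 1) + R k - \<kappa>1) * \<bar>lform \<xi> ?z\<bar> \<le> size0 ?Y * \<bar>lform \<xi> ?z\<bar>"
      using y by (intro mult_right_mono) auto
    also note up
    also have "2 * of_int a * exp (\<delta> * (R (k + 1) + R k)) \<le> exp \<kappa>2 * exp (\<delta> * (R (k + 1) + R k))"
      using \<kappa>2(3) by (intro mult_right_mono) auto
    finally have "exp (- (2 * R (k + 1) + R k - \<kappa>1)) * (exp (2 * R (k + 1) + R k - \<kappa>1) * \<bar>lform \<xi> ?z\<bar>)
       \<le> exp (- (2 * R (k + 1) + R k - \<kappa>1)) * (exp \<kappa>2 * exp (\<delta> * (R (k + 1) + R k)))"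
      by (intro mult_left_mono) auto
    then have "\<bar>lform \<xi> ?z\<bar> \<le> exp (- (2 * R (k + 1) + R k - \<kappa>1) + (\<kappa>2 + \<delta> * (R (k + 1) + R k)))"
      unfolding mult.assoc[symmetric] exp_add[symmetric] by (simp add: add.assoc)
    also have "\<dots> \<le> exp (- val_exp k + \<kappa>)"
      unfolding v \<kappa>_def using B(1) by simp
    finally have 4: "\<bar>lform \<xi> ?z\<bar> \<le> exp (- val_exp k + \<kappa>)" .
    have "exp (\<delta> * (R (k + 1) + R k)) \<le> 2 * (size0 ?Y * \<bar>lform \<xi> ?z\<bar>)"
      using lo by simp
    also have "\<dots> \<le> exp \<kappa>2 * (exp (2 * R (k + 1) + R k + \<kappa>1) * \<bar>lform \<xi> ?z\<bar>)"
      using \<kappa>2(4) y by (intro mult_mono mult_right_mono) (auto simp: size0_nonneg)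
    finally have "exp (- (\<kappa>2 + (2 * R (k + 1) + R k + \<kappa>1))) * exp (\<delta> * (R (k + 1) + R k)) \<le>
        exp (- (\<kappa>2 + (2 * R (k + 1) + R k + \<kappa>1))) * (exp \<kappa>2 * (exp (2 * R (k + 1) + R k + \<kappa>1) * \<bar>lform \<xi> ?z\<bar>))"
      by (intro mult_left_mono) auto
    then have "exp (- (\<kappa>2 + (2 * R (k + 1) + R k + \<kappa>1)) + \<delta> * (R (k + 1) + R k)) \<le> \<bar>lform \<xi> ?z\<bar>"
      unfolding mult.assoc[symmetric] exp_add[symmetric] by (simp add: add.assoc)
    moreover have "exp (- val_exp k - \<kappa>) \<le> exp (- (\<kappa>2 + (2 * R (k + 1) + R k + \<kappa>1)) + \<delta> * (R (k + 1) + R k))"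
      unfolding v \<kappa>_def using B(1) by simp
    ultimately have 3: "exp (- val_exp k - \<kappa>) \<le> \<bar>lform \<xi> ?z\<bar>"
      by linarith
    have "exp (R k + B) \<le> exp (R k + \<kappa>)"
      using \<kappa>1 \<kappa>2(1) by (simp add: \<kappa>_def)
    then have "ht ?z \<le> exp (R k + \<kappa>)"
      using zh[of k] by linarith
    then show ?case
      using z2 3 4 by blast
  qed
  moreover have "0 \<le> \<kappa>"
    using B(1) \<kappa>1 \<kappa>2(1) by (simp add: \<kappa>_def)
  ultimately show thesis
    using that by blast
qed

lemma exponents_xi:
  assumes "\<delta> * (1 + sturm_sigma s) < sturm_sigma s"
  defines "\<sigma> \<equiv> sturm_sigma s"
  shows "omega2 \<xi> = ereal ((2 - \<delta>) / \<sigma> + 1 - \<delta>)"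
    "omega2_hat \<xi> = ereal (1 + (1 - \<delta>) * (1 + \<sigma>))"
    "lambda2_hat \<xi> = ereal ((1 - \<delta>) * (1 + \<sigma>) / (1 + (1 - \<delta>) * (1 + \<sigma>)))"
    "ereal (1 - \<delta>) \<le> lambda2 \<xi>"
    "lambda2 \<xi> \<le> ereal (max (1 - \<delta>) (1 / (1 - \<delta> + \<sigma>)))"
proof -
  have half: "\<delta> \<le> 1 / 2"
  proof -
    have "\<delta> * (1 + \<sigma>) < 1 / 2 * (1 + \<sigma>)"
    proof -
      have "\<sigma> \<le> 1 / 2 * (1 + \<sigma>)"
        using sigma_bounds by (simp add: \<sigma>_def)
      then show ?thesis
        using assms(1) unfolding \<sigma>_def by (rule less_le_trans[rotated])
    qed
    then show ?thesis
      using sigma_bounds by (simp add: \<sigma>_def mult_less_cancel_right)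
  qed
  then have "\<delta> \<le> 1" by simp
  then obtain \<kappa>1 where \<kappa>1: "0 \<le> \<kappa>1" and ev1: "\<forall>\<^sub>F k in sequentially. \<forall>l\<le>s (k + 1). pt_estimate \<kappa>1 k l"
    using pt_bounds_closed by blast
  obtain \<kappa>2 where \<kappa>2: "0 \<le> \<kappa>2" and ev2: "\<forall>\<^sub>F k in sequentially.
     form_estimate \<kappa>2 k"
    using form_bounds[OF half] .
  define \<kappa> where "\<kappa> = \<kappa>1 + \<kappa>2"
  have le: "exp (x - \<kappa>) \<le> exp (x - \<kappa>1)" "exp (x + \<kappa>1) \<le> exp (x + \<kappa>)"
    "exp (x - \<kappa>) \<le> exp (x - \<kappa>2)" "exp (x + \<kappa>2) \<le> exp (x + \<kappa>)" for x
    using \<kappa>1 \<kappa>2 by (simp_all add: \<kappa>_def)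
  interpret sturm_system s R \<delta> \<sigma> \<xi> \<kappa> "\<lambda>k. form_vec (w k)" "\<lambda>k l. sym_vec (pt k l)"
    "\<lambda>k l. (real l + 1) * R k + R (k - 1)" "\<lambda>k. (2 - \<delta>) * R (k + 1) + (1 - \<delta>) * R k"
  proof (unfold_locales, unfold \<sigma>_def ht_exp_def[symmetric] val_exp_def[symmetric])
    show "\<And>k. 0 < s k" "\<And>k. k \<ge> 1 \<Longrightarrow> R (k + 1) = real (s (k + 1)) * R k + R (k - 1)" "\<And>k. 0 < R k"
      "\<And>k. R k \<le> R (k + 1)" "filterlim R at_top sequentially" "0 \<le> \<delta>"
      by (fact s_pos R_rec R_pos R_mono R_lim delta_nonneg)+
    show "0 < sturm_sigma s" "sturm_sigma s \<le> 1"
      by (rule sigma_bounds)+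
    show "\<delta> * (1 + sturm_sigma s) < sturm_sigma s"
      by (rule assms)
    show "0 \<le> \<kappa>"
      using \<kappa>1 \<kappa>2 by (simp add: \<kappa>_def)
    show "\<forall>\<^sub>F k in sequentially. \<tau> * R (k + 1) \<le> R k" if "\<tau> < sturm_sigma s" for \<tau>
      using ratio_eventually[OF that] C_pos unfolding R_def by (simp add: mult.left_commute)
    show "\<exists>\<^sub>F k in sequentially. R k \<le> \<tau> * R (k + 1)" if "sturm_sigma s < \<tau>" for \<tau>
      using ratio_frequently[OF that] C_pos unfolding R_def by (simp add: mult.left_commute)
    show "\<forall>\<^sub>F k in sequentially. \<forall>l\<le>s (k + 1). primitive (sym_vec (pt k l)) \<and>
        dot3 (sym_vec (pt k l)) (form_vec (w k)) = 0 \<and>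
        pt_estimate \<kappa> k l"
      using ev1 eventually_ge_at_top[of 1]
    proof eventually_elim
      case (elim k)
      obtain j where j: "k = j + 1"
        using elim(2) by (metis le_add_diff_inverse add.commute)
      have "dot3 x y = dot3 y x" for x y
        by (cases x; cases y) (simp add: mult.commute)
      then have "primitive (sym_vec (pt k l)) \<and> dot3 (sym_vec (pt k l)) (form_vec (w k)) = 0" for l
        using primitive_pt[of j l] form_pt_orthogonal[of j l] unfolding j by metis
      then show ?case
        using elim(1) le by (meson order_trans)
    qed
    show "\<forall>\<^sub>F k in sequentially. primitive (form_vec (w k)) \<and>
        form_estimate \<kappa> k"
      using ev2 eventually_ge_at_top[of 1]
    proof eventually_elim
      case (elim k)
      obtain j where j: "k = j + 1"
        using elim(2) by (metis le_add_diff_inverse add.commute)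
      have "primitive (form_vec (w k))"
        using primitive_form[of j] unfolding j .
      then show ?case
        using elim(1) le by (meson order_trans)
    qed
  qed
  show "omega2 \<xi> = ereal ((2 - \<delta>) / \<sigma> + 1 - \<delta>)"
    "omega2_hat \<xi> = ereal (1 + (1 - \<delta>) * (1 + \<sigma>))"
    "lambda2_hat \<xi> = ereal ((1 - \<delta>) * (1 + \<sigma>) / (1 + (1 - \<delta>) * (1 + \<sigma>)))"
    "ereal (1 - \<delta>) \<le> lambda2 \<xi>"
    "lambda2 \<xi> \<le> ereal (max (1 - \<delta>) (1 / (1 - \<delta> + \<sigma>)))"
    by (fact exponents)+
qed

end

section \<open>Sturmian type and the choice of parameters\<close>

lemma sturm_t_1: "sturm_t s 1 = 0"
  by (simp add: sturm_t_def sturm_s_def)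

lemma sturm_t_Suc: "k \<ge> 1 \<Longrightarrow> sturm_t s (k + 1) = sturm_t s k + int (s (k + 1))"
  by (simp add: sturm_t_def sturm_s_def)

lemma Gcd_le_1I:
  assumes "\<And>d. d dvd x \<Longrightarrow> d dvd y \<Longrightarrow> d dvd z \<Longrightarrow> is_unit d"
  shows "Gcd {x, y, z} \<le> (1 :: int)"
proof -
  have "is_unit (Gcd {x, y, z})"
    by (rule assms) (rule Gcd_dvd, simp)+
  then show ?thesis
    by (simp add: zdvd1_eq)
qed

lemma proj_class_scale:
  assumes "c \<noteq> 0"
  shows "proj_class (c *\<^sub>R x) = proj_class x"
proof -
  have "\<exists>d. d \<noteq> 0 \<and> e *\<^sub>R x = d *\<^sub>R c *\<^sub>R x" if "e \<noteq> 0" for e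
    using that assms by (intro exI[of _ "e / c"]) simp
  then show ?thesis
    unfolding proj_class_def using assms by (auto, metis mult_eq_0_iff scaleR_scaleR)
qed

context sturm_matrices
begin

section \<open>Enumeration of the points and their limit\<close>

lemma sturm_t_less:
  assumes "1 \<le> k" "k < k'"
  shows "sturm_t s k + int (s (k + 1)) \<le> sturm_t s k'"
  using Suc_leI[OF assms(2)]
proof (induction k' rule: dec_induct)
  case base
  then show ?case using sturm_t_Suc[OF assms(1), of s] by simp
next
  case (step j)
  then show ?case
    using sturm_t_Suc[of j s] assms(1) by simp
qed

lemma sturm_t_ge: "int k \<le> sturm_t s (k + 1)"
proof (induction k)
  case 0
  then show ?case using sturm_t_1[of s] by simp
next
  case (Suc k)
  then show ?case
    using sturm_t_Suc[of "k + 1" s] s_pos[of "k + 2"] by simp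
qed

lemma index_unique:
  assumes "1 \<le> k" "l < s (k + 1)" "1 \<le> k'" "l' < s (k' + 1)"
    "sturm_t s k + int l = sturm_t s k' + int l'"
  shows "k = k' \<and> l = l'"
proof -
  have "\<not> k < k'" "\<not> k' < k"
    using sturm_t_less[of k k'] sturm_t_less[of k' k] assms by linarith+
  then show ?thesis
    using assms(5) by (simp add: not_less)
qed

text \<open>The bound \<open>K0\<close> on the block is kept because the limit needs blocks beyond
  any given one; \<open>K0 = 0\<close> covers all indices from 0 on.\<close>

lemma index_exists:
  assumes "sturm_t s (K0 + 1) \<le> i"
  obtains k l where "K0 < k" "l < s (k + 1)" "i = sturm_t s k + int l"
proof -
  have "i < sturm_t s (nat i + 2) \<or> i < 0"
    using sturm_t_ge[of "nat i + 1"] by (cases "i < 0") (simp_all, linarith?)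
  then have ex: "\<exists>j. i < sturm_t s (K0 + 2 + j)"
  proof
    assume "i < sturm_t s (nat i + 2)"
    also have "sturm_t s (nat i + 2) \<le> sturm_t s (K0 + 2 + nat i)"
      using sturm_t_less[of "nat i + 2" "K0 + 2 + nat i"] by (cases K0) auto
    finally show ?thesis by blast
  next
    assume "i < 0"
    then show ?thesis
      using sturm_t_ge[of "K0 + 1"] by (intro exI[of _ 0]) simp
  qed
  define Q where "Q j \<longleftrightarrow> i < sturm_t s (K0 + 2 + j)" for j
  define j where "j = (LEAST j. Q j)"
  have j: "i < sturm_t s (K0 + 2 + j)"
    using LeastI_ex[of Q] ex unfolding j_def Q_def by blast
  have le: "sturm_t s (K0 + 1 + j) \<le> i"
  proof (cases j)
    case (Suc j')
    then have "\<not> Q j'"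
      unfolding j_def by (intro not_less_Least) simp
    then show ?thesis
      using Suc by (simp add: Q_def)
  qed (use assms in simp)
  define l where "l = nat (i - sturm_t s (K0 + 1 + j))"
  have "int l = i - sturm_t s (K0 + 1 + j)"
    using le by (simp add: l_def)
  moreover have "sturm_t s (K0 + 2 + j) = sturm_t s (K0 + 1 + j) + int (s (K0 + 1 + j + 1))"
    using sturm_t_Suc[of "K0 + 1 + j" s] by simp
  ultimately show thesis
    using j by (intro that[of "K0 + 1 + j" l]) auto
qed

definition pt_seq :: "int \<Rightarrow> int^2^2" where
  "pt_seq i = (if i = - 2 then w 0 ** transpose N else if i = - 1 then w 1 ** N
     else (THE Y. \<exists>k\<ge>1. \<exists>l<s (k + 1). i = sturm_t s k + int l \<and> Y = pt k l))"

lemma pt_seq_eq: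
  assumes "1 \<le> k" "l < s (k + 1)"
  shows "pt_seq (sturm_t s k + int l) = pt k l"
proof -
  have "0 \<le> sturm_t s k"
    using sturm_t_ge[of "k - 1"] assms(1) by simp
  then have "pt_seq (sturm_t s k + int l) =
      (THE Y. \<exists>k'\<ge>1. \<exists>l'<s (k' + 1). sturm_t s k + int l = sturm_t s k' + int l' \<and> Y = pt k' l')"
    by (simp add: pt_seq_def)
  also have "\<dots> = pt k l"
    using assms index_unique by (intro the_equality) blast+
  finally show ?thesis .
qed

lemma associated_pt_seq: "associated_points s w N pt_seq"
  unfolding associated_points_def
proof (intro conjI allI impI)
  show "pt_seq (- 2) = w 0 ** transpose N" "pt_seq (- 1) = w 1 ** N"
    by (simp_all add: pt_seq_def)
  fix k l assume "1 \<le> k" "l < s (k + 1)"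
  then show "pt_seq (sturm_t s k + int l) =
      mat_power (w k) (l + 1) ** w (k - 1) ** (if even k then N else transpose N)"
    by (simp add: pt_seq_eq pt_def word_def Nk_def)
qed

lemma content_le_1:
  assumes "- 2 \<le> i"
  shows "point_content (pt_seq i) \<le> 1"
proof -
  have unit: "is_unit d" if "d dvd x" "d dvd - a" "a dvd x + 1" for d x
    using coprime_dvd_power_unit[of a x d 1] that by (simp del: zdvd1_eq)
  consider "i = - 2" | "i = - 1" | "sturm_t s (0 + 1) \<le> i"
    using assms sturm_t_1[of s] by (simp, linarith)
  then show ?thesis
  proof cases
    case 1
    have e: "(w 0 ** transpose N) $ 1 $ 1 = a * (b + 2) - 1" "(w 0 ** transpose N) $ 1 $ 2 = - a"
      by (simp_all add: mult_nth transpose_nth N_def algebra_simps)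
    show ?thesis
      unfolding point_content_def
    proof (rule Gcd_le_1I)
      fix d assume "d dvd pt_seq i $ 1 $ 1" "d dvd pt_seq i $ 1 $ 2"
      then show "is_unit d"
        unfolding 1 pt_seq_def by (intro unit) (auto simp: e simp del: sturm_w.simps One_nat_def)
    qed
  next
    case 2
    have e: "(w 1 ** N) $ 1 $ 1 = a * (b + 1) - 1" "(w 1 ** N) $ 1 $ 2 = - a"
      by (simp_all add: mult_nth transpose_nth N_def algebra_simps)
    show ?thesis
      unfolding point_content_def
    proof (rule Gcd_le_1I)
      fix d assume "d dvd pt_seq i $ 1 $ 1" "d dvd pt_seq i $ 1 $ 2"
      then show "is_unit d"
        unfolding 2 pt_seq_def by (intro unit) (auto simp: e simp del: sturm_w.simps One_nat_def)
    qed
  next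
    case 3
    then obtain k l where kl: "0 < k" "l < s (k + 1)" "i = sturm_t s k + int l"
      by (rule index_exists)
    then have "pt_seq i = pt (k - 1 + 1) l"
      using pt_seq_eq[of k l] by simp
    then show ?thesis
      unfolding point_content_def using pt_content by (intro Gcd_le_1I) metis
  qed
qed

lemma limit_pt_seq:
  assumes "\<delta> \<le> 1"
  shows "limitin proj_plane (\<lambda>i. proj_class (point_vec (pt_seq i))) (proj_class (vector [1, \<xi>, \<xi>\<^sup>2])) at_top"
proof -
  let ?X = "vector [1, \<xi>, \<xi>\<^sup>2] :: real^3"
  have X0: "?X \<noteq> 0"
  proof
    assume "?X = 0"
    then have "?X $ 1 = 0" by simp
    then show False by (simp add: vector_3)
  qed
  obtain \<kappa> where ev: "\<forall>\<^sub>F k in sequentially. \<forall>l<s (k + 1). pt_estimate \<kappa> k l"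
    using pt_bounds[OF assms] by blast
  \<comment> \<open>The representative with first coordinate 1. It converges in the affine space,
    and open sets of the quotient topology have open preimages there.\<close>
  define Z where "Z i = (1 / real_of_int (pt_seq i $ 1 $ 1)) *\<^sub>R point_vec (pt_seq i)" for i
  have near: "\<forall>\<^sub>F i in at_top. pt_seq i $ 1 $ 1 \<noteq> 0 \<and> dist (Z i) ?X < e" if "0 < e" for e
  proof -
    have small: "\<forall>\<^sub>F k in sequentially. 2 * exp (2 * \<kappa> - R k) < e"
    proof -
      have "\<forall>\<^sub>F k in sequentially. 2 * \<kappa> - ln (e / 2) < R k"
        using R_lim unfolding filterlim_at_top_dense by blast
      then show ?thesis
      proof eventually_elim
        case (elim k)
        then have "exp (2 * \<kappa> - R k) < exp (ln (e / 2))"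
          by simp
        then show ?case
          using that by simp
      qed
    qed
    obtain K0 where K0: "\<And>k. K0 \<le> k \<Longrightarrow> 2 * exp (2 * \<kappa> - R k) < e \<and> (\<forall>l<s (k + 1).
       pt_estimate \<kappa> k l)"
      using eventually_conj[OF small ev] unfolding eventually_sequentially by blast
    show ?thesis
      using eventually_ge_at_top[of "sturm_t s (K0 + 1)"]
    proof eventually_elim
      case (elim i)
      then obtain k l where kl: "K0 < k" "l < s (k + 1)" "i = sturm_t s k + int l"
        by (rule index_exists)
      have Y: "pt_seq i = pt k l"
        using kl pt_seq_eq[of k l] by simp
      let ?n = "ht_exp k l"
      have b: "2 * exp (2 * \<kappa> - R k) < e" "exp (?n - \<kappa>) \<le> size0 (sym_vec (pt k l))"
        "err \<xi> (sym_vec (pt k l)) \<le> exp (- (1 - \<delta>) * ?n + \<kappa>)"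
        using K0[of k] kl by auto
      define y0 y1 y2 where "y0 = real_of_int (pt k l $ 1 $ 1)" and "y1 = real_of_int (pt k l $ 1 $ 2)"
        and "y2 = real_of_int (pt k l $ 2 $ 2)"
      have size: "size0 (sym_vec (pt k l)) = \<bar>y0\<bar>"
        by (simp add: sym_vec_def y0_def)
      have pos: "0 < \<bar>y0\<bar>"
        using b(2) exp_gt_zero[of "?n - \<kappa>"] unfolding size by linarith
      have e12: "\<bar>y0 * \<xi> - y1\<bar> \<le> err \<xi> (sym_vec (pt k l))" "\<bar>y0 * \<xi>\<^sup>2 - y2\<bar> \<le> err \<xi> (sym_vec (pt k l))"
        by (simp_all add: sym_vec_def y0_def y1_def y2_def)
      have n0: "R k \<le> ?n" "0 \<le> ?n"
        using ht_exp_ge[of k l] R_pos[of k] by linarith+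
      have "- (1 - \<delta>) * ?n \<le> 0"
        using n0 assms by (simp add: mult_nonpos_nonneg)
      then have "exp (- (1 - \<delta>) * ?n + \<kappa>) \<le> exp \<kappa>"
        by simp
      then have "err \<xi> (sym_vec (pt k l)) \<le> exp \<kappa>"
        using b(3) by linarith
      then have "err \<xi> (sym_vec (pt k l)) / \<bar>y0\<bar> \<le> exp \<kappa> / exp (?n - \<kappa>)"
        using b(2) unfolding size by (intro frac_le) auto
      also have "\<dots> = exp (\<kappa> - (?n - \<kappa>))"
        by (rule exp_diff[symmetric])
      also have "\<dots> \<le> exp (2 * \<kappa> - R k)"
        using n0 by simp
      finally have q: "err \<xi> (sym_vec (pt k l)) / \<bar>y0\<bar> \<le> exp (2 * \<kappa> - R k)" .
      have comp: "\<bar>y / y0 - \<eta>\<bar> \<le> exp (2 * \<kappa> - R k)" if "\<bar>y0 * \<eta> - y\<bar> \<le> err \<xi> (sym_vec (pt k l))" for y \<eta>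
      proof -
        have "\<bar>y / y0 - \<eta>\<bar> = \<bar>y0 * \<eta> - y\<bar> / \<bar>y0\<bar>"
          using pos by (simp add: abs_divide[symmetric] diff_divide_distrib abs_minus_commute)
        also have "\<dots> \<le> err \<xi> (sym_vec (pt k l)) / \<bar>y0\<bar>"
          using that pos by (intro divide_right_mono) auto
        finally show ?thesis
          using q by linarith
      qed
      have Zc: "(Z i - ?X) $ 1 = 0" "(Z i - ?X) $ 2 = y1 / y0 - \<xi>" "(Z i - ?X) $ 3 = y2 / y0 - \<xi>\<^sup>2"
        using pos by (simp_all add: Z_def Y point_vec_def vector_3 y0_def y1_def y2_def)
      have "dist (Z i) ?X \<le> (\<Sum>j\<in>UNIV. \<bar>(Z i - ?X) $ j\<bar>)"
        unfolding dist_norm by (rule norm_le_l1_cart)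
      also have "\<dots> = \<bar>y1 / y0 - \<xi>\<bar> + \<bar>y2 / y0 - \<xi>\<^sup>2\<bar>"
        by (simp only: sum_3 Zc abs_zero add_0_left)
      also have "\<dots> \<le> 2 * exp (2 * \<kappa> - R k)"
        using comp[OF e12(1)] comp[OF e12(2)] by linarith
      finally have "dist (Z i) ?X < e"
        using b(1) by linarith
      then show ?case
        using pos by (simp add: Y y0_def)
    qed
  qed
  show ?thesis
    unfolding limitin_def
  proof (intro conjI allI impI)
    show "proj_class ?X \<in> topspace proj_plane"
      unfolding topspace_proj_plane using X0 by blast
    fix U assume U: "openin proj_plane U \<and> proj_class ?X \<in> U"
    let ?V = "{x. x \<noteq> 0 \<and> proj_class x \<in> U}"
    have "open ?V" "?X \<in> ?V"
      using U X0 by (auto simp: openin_proj_plane)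
    then obtain e where e: "0 < e" "\<And>x. dist x ?X < e \<Longrightarrow> x \<in> ?V"
      unfolding open_dist by blast
    show "\<forall>\<^sub>F i in at_top. proj_class (point_vec (pt_seq i)) \<in> U"
      using near[OF e(1)]
    proof eventually_elim
      case (elim i)
      then have "proj_class (Z i) = proj_class (point_vec (pt_seq i))"
        unfolding Z_def by (intro proj_class_scale) simp
      moreover have "Z i \<in> ?V"
        using elim e(2) by blast
      ultimately show ?case by simp
    qed
  qed
qed

lemma growth_w: "multiplicative_growth s w"
proof -
  have "1 * mat_norm (w k) * mat_norm (mat_power (w k) (l - 1) ** w (k - 1)) \<le> mat_norm (mat_power (w k) l ** w (k - 1)) \<and>
    mat_norm (mat_power (w k) l ** w (k - 1)) \<le> 2 * mat_norm (w k) * mat_norm (mat_power (w k) (l - 1) ** w (k - 1))"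
    if "1 \<le> l" for k l
  proof -
    have "mat_power (w k) l ** w (k - 1) = w k ** (mat_power (w k) (l - 1) ** w (k - 1))"
      using that by (cases l) (simp_all add: mat_power_Suc matrix_mul_assoc)
    then show ?thesis
      using tame_norm_mult[OF tame_w tame_power_mult[OF tame_w tame_w]] by simp
  qed
  moreover have "0 < (1 :: real)" "0 < (2 :: real)"
    by simp_all
  ultimately show ?thesis
    unfolding multiplicative_growth_def by blast
qed

lemma det_w_norm:
  obtains c1 c2 where "0 < c1" "0 < c2"
    "\<And>i. c1 * mat_norm (w i) powr \<delta> \<le> \<bar>real_of_int (det (w i))\<bar>"
    "\<And>i. \<bar>real_of_int (det (w i))\<bar> \<le> c2 * mat_norm (w i) powr \<delta>"
proof -
  obtain B where B: "0 \<le> B" "\<And>k. exp (R k - B) \<le> mat_norm (w k)" "\<And>k. mat_norm (w k) \<le> exp (R k + B)"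
    using norm_bound by metis
  show thesis
  proof (rule that[of "exp (- \<delta> * B)" "exp (\<delta> * B)"])
    fix i
    have pos: "0 \<le> mat_norm (w i)"
      using tame_norm_ge_1[OF tame_w, of i] by linarith
    have "mat_norm (w i) powr \<delta> \<le> exp (R i + B) powr \<delta>"
      using B(3) pos delta_nonneg by (intro powr_mono2) auto
    then have "exp (- \<delta> * B) * mat_norm (w i) powr \<delta> \<le> exp (- \<delta> * B) * exp ((R i + B) * \<delta>)"
      unfolding exp_powr_real by (intro mult_left_mono) auto
    then show "exp (- \<delta> * B) * mat_norm (w i) powr \<delta> \<le> \<bar>real_of_int (det (w i))\<bar>"
      unfolding det_w_exp exp_add[symmetric] by (simp add: algebra_simps)
    have "exp (R i - B) powr \<delta> \<le> mat_norm (w i) powr \<delta>"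
      using B(2) delta_nonneg by (intro powr_mono2) auto
    then have "exp (\<delta> * B) * exp ((R i - B) * \<delta>) \<le> exp (\<delta> * B) * mat_norm (w i) powr \<delta>"
      unfolding exp_powr_real by (intro mult_left_mono) auto
    then show "\<bar>real_of_int (det (w i))\<bar> \<le> exp (\<delta> * B) * mat_norm (w i) powr \<delta>"
      unfolding det_w_exp exp_add[symmetric] by (simp add: algebra_simps)
  qed auto
qed

lemma sturmian_type_xi:
  assumes "\<delta> * (1 + sturm_sigma s) < sturm_sigma s"
  shows "sturmian_type s \<xi>"
proof -
  have d1: "\<delta> < sturm_sigma s / (1 + sturm_sigma s)"
    using assms sigma_bounds by (simp add: field_simps)
  have "sturm_sigma s / (1 + sturm_sigma s) \<le> 1"
    using sigma_bounds by simp
  then have d2: "\<delta> \<le> 1"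
    using d1 by linarith
  have seq: "sturmian_seq s w"
    unfolding sturmian_seq_def using det_w_pos w_rec by (simp add: matM_def less_imp_neq[symmetric])
  have adm: "admissible_with w N"
    using symmetric_triple[of 0] det_Nk[of 0] a_pos
    by (simp add: admissible_with_def matM_def Nk_def del: sturm_w.simps)
  have nonsym: "\<not> symmetric_mat N"
    using a_pos by (simp add: symmetric_mat_iff N_def)
  have "filterlim r at_top sequentially"
    by (rule filterlim_at_top_mono[OF filterlim_tendsto_pos_mult_at_top[OF tendsto_const r_0_1(1) q_lim]])
      (simp add: r_lower)
  then have lim: "filterlim (\<lambda>i. mat_norm (w i)) at_top sequentially"
    unfolding norm_w by (rule filterlim_compose[OF exp_at_top])
  have content: "\<exists>B. \<forall>i\<ge>-2. point_content (pt_seq i) \<le> B"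
    using content_le_1 by blast
  obtain c1 c2 where "0 < c1" "0 < c2"
    "\<And>i. c1 * mat_norm (w i) powr \<delta> \<le> \<bar>real_of_int (det (w i))\<bar>"
    "\<And>i. \<bar>real_of_int (det (w i))\<bar> \<le> c2 * mat_norm (w i) powr \<delta>"
    using det_w_norm by blast
  then have det: "\<exists>\<delta>\<ge>0. \<delta> < sturm_sigma s / (1 + sturm_sigma s) \<and>
      (\<exists>c1>0. \<exists>c2>0. \<forall>i. c1 * mat_norm (w i) powr \<delta> \<le> \<bar>real_of_int (det (w i))\<bar> \<and>
        \<bar>real_of_int (det (w i))\<bar> \<le> c2 * mat_norm (w i) powr \<delta>)"
    using d1 delta_nonneg by blast
  show ?thesis
    unfolding sturmian_type_def
    using seq adm nonsym growth_w lim associated_pt_seq content det limit_pt_seq[OF d2] by blast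
qed

end

section \<open>The function \<open>sturm_h\<close> and density of the values of
  \<open>\<delta>\<close>\<close>

text \<open>With u = 1/(1+\<sigma>) the claim is \<sigma>/2 + u \<le> sqrt ((\<sigma>/2)^2 + 1);
  after squaring, it reads 1 - u + u^2 \<le> 1.\<close>

lemma sturm_h_le:
  assumes "0 < \<sigma>"
  shows "sturm_h \<sigma> \<le> \<sigma> / (1 + \<sigma>)"
proof -
  define u where "u = 1 / (1 + \<sigma>)"
  have u: "0 < u" "u * (1 + \<sigma>) = 1"
    using assms by (simp_all add: u_def)
  have u1: "u \<le> 1"
    using assms by (simp add: u_def)
  have "(\<sigma> / 2 + u)\<^sup>2 = (\<sigma> / 2)\<^sup>2 + (u * (1 + \<sigma>) - u + u * u)"
    by (simp add: power2_eq_square algebra_simps)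
  also have "u * (1 + \<sigma>) - u + u * u \<le> 1"
    unfolding u(2) using mult_left_le[OF u1, of u] u(1) by linarith
  finally have "\<sigma> / 2 + u \<le> sqrt ((\<sigma> / 2)\<^sup>2 + 1)"
    by (intro real_le_rsqrt) simp
  moreover have "\<sigma> / (1 + \<sigma>) = 1 - u"
    using assms by (simp add: u_def field_simps)
  ultimately show ?thesis
    by (simp add: sturm_h_def)
qed

text \<open>\<open>sturm_h \<sigma>\<close> is the smaller root of (1-x)(1-x+\<sigma>) = 1, as
  completing the square shows; below it the two terms of the maximum compare in favour of 1 -
  \<delta>.\<close>

lemma le_sturm_h_imp:
  assumes "\<delta> \<le> sturm_h \<sigma>" "0 < \<sigma>" "\<delta> < 1"
  shows "1 / (1 - \<delta> + \<sigma>) \<le> 1 - \<delta>"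
proof -
  have "sqrt ((\<sigma> / 2)\<^sup>2 + 1) \<le> 1 - \<delta> + \<sigma> / 2"
    using assms(1) by (simp add: sturm_h_def)
  then have "(sqrt ((\<sigma> / 2)\<^sup>2 + 1))\<^sup>2 \<le> (1 - \<delta> + \<sigma> / 2)\<^sup>2"
    by (intro power_mono) auto
  then have "(\<sigma> / 2)\<^sup>2 + 1 \<le> (1 - \<delta> + \<sigma> / 2)\<^sup>2"
    by simp
  then have "1 \<le> (1 - \<delta>) * (1 - \<delta> + \<sigma>)"
    by (simp add: power2_eq_square algebra_simps)
  then show ?thesis
    using assms by (subst pos_divide_le_eq) auto
qed

text \<open>With \<open>b\<close> close to \<open>a powr (1 / t - 1)\<close>, the value of \<open>\<delta>\<close> tends to \<open>t\<close> as \<open>a\<close> grows.\<close>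

lemma parameters_near:
  fixes t e :: real
  assumes "0 < t" "t < 1" "0 < e"
  obtains a b :: int where "1 \<le> a" "1 \<le> b"
    "ln (real_of_int a) / ln (real_of_int (a * (b + 1))) \<le> t"
    "t - e < ln (real_of_int a) / (ln (real_of_int (a * (b + 2))) + ln 2)"
proof -
  \<comment> \<open>Ensures e ln a > t ln 6. The 6 combines the ln 2 of the lower bound for \<delta>
    with the 3 in b + 2 \<le> 3 p.\<close>
  define a :: int where "a = \<lceil>exp (t * ln 6 / e)\<rceil> + 1"
  have "exp (t * ln 6 / e) < real_of_int a"
    by (simp add: a_def) linarith
  moreover have "1 \<le> exp (t * ln 6 / e)"
    using assms by simp
  ultimately have a: "exp (t * ln 6 / e) < real_of_int a" "1 < real_of_int a" "1 < a"
    by linarith+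
  define x where "x = ln (real_of_int a)"
  have x: "0 < x" "t * ln 6 / e < x"
  proof -
    show "0 < x"
      using a by (simp add: x_def)
    have "ln (exp (t * ln 6 / e)) < ln (real_of_int a)"
      using a by (subst ln_less_cancel_iff) auto
    then show "t * ln 6 / e < x"
      by (simp add: x_def)
  qed
  define \<tau> where "\<tau> = 1 / t - 1"
  have \<tau>: "0 < \<tau>"
    using assms by (simp add: \<tau>_def)
  define p where "p = real_of_int a powr \<tau>"
  have p: "1 \<le> p" "ln p = \<tau> * x"
    using a \<tau> by (simp_all add: p_def x_def ge_one_powr_ge_zero ln_powr)
  define b where "b = \<lfloor>p\<rfloor>"
  have b: "1 \<le> b" "p \<le> real_of_int (b + 1)" "real_of_int b \<le> p"
    using p(1) unfolding b_def by linarith+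
  have xt: "x + \<tau> * x = x / t"
    by (simp add: \<tau>_def algebra_simps)
  have split: "ln (real_of_int (a * j)) = x + ln (real_of_int j)" if "1 \<le> j" for j
    using that a by (simp add: ln_mult x_def)
  show thesis
  proof (rule that)
    show "1 \<le> a" "1 \<le> b"
      using a b by linarith+
    have "\<tau> * x \<le> ln (real_of_int (b + 1))"
      unfolding p(2)[symmetric] using b p(1) by (subst ln_le_cancel_iff) auto
    then have le: "x / t \<le> ln (real_of_int (a * (b + 1)))"
      using split[of "b + 1"] b xt by simp
    have "x / ln (real_of_int (a * (b + 1))) \<le> x / (x / t)"
      using le x assms by (intro divide_left_mono mult_pos_pos) (auto intro: less_le_trans[OF divide_pos_pos])
    then show "ln (real_of_int a) / ln (real_of_int (a * (b + 1))) \<le> t"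
      using x by (simp add: x_def)
    have "real_of_int (b + 2) \<le> 3 * p"
      using b p(1) by simp
    then have "ln (real_of_int (b + 2)) \<le> ln (3 * p)"
      using b by (subst ln_le_cancel_iff) auto
    also have "ln (3 * p) = ln 3 + \<tau> * x"
      using p by (simp add: ln_mult)
    finally have "ln (real_of_int (a * (b + 2))) + ln 2 \<le> x / t + (ln 3 + ln 2)"
      using split[of "b + 2"] b xt by simp
    also have "ln 3 + ln 2 = ln (6::real)"
      using ln_mult[of 3 "2::real"] by simp
    finally have up: "ln (real_of_int (a * (b + 2))) + ln 2 \<le> x / t + ln 6" .
    have "0 \<le> ln (real_of_int (b + 2))"
      using b by simp
    then have pos: "0 < ln (real_of_int (a * (b + 2))) + ln 2"
      using split[of "b + 2"] b x by (simp add: add_pos_pos add_pos_nonneg)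
    have "(t - e) * (x / t + ln 6) < x"
    proof -
      have "t * ln 6 < e * x"
        using x(2) assms by (simp add: field_simps)
      moreover have "(t - e) * (x / t) = x - e * x / t"
        using assms by (simp add: field_simps)
      moreover have "e * x \<le> e * x / t"
        using assms x by (simp add: field_simps mult_left_le)
      moreover have "0 < e * ln 6"
        using assms by simp
      ultimately show ?thesis
        by (simp add: algebra_simps)
    qed
    then have "t - e < x / (x / t + ln 6)"
      using x assms by (subst pos_less_divide_eq) (auto intro: add_pos_pos)
    also have "\<dots> \<le> x / (ln (real_of_int (a * (b + 2))) + ln 2)"
      using up pos x assms by (intro divide_left_mono mult_pos_pos) (auto intro: add_pos_pos)
    finally show "t - e < ln (real_of_int a) / (ln (real_of_int (a * (b + 2))) + ln 2)"
      by (simp add: x_def)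
  qed
qed

theorem theorem1p1:
  fixes s :: "nat \<Rightarrow> nat" and \<sigma> :: real
  assumes s_pos: "\<And>k. s k > 0"
    and s_bounded: "bdd_above (range s)"
    and sigma: "\<sigma> = sturm_sigma s"
  shows "sturm_h \<sigma> \<le> \<sigma> / (1 + \<sigma>) \<and>
    (\<exists>\<Delta> :: real set.
       \<Delta> \<subseteq> {0..\<sigma> / (1 + \<sigma>)} \<and> 0 \<in> \<Delta> \<and> {0..\<sigma> / (1 + \<sigma>)} \<subseteq> closure \<Delta> \<and>
       (\<forall>\<delta>\<in>\<Delta>. \<exists>\<xi>.
          sturmian_type s \<xi> \<and>
          omega2 \<xi> = ereal ((2 - \<delta>) / \<sigma> + 1 - \<delta>) \<and>
          omega2_hat \<xi> = ereal (1 + (1 - \<delta>) * (1 + \<sigma>)) \<and>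
          lambda2_hat \<xi> = ereal ((1 - \<delta>) * (1 + \<sigma>) / (1 + (1 - \<delta>) * (1 + \<sigma>))) \<and>
          ereal (1 - \<delta>) \<le> lambda2 \<xi> \<and>
          lambda2 \<xi> \<le> ereal (max (1 - \<delta>) (1 / (1 - \<delta> + \<sigma>))) \<and>
          (\<delta> \<in> {0..sturm_h \<sigma>} \<longrightarrow> lambda2 \<xi> = ereal (1 - \<delta>))))"
proof -
  obtain S where "\<And>k. s k \<le> S"
    using s_bounded unfolding bdd_above_def by auto
  then interpret bounded_quotients s S
    by unfold_locales (use s_pos in auto)
  have \<sigma>: "0 < \<sigma>" "\<sigma> \<le> 1"
    using sigma_bounds by (simp_all add: sigma)
  let ?u = "\<sigma> / (1 + \<sigma>)"
  define P where "P \<delta> \<xi> \<longleftrightarrow> sturmian_type s \<xi> \<and>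
      omega2 \<xi> = ereal ((2 - \<delta>) / \<sigma> + 1 - \<delta>) \<and>
      omega2_hat \<xi> = ereal (1 + (1 - \<delta>) * (1 + \<sigma>)) \<and>
      lambda2_hat \<xi> = ereal ((1 - \<delta>) * (1 + \<sigma>) / (1 + (1 - \<delta>) * (1 + \<sigma>))) \<and>
      ereal (1 - \<delta>) \<le> lambda2 \<xi> \<and>
      lambda2 \<xi> \<le> ereal (max (1 - \<delta>) (1 / (1 - \<delta> + \<sigma>))) \<and>
      (\<delta> \<in> {0..sturm_h \<sigma>} \<longrightarrow> lambda2 \<xi> = ereal (1 - \<delta>))" for \<delta> \<xi>
  \<comment> \<open>The largest admissible choice, so only membership of the constructed values has
    to be shown.\<close>
  define \<Delta> where "\<Delta> = {\<delta> \<in> {0..?u}. \<exists>\<xi>. P \<delta> \<xi>}"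
  have member: "sturm_matrices.\<delta> s a b \<in> \<Delta>" if ab: "1 \<le> a" "1 \<le> b" and less: "sturm_matrices.\<delta> s a b < ?u" for a b
  proof -
    interpret sturm_matrices s S a b
      by unfold_locales (use ab in auto)
    have d: "\<delta> * (1 + sturm_sigma s) < sturm_sigma s"
      using less \<sigma> by (simp add: sigma field_simps)
    have "?u \<le> 1"
      using \<sigma> by simp
    then have d1: "\<delta> < 1"
      using less by linarith
    note ex = exponents_xi[OF d, folded sigma]
    have "lambda2 \<xi> = ereal (1 - \<delta>)" if "\<delta> \<in> {0..sturm_h \<sigma>}"
    proof -
      have "1 / (1 - \<delta> + \<sigma>) \<le> 1 - \<delta>"
        using le_sturm_h_imp[of \<delta> \<sigma>] that \<sigma> d1 by simp
      then show ?thesis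
        using ex(4,5) by (simp add: max_absorb1)
    qed
    then have "P \<delta> \<xi>"
      unfolding P_def using ex sturmian_type_xi[OF d] by blast
    then show ?thesis
      unfolding \<Delta>_def using delta_nonneg less by auto
  qed
  have "0 \<in> \<Delta>"
  proof -
    interpret sturm_matrices s S 1 1
      by unfold_locales auto
    have "\<delta> = 0"
      by (simp add: \<delta>_def)
    then show ?thesis
      using member[of 1 1] \<sigma> by simp
  qed
  moreover have "{0..?u} \<subseteq> closure \<Delta>"
  proof -
    \<comment> \<open>Interior points suffice, and they are approximated from below: \<delta> \<le>
      t keeps \<delta> strictly under \<sigma>/(1+\<sigma>).\<close>
    have "t \<in> closure \<Delta>" if t: "t \<in> {0<..<?u}" for t
      unfolding closure_approachable
    proof (intro allI impI)
      fix e :: real assume e: "0 < e"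
      have "?u \<le> 1"
        using \<sigma> by simp
      then have "0 < t" "t < 1"
        using t by auto
      then obtain a b where ab: "1 \<le> a" "1 \<le> b" "ln (real_of_int a) / ln (real_of_int (a * (b + 1))) \<le> t"
        "t - e < ln (real_of_int a) / (ln (real_of_int (a * (b + 2))) + ln 2)"
        using parameters_near[OF _ _ e] by blast
      interpret sturm_matrices s S a b
        by unfold_locales (use ab in auto)
      have "\<delta> \<le> t" "t - e < \<delta>"
        using delta_bounds ab(3,4) by linarith+
      then show "\<exists>y\<in>\<Delta>. dist y t < e"
        using member[OF ab(1,2)] t by (intro bexI[of _ \<delta>]) (auto simp: dist_real_def)
    qed
    then have "closure {0<..<?u} \<subseteq> closure \<Delta>"
      by (intro closure_minimal) auto
    then show ?thesis
      using \<sigma> by simp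
  qed
  ultimately show ?thesis
    using sturm_h_le[OF \<sigma>(1)] unfolding P_def[symmetric] by (intro conjI exI[of _ \<Delta>]) (auto simp: \<Delta>_def)
qed

end
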